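(* Let $\Omega\subset\mathbb{R}^d$ be a bounded $C^2$ domain equipped with heterogeneous localization functions $\eta_\delta$, $0<\delta<\delta_0$, and let $\rho$ be an admissible kernel (as defined in the context). Then there exists a constant $C$ depending only on $d$, $\Omega$ and $\rho$ such that the following holds for every $\delta\in(0,\delta_0)$. Let $f\in H^1(\Omega)$ and suppose that $u\in\mathfrak{W}^{\delta,2}_0(\Omega)$ is a weak solution of $\mathcal{L}_\delta u=f$ in $\Omega$, $u=0$ on $\partial\Omega$, i.e. $$B_{\rho,\delta}(u,v)=\langle f,v\rangle\qquad\text{for all }v\in\mathfrak{W}^{\delta,2}_0(\Omega).$$ Then $$\|u\|_{H^1(\Omega)}\le C\Big(\|f\|_{[\mathfrak{W}^{\delta,2}_0(\Omega)]^*}+\|\Phi_{\delta,2}^{-1}f\|_{H^1(\Omega)}\Big).$$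
   Context: Domain and localization functions. $\Omega\subset\mathbb{R}^d$ is a bounded $C^2$ domain. There are constants $\kappa_0\in(0,1)$ and $\kappa_1,\kappa_2,\bar\kappa_0>0$ depending at most on $d$ and $\Omega$ and, with $\delta_0:=\min\{1,\frac{1}{9\kappa_1^2},\frac{1}{2\bar\kappa_0^2}\}$, for every $0<\delta<\delta_0$ a function $\eta_\delta:\overline\Omega\to[0,\infty)$, positive in $\Omega$, such that: (i) $\eta_\delta(x)=\operatorname{dist}(x,\partial\Omega)^2$ for $x\in\Omega$ with $\operatorname{dist}(x,\partial\Omega)^2<\kappa_0\delta$; (ii) $\eta_\delta(x)=\delta$ for $x\in\Omega$ with $\kappa_0\operatorname{dist}(x,\partial\Omega)^2>\delta$; (iii) $\eta_\delta\in C^2(\overline\Omega)$ with $|\nabla\eta_\delta|\le\kappa_1\sqrt\delta$ and $|\nabla^2\eta_\delta|\le\kappa_2$ in $\Omega$; (iv) $\eta_\delta(x)\le\bar\kappa_0\min\{\delta,\operatorname{dist}(x,\partial\Omega)^2\}$ in $\Omega$. These data are fixed with $\Omega$; a constant "depending on $\Omega$" may depend on $\kappa_0,\kappa_1,\kappa_2,\bar\kappa_0$ but not on $\delta$. Kernel. $\rho:[0,\infty)\to[0,\infty)$ is admissible if there are constants $0<\rho_0<\infty$ and $0<r_0<R_0<1$ such that $\rho\in C^1([0,\infty))$, $\rho\ge0$, $\lim_{r\to0^+}\rho'(r)/r$ exists, $\operatorname{supp}\rho\subset[0,R_0)$, and $\rho(r)\ge\rho_0$ for all $r\in[0,r_0]$.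 For $\alpha\in\mathbb{R}$ set $\rho_{\delta,\alpha}(x,y):=\frac12\Big[\frac{1}{\eta_\delta(x)^{d+\alpha}}\rho\big(\tfrac{|y-x|}{\eta_\delta(x)}\big)+\frac{1}{\eta_\delta(y)^{d+\alpha}}\rho\big(\tfrac{|y-x|}{\eta_\delta(y)}\big)\Big]$, $\Phi_{\delta,\alpha}(x):=\int_\Omega\rho_{\delta,\alpha}(x,y)\,dy$, $\mathcal{L}_\delta u(x):=2\int_\Omega\rho_{\delta,2}(x,y)(u(x)-u(y))\,dy$, and $B_{\rho,\delta}(u,v):=\int_\Omega\int_\Omega\rho_{\delta,2}(x,y)(u(x)-u(y))(v(x)-v(y))\,dy\,dx$. Function spaces. Fix a constant $R\in(0,1)$ (constants may depend on this fixed choice). $[u]_{\mathfrak{W}^{\delta,2}(\Omega)}^2:=\int_\Omega\int_{\Omega\cap\{|y-x|\le R\eta_\delta(x)\}}\frac{|u(x)-u(y)|^2}{\eta_\delta(x)^{d+2}}\,dy\,dx$, $\|u\|_{\mathfrak{W}^{\delta,2}(\Omega)}^2:=\|u\|_{L^2(\Omega)}^2+[u]_{\mathfrak{W}^{\delta,2}(\Omega)}^2$; $\mathfrak{W}^{\delta,2}(\Omega)$ and $\mathfrak{W}^{\delta,2}_0(\Omega)$ are the closures of $C^\infty(\overline\Omega)$ and of $C^\infty_c(\Omega)$, respectively, in this norm. $f\in H^1(\Omega)\subset L^2(\Omega)$ is regarded as an element of $[\mathfrak{W}^{\delta,2}_0(\Omega)]^*$ through $\langle f,v\rangle=\int_\Omega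 fv\,dx$. *)

theory Defs
  imports "HOL-Analysis.Analysis"
begin

section \<open>Classes of differentiable functions\<close>

text \<open>\<open>C_k k S f\<close> is \<open>f \<in> C\<^sup>k(S)\<close> for an open set \<open>S\<close>.  A differentiable function is of class
  \<open>C\<^sup>k\<^sup>+\<^sup>1\<close> iff each of its directional derivatives is of class \<open>C\<^sup>k\<close>.\<close>

primrec C_k :: "nat \<Rightarrow> 'a::euclidean_space set \<Rightarrow> ('a \<Rightarrow> real) \<Rightarrow> bool" where
  "C_k 0 S f \<longleftrightarrow> continuous_on S f"
| "C_k (Suc k) S f \<longleftrightarrow>
     (\<forall>x\<in>S. f differentiable (at x)) \<and> (\<forall>v. C_k k S (\<lambda>x. frechet_derivative f (at x) v))"

text \<open>Test functions are taken on the whole space, i.e. extended by zero outside \<open>\<Omega>\<close>.\<close>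

definition Cc_infinity :: "'a::euclidean_space set \<Rightarrow> ('a \<Rightarrow> real) set" where
  "Cc_infinity \<Omega> = {\<phi>. (\<forall>k. C_k k UNIV \<phi>) \<and>
     compact (closure {x. \<phi> x \<noteq> 0}) \<and> closure {x. \<phi> x \<noteq> 0} \<subseteq> \<Omega>}"

text \<open>\<open>C2_closure \<Omega> f g H\<close>: \<open>f \<in> C\<^sup>2(closure \<Omega>)\<close>, where on \<open>\<Omega>\<close> the vector field \<open>g\<close> is the
  gradient and \<open>H\<close> the Hessian of \<open>f\<close>, and the values of \<open>g\<close> and \<open>H\<close> on the boundary are their
  continuous extensions.\<close>

definition C2_closure ::
  "'a::euclidean_space set \<Rightarrow> ('a \<Rightarrow> real) \<Rightarrow> ('a \<Rightarrow> 'a) \<Rightarrow> ('a \<Rightarrow> 'a \<Rightarrow>\<^sub>L 'a) \<Rightarrow> bool" where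
  "C2_closure \<Omega> f g H \<longleftrightarrow>
     (\<forall>x\<in>\<Omega>. (f has_derivative (\<lambda>h. g x \<bullet> h)) (at x)) \<and>
     (\<forall>x\<in>\<Omega>. (g has_derivative blinfun_apply (H x)) (at x)) \<and>
     continuous_on (closure \<Omega>) f \<and> continuous_on (closure \<Omega>) g \<and> continuous_on (closure \<Omega>) H"

section \<open>Domains, localization functions and kernels\<close>

text \<open>Near each boundary point, \<open>\<Omega>\<close> is the region above the graph of a \<open>C\<^sup>2\<close> function in suitable
  Cartesian coordinates: the unit vector \<open>e\<close> is the vertical axis, and the horizontal part of
  \<open>x\<close> is its projection \<open>x - (x \<bullet> e) e\<close> to the hyperplane orthogonal to \<open>e\<close>.  Since \<open>\<gamma>\<close> is
  evaluated on that hyperplane only, taking it to be \<open>C\<^sup>2\<close> on the whole space is no restriction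
  (compose with the projection).\<close>

definition bounded_C2_domain :: "'a::euclidean_space set \<Rightarrow> bool" where
  "bounded_C2_domain \<Omega> \<longleftrightarrow> open \<Omega> \<and> connected \<Omega> \<and> \<Omega> \<noteq> {} \<and> bounded \<Omega> \<and>
     (\<forall>x0\<in>frontier \<Omega>. \<exists>r>0. \<exists>e \<gamma>. norm e = 1 \<and> C_k 2 UNIV \<gamma> \<and>
        \<Omega> \<inter> ball x0 r = {x \<in> ball x0 r. x \<bullet> e > \<gamma> (x - (x \<bullet> e) *\<^sub>R e)})"

definition delta0 :: "real \<Rightarrow> real \<Rightarrow> real" where
  "delta0 \<kappa>1 \<kappa>b = Min {1, 1 / (9 * \<kappa>1\<^sup>2), 1 / (2 * \<kappa>b\<^sup>2)}"

text \<open>\<open>\<kappa>b\<close> is the constant of the upper bound (iv).  The Hessian is measured in operator norm.\<close>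

definition localization_function ::
  "'a::euclidean_space set \<Rightarrow> real \<Rightarrow> real \<Rightarrow> real \<Rightarrow> real \<Rightarrow> real \<Rightarrow> ('a \<Rightarrow> real) \<Rightarrow> bool" where
  "localization_function \<Omega> \<kappa>0 \<kappa>1 \<kappa>2 \<kappa>b \<delta> \<eta> \<longleftrightarrow>
     (\<forall>x\<in>closure \<Omega>. \<eta> x \<ge> 0) \<and> (\<forall>x\<in>\<Omega>. \<eta> x > 0) \<and>
     (\<forall>x\<in>\<Omega>. (infdist x (frontier \<Omega>))\<^sup>2 < \<kappa>0 * \<delta> \<longrightarrow> \<eta> x = (infdist x (frontier \<Omega>))\<^sup>2) \<and>
     (\<forall>x\<in>\<Omega>. \<kappa>0 * (infdist x (frontier \<Omega>))\<^sup>2 > \<delta> \<longrightarrow> \<eta> x = \<delta>) \<and>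
     (\<exists>g H. C2_closure \<Omega> \<eta> g H \<and>
        (\<forall>x\<in>\<Omega>. norm (g x) \<le> \<kappa>1 * sqrt \<delta> \<and> norm (H x) \<le> \<kappa>2)) \<and>
     (\<forall>x\<in>\<Omega>. \<eta> x \<le> \<kappa>b * min \<delta> ((infdist x (frontier \<Omega>))\<^sup>2))"

definition localization_family ::
  "'a::euclidean_space set \<Rightarrow> real \<Rightarrow> real \<Rightarrow> real \<Rightarrow> real \<Rightarrow> (real \<Rightarrow> 'a \<Rightarrow> real) \<Rightarrow> bool" where
  "localization_family \<Omega> \<kappa>0 \<kappa>1 \<kappa>2 \<kappa>b \<eta> \<longleftrightarrow>
     (\<forall>\<delta>. 0 < \<delta> \<and> \<delta> < delta0 \<kappa>1 \<kappa>b \<longrightarrow> localization_function \<Omega> \<kappa>0 \<kappa>1 \<kappa>2 \<kappa>b \<delta> (\<eta> \<delta>))"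

text \<open>Only the values of \<open>\<rho>\<close> on the half-line of nonnegative reals matter.\<close>

definition admissible_kernel :: "(real \<Rightarrow> real) \<Rightarrow> bool" where
  "admissible_kernel \<rho> \<longleftrightarrow>
     (\<exists>\<rho>0 r0 R0. 0 < \<rho>0 \<and> 0 < r0 \<and> r0 < R0 \<and> R0 < 1 \<and>
        (\<exists>\<rho>'. (\<forall>r\<ge>0. (\<rho> has_real_derivative \<rho>' r) (at r within {0..})) \<and>
              continuous_on {0..} \<rho>' \<and>
              (\<exists>l. ((\<lambda>r. \<rho>' r / r) \<longlongrightarrow> l) (at_right 0))) \<and>
        (\<forall>r\<ge>0. \<rho> r \<ge> 0) \<and>
        closure {r \<in> {0..}. \<rho> r \<noteq> 0} \<subseteq> {0..<R0} \<and>
        (\<forall>r\<in>{0..r0}. \<rho> r \<ge> \<rho>0))"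

definition scaled_kernel ::
  "(real \<Rightarrow> real) \<Rightarrow> ('a::euclidean_space \<Rightarrow> real) \<Rightarrow> real \<Rightarrow> 'a \<Rightarrow> 'a \<Rightarrow> real" where
  "scaled_kernel \<rho> \<eta> \<alpha> x y =
     1/2 * (1 / \<eta> x powr (real DIM('a) + \<alpha>) * \<rho> (norm (y - x) / \<eta> x) +
            1 / \<eta> y powr (real DIM('a) + \<alpha>) * \<rho> (norm (y - x) / \<eta> y))"

definition Phi ::
  "'a::euclidean_space set \<Rightarrow> (real \<Rightarrow> real) \<Rightarrow> ('a \<Rightarrow> real) \<Rightarrow> real \<Rightarrow> 'a \<Rightarrow> real" where
  "Phi \<Omega> \<rho> \<eta> \<alpha> x = (LINT y|lebesgue_on \<Omega>. scaled_kernel \<rho> \<eta> \<alpha> x y)"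

definition B_form ::
  "'a::euclidean_space set \<Rightarrow> (real \<Rightarrow> real) \<Rightarrow> ('a \<Rightarrow> real) \<Rightarrow> ('a \<Rightarrow> real) \<Rightarrow> ('a \<Rightarrow> real) \<Rightarrow> real"
  where
  "B_form \<Omega> \<rho> \<eta> u v =
     (LINT x|lebesgue_on \<Omega>. LINT y|lebesgue_on \<Omega>.
        scaled_kernel \<rho> \<eta> 2 x y * (u x - u y) * (v x - v y))"

section \<open>Function spaces\<close>

text \<open>Elements of the spaces are functions, not equivalence classes modulo null sets; their values
  outside \<open>\<Omega>\<close> are irrelevant.\<close>

definition L2 :: "'a::euclidean_space set \<Rightarrow> ('a \<Rightarrow> 'b::euclidean_space) set" where
  "L2 \<Omega> = {u \<in> borel_measurable (lebesgue_on \<Omega>).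
             integrable (lebesgue_on \<Omega>) (\<lambda>x. (norm (u x))\<^sup>2)}"

definition L2_nrm :: "'a::euclidean_space set \<Rightarrow> ('a \<Rightarrow> 'b::euclidean_space) \<Rightarrow> real" where
  "L2_nrm \<Omega> u = sqrt (LINT x|lebesgue_on \<Omega>. (norm (u x))\<^sup>2)"

definition weak_gradient ::
  "'a::euclidean_space set \<Rightarrow> ('a \<Rightarrow> real) \<Rightarrow> ('a \<Rightarrow> 'a) \<Rightarrow> bool" where
  "weak_gradient \<Omega> u g \<longleftrightarrow>
     (\<forall>\<phi>\<in>Cc_infinity \<Omega>. \<forall>b\<in>Basis.
        (LINT x|lebesgue_on \<Omega>. u x * frechet_derivative \<phi> (at x) b) =
        - (LINT x|lebesgue_on \<Omega>. (g x \<bullet> b) * \<phi> x))"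

definition H1 :: "'a::euclidean_space set \<Rightarrow> ('a \<Rightarrow> real) set" where
  "H1 \<Omega> = {u \<in> L2 \<Omega>. \<exists>g\<in>L2 \<Omega>. weak_gradient \<Omega> u g}"

text \<open>Meaningful for \<open>u \<in> H1 \<Omega>\<close> only; the weak gradient in \<open>L\<^sup>2\<close> is unique almost everywhere.\<close>

definition H1_nrm :: "'a::euclidean_space set \<Rightarrow> ('a \<Rightarrow> real) \<Rightarrow> real" where
  "H1_nrm \<Omega> u =
     sqrt ((L2_nrm \<Omega> u)\<^sup>2 + (L2_nrm \<Omega> (SOME g. g \<in> L2 \<Omega> \<and> weak_gradient \<Omega> u g))\<^sup>2)"

text \<open>The squares of the seminorm and norm of the nonlocal space, as extended nonnegative reals, so that
  they are infinite where the integrals diverge.\<close>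

definition W_seminorm_sq ::
  "'a::euclidean_space set \<Rightarrow> real \<Rightarrow> ('a \<Rightarrow> real) \<Rightarrow> ('a \<Rightarrow> real) \<Rightarrow> ennreal" where
  "W_seminorm_sq \<Omega> R \<eta> u =
     (\<integral>\<^sup>+ x. (\<integral>\<^sup>+ y. ennreal (\<bar>u x - u y\<bar>\<^sup>2 / \<eta> x ^ (DIM('a) + 2))
        \<partial>lebesgue_on (\<Omega> \<inter> {y. norm (y - x) \<le> R * \<eta> x})) \<partial>lebesgue_on \<Omega>)"

definition W_norm_sq ::
  "'a::euclidean_space set \<Rightarrow> real \<Rightarrow> ('a \<Rightarrow> real) \<Rightarrow> ('a \<Rightarrow> real) \<Rightarrow> ennreal" where
  "W_norm_sq \<Omega> R \<eta> u =
     (\<integral>\<^sup>+ x. ennreal (\<bar>u x\<bar>\<^sup>2) \<partial>lebesgue_on \<Omega>) + W_seminorm_sq \<Omega> R \<eta> u"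

text \<open>The closure of the test functions, taken among the measurable functions on \<open>\<Omega>\<close>; those with
  finite norm form a complete space.\<close>

definition W0 ::
  "'a::euclidean_space set \<Rightarrow> real \<Rightarrow> ('a \<Rightarrow> real) \<Rightarrow> ('a \<Rightarrow> real) set" where
  "W0 \<Omega> R \<eta> = {u \<in> borel_measurable (lebesgue_on \<Omega>).
     \<forall>\<epsilon>>0. \<exists>\<phi>\<in>Cc_infinity \<Omega>. W_norm_sq \<Omega> R \<eta> (\<lambda>x. u x - \<phi> x) < ennreal (\<epsilon>\<^sup>2)}"

definition pairing ::
  "'a::euclidean_space set \<Rightarrow> ('a \<Rightarrow> real) \<Rightarrow> ('a \<Rightarrow> real) \<Rightarrow> real" where
  "pairing \<Omega> f v = (LINT x|lebesgue_on \<Omega>. f x * v x)"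

text \<open>The norm of \<open>v \<mapsto> pairing \<Omega> f v\<close> as a functional on \<open>W0\<close>; the supremum is over a bounded
  set if \<open>f \<in> L\<^sup>2\<close>.\<close>

definition W0_dual_nrm ::
  "'a::euclidean_space set \<Rightarrow> real \<Rightarrow> ('a \<Rightarrow> real) \<Rightarrow> ('a \<Rightarrow> real) \<Rightarrow> real" where
  "W0_dual_nrm \<Omega> R \<eta> f = (SUP v \<in> {v \<in> W0 \<Omega> R \<eta>. W_norm_sq \<Omega> R \<eta> v \<le> 1}. \<bar>pairing \<Omega> f v\<bar>)"

definition weak_solution ::
  "'a::euclidean_space set \<Rightarrow> real \<Rightarrow> (real \<Rightarrow> real) \<Rightarrow> ('a \<Rightarrow> real) \<Rightarrow> ('a \<Rightarrow> real) \<Rightarrow> ('a \<Rightarrow> real) \<Rightarrow> bool"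
  where
  "weak_solution \<Omega> R \<rho> \<eta> f u \<longleftrightarrow>
     u \<in> W0 \<Omega> R \<eta> \<and> (\<forall>v\<in>W0 \<Omega> R \<eta>. B_form \<Omega> \<rho> \<eta> u v = pairing \<Omega> f v)"

end

theory Submission
  imports Defs
begin

text \<open>Testing the equation with smooth functions gives \<open>u = average u + f / (2 \<Phi>)\<close> almost
  everywhere, where \<open>average u x\<close> is the mean of \<open>u\<close> with weights \<open>\<rho>\<^sub>\<delta>(x, y) / \<Phi> x\<close>.  Since the weights
  integrate to one, the gradient of \<open>average u\<close> is an integral of \<open>u y - u x\<close> against a kernel of size
  \<open>\<eta> x ^ - (d + 1)\<close> on the set \<open>\<bar>x - y\<bar> \<le> max (\<eta> x) (\<eta> y)\<close>, so by Cauchy--Schwarz its \<open>L\<^sup>2\<close> norm is bounded by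
  the nonlocal seminorm of \<open>u\<close>.  The same argument bounds \<open>u - average u\<close>; combined with the
  Friedrichs inequality for \<open>average \<phi>\<close>, \<open>\<phi>\<close> a test function, this yields a Poincare inequality
  that is uniform in \<open>\<delta>\<close>.  Testing with \<open>u\<close> then bounds the seminorm by the dual norm of \<open>f\<close>.
  The choice of \<open>\<delta>\<^sub>0\<close> enters through \<open>\<bar>\<nabla>\<eta>\<bar> \<le> 1/3\<close> and \<open>\<eta> x \<le> 3/4 dist(x, \<partial>\<Omega>)\<close>, which make \<open>\<eta>\<close>
  comparable at any two interacting points.\<close>

section \<open>Smooth cutoff functions and the fundamental lemma\<close>

text \<open>A solution comes without any derivative, so its regularity has to be taken from the
  kernel. What makes this uniform in \<delta> is a count of powers of \<eta>: the kernel has size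
  \<eta>^-(d + 2), a derivative costs one more power, dividing by \<open>phi\<close> gains two, and
  the region of interaction has volume \<eta>^d. What is left over is exactly the weight of the
  energy, even where \<eta> degenerates at the boundary. The same count shows that
  \<open>inverse (phi x)\<close> is bounded with bounded gradient, which is why f /
  \<open>phi\<close> is again in H1.

  Three radii of interaction have to be reconciled: the norm sees pairs at distance at most R
  \<eta>, the lower bound of the kernel reaches only r0 \<eta>, and the estimates need the full
  radius \<eta>. Energies of different radii are therefore compared by chains of shorter steps.

  The Friedrichs inequality cannot be applied to a test function directly, because the energy does
  not control its gradient. The average has a controlled gradient, and it still vanishes near the
  boundary because the interaction range stays below the distance to the boundary.\<close>

definition flat_exp :: "nat \<Rightarrow> real \<Rightarrow> real" where
  "flat_exp m t = (if t > 0 then exp (- 1 / t) / t ^ m else 0)"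

lemma flat_exp_nonneg: "0 \<le> flat_exp m t"
  by (auto simp: flat_exp_def)

lemma flat_exp_tendsto_0: "(flat_exp m \<longlongrightarrow> 0) (at_right 0)"
proof -
  have "((\<lambda>t::real. (inverse t) ^ m / exp (inverse t)) \<longlongrightarrow> 0) (at_right 0)"
    by (rule filterlim_compose[OF tendsto_power_div_exp_0 filterlim_inverse_at_top_right])
  then show ?thesis
  proof (rule Lim_transform_eventually)
    show "\<forall>\<^sub>F t in at_right 0. inverse t ^ m / exp (inverse t) = flat_exp m t"
      by (rule eventually_mono[OF eventually_at_right_less])
        (auto simp: flat_exp_def exp_minus field_simps)
  qed
qed

text \<open>The powers of \<open>t\<close> in the denominator make the span of the family closed
  under differentiation. At the origin the difference quotient of \<open>flat_exp m\<close> is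
  \<open>flat_exp (Suc m)\<close>, which tends to 0.\<close>

lemma flat_exp_has_derivative:
  "(flat_exp m has_real_derivative (flat_exp (m + 2) t - m * flat_exp (m + 1) t)) (at t)"
proof -
  consider "t < 0" | "t > 0" | "t = 0" by linarith
  then show ?thesis
  proof cases
    case 1
    have "((\<lambda>t. 0::real) has_real_derivative 0) (at t)" by simp
    then have "(flat_exp m has_real_derivative 0) (at t)"
      by (rule has_field_derivative_transform_within_open[of _ _ _ "{..<0}"])
        (use 1 in \<open>auto simp: flat_exp_def\<close>)
    then show ?thesis using 1 by (simp add: flat_exp_def)
  next
    case 2
    have "((\<lambda>t. exp (- 1 / t) / t ^ m) has_real_derivative
       ((exp (- 1 / t) * (1 / t\<^sup>2)) * t ^ m - exp (- 1 / t) * (m * t ^ (m - 1))) / (t ^ m * t ^ m)) (at t)"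
      using 2 by (auto intro!: derivative_eq_intros simp: power2_eq_square)
    also have "((exp (- 1 / t) * (1 / t\<^sup>2)) * t ^ m - exp (- 1 / t) * (m * t ^ (m - 1))) / (t ^ m * t ^ m)
      = flat_exp (m + 2) t - m * flat_exp (m + 1) t"
      using 2 by (cases m) (auto simp: flat_exp_def field_simps power2_eq_square)
    finally have "((\<lambda>t. exp (- 1 / t) / t ^ m) has_real_derivative (flat_exp (m + 2) t - m * flat_exp (m + 1) t)) (at t)" .
    then show ?thesis
      by (rule has_field_derivative_transform_within_open[of _ _ _ "{0<..}"])
        (use 2 in \<open>auto simp: flat_exp_def\<close>)
  next
    case 3
    have "((\<lambda>s. flat_exp m s / s) \<longlongrightarrow> 0) (at 0)"
    proof (rule filterlim_split_at_real)
      show "((\<lambda>s. flat_exp m s / s) \<longlongrightarrow> 0) (at_left 0)"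
        by (rule Lim_transform_eventually[OF tendsto_const])
          (auto simp: flat_exp_def eventually_at_filter)
      show "((\<lambda>s. flat_exp m s / s) \<longlongrightarrow> 0) (at_right 0)"
        by (rule Lim_transform_eventually[OF flat_exp_tendsto_0[of "Suc m"]])
          (auto simp: flat_exp_def eventually_at_filter field_simps)
    qed
    then show ?thesis using 3
      by (simp add: has_field_derivative_iff flat_exp_def)
  qed
qed

text \<open>This algebra is closed under directional derivatives, so that its members are smooth by
  induction on the order of differentiability.\<close>

inductive_set cutoff_algebra :: "('a::euclidean_space \<Rightarrow> real) set" where
  const: "(\<lambda>x. c) \<in> cutoff_algebra"
| flat: "(\<lambda>x. flat_exp m (v \<bullet> x - c)) \<in> cutoff_algebra"
| add: "f \<in> cutoff_algebra \<Longrightarrow> g \<in> cutoff_algebra \<Longrightarrow> (\<lambda>x. f x + g x) \<in> cutoff_algebra"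
| mult: "f \<in> cutoff_algebra \<Longrightarrow> g \<in> cutoff_algebra \<Longrightarrow> (\<lambda>x. f x * g x) \<in> cutoff_algebra"

lemma cutoff_algebra_derivative:
  assumes "f \<in> cutoff_algebra"
  obtains D where "\<And>x. (f has_derivative D x) (at x)" "\<And>v. (\<lambda>x. D x v) \<in> cutoff_algebra"
proof -
  have "\<exists>D. (\<forall>x. (f has_derivative D x) (at x)) \<and> (\<forall>v. (\<lambda>x. D x v) \<in> cutoff_algebra)"
    using assms
  proof induction
    case (const c)
    show ?case
      by (rule exI[of _ "\<lambda>x v. 0"]) (auto intro: cutoff_algebra.const)
  next
    case (flat m w c)
    have "((\<lambda>x. flat_exp m (w \<bullet> x - c)) has_derivative
        (\<lambda>v. (flat_exp (m + 2) (w \<bullet> x - c) + - real m * flat_exp (m + 1) (w \<bullet> x - c)) * (w \<bullet> v))) (at x)" for x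
    proof -
      have "((\<lambda>x. w \<bullet> x - c) has_derivative (\<lambda>v. w \<bullet> v)) (at x)"
        by (auto intro!: derivative_eq_intros)
      from DERIV_compose_FDERIV[OF flat_exp_has_derivative this, of m] show ?thesis
        by (simp add: mult.commute)
    qed
    moreover have "(\<lambda>x. (flat_exp (m + 2) (w \<bullet> x - c) + - real m * flat_exp (m + 1) (w \<bullet> x - c)) * (w \<bullet> v)) \<in> cutoff_algebra" for v
      by (intro cutoff_algebra.intros)
    ultimately show ?case
      by (intro exI[of _ "\<lambda>x v. (flat_exp (m + 2) (w \<bullet> x - c) + - real m * flat_exp (m + 1) (w \<bullet> x - c)) * (w \<bullet> v)"]) auto
  next
    case (add f g)
    then obtain D E where D: "\<And>x. (f has_derivative D x) (at x)" "\<And>v. (\<lambda>x. D x v) \<in> cutoff_algebra"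
      and E: "\<And>x. (g has_derivative E x) (at x)" "\<And>v. (\<lambda>x. E x v) \<in> cutoff_algebra" by blast
    have "((\<lambda>x. f x + g x) has_derivative (\<lambda>v. D x v + E x v)) (at x)" for x
      by (intro has_derivative_add D E)
    moreover have "(\<lambda>x. D x v + E x v) \<in> cutoff_algebra" for v
      by (intro cutoff_algebra.add D E)
    ultimately show ?case by (intro exI[of _ "\<lambda>x v. D x v + E x v"]) auto
  next
    case (mult f g)
    then obtain D E where D: "\<And>x. (f has_derivative D x) (at x)" "\<And>v. (\<lambda>x. D x v) \<in> cutoff_algebra"
      and E: "\<And>x. (g has_derivative E x) (at x)" "\<And>v. (\<lambda>x. E x v) \<in> cutoff_algebra" by blast
    have "((\<lambda>x. f x * g x) has_derivative (\<lambda>v. f x * E x v + D x v * g x)) (at x)" for x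
      by (intro has_derivative_mult D E)
    moreover have "(\<lambda>x. f x * E x v + D x v * g x) \<in> cutoff_algebra" for v
      by (intro cutoff_algebra.add cutoff_algebra.mult D E mult)
    ultimately show ?case by (intro exI[of _ "\<lambda>x v. f x * E x v + D x v * g x"]) auto
  qed
  then show ?thesis using that by blast
qed

lemma cutoff_algebra_continuous:
  assumes "f \<in> cutoff_algebra"
  shows "continuous_on S f"
  using cutoff_algebra_derivative[OF assms] has_derivative_continuous
    continuous_at_imp_continuous_on by metis

lemma cutoff_algebra_C_k:
  assumes "f \<in> cutoff_algebra"
  shows "C_k k UNIV f"
  using assms
proof (induction k arbitrary: f)
  case 0
  then show ?case by (simp add: cutoff_algebra_continuous)
next
  case (Suc k)
  obtain D where D: "\<And>x. (f has_derivative D x) (at x)" "\<And>v. (\<lambda>x. D x v) \<in> cutoff_algebra"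
    using cutoff_algebra_derivative[OF Suc.prems] by blast
  have "frechet_derivative f (at x) = D x" for x
    using frechet_derivative_at[OF D(1)] by metis
  with D Suc.IH show ?case
    by (auto simp: differentiable_def)
qed

lemma cutoff_algebra_prod:
  assumes "finite I" "\<And>i. i \<in> I \<Longrightarrow> f i \<in> cutoff_algebra"
  shows "(\<lambda>x. \<Prod>i\<in>I. f i x) \<in> cutoff_algebra"
  using assms by (induction) (auto intro: cutoff_algebra.intros)

text \<open>Inside the box each factor is exp (-1 / (n t)) with t the distance to one face, so
  growing \<open>n\<close> keeps the support and raises the bump to the indicator of the open box.
  The scaling by \<open>n\<close> is put into the vectors so that every factor is literally a
  generator of \<open>cutoff_algebra\<close>.\<close>

definition box_bump :: "'a::euclidean_space \<Rightarrow> 'a \<Rightarrow> real \<Rightarrow> 'a \<Rightarrow> real" where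
  "box_bump a c n x =
     (\<Prod>b\<in>Basis. flat_exp 0 ((n *\<^sub>R b) \<bullet> x - n * (a \<bullet> b)) * flat_exp 0 ((- n *\<^sub>R b) \<bullet> x - - n * (c \<bullet> b)))"

lemma box_bump_cutoff: "box_bump a c n \<in> cutoff_algebra"
  unfolding box_bump_def[abs_def]
  by (intro cutoff_algebra_prod cutoff_algebra.intros) auto

lemma box_bump_pos:
  assumes "x \<in> box a c" "n > 0"
  shows "box_bump a c n x > 0"
proof -
  have "0 < n * (x \<bullet> b) - n * (a \<bullet> b)" "0 < n * (c \<bullet> b) - n * (x \<bullet> b)" if "b \<in> Basis" for b
    using assms that by (auto simp: mem_box)
  then show ?thesis
    unfolding box_bump_def
    by (intro prod_pos) (auto simp: flat_exp_def inner_commute)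
qed

lemma box_bump_eq_0:
  assumes "x \<notin> box a c" "n > 0"
  shows "box_bump a c n x = 0"
proof -
  obtain b where b: "b \<in> Basis" "x \<bullet> b \<le> a \<bullet> b \<or> c \<bullet> b \<le> x \<bullet> b"
    using assms(1) by (auto simp: mem_box not_less)
  have "n * (x \<bullet> b) \<le> n * (a \<bullet> b) \<or> n * (c \<bullet> b) \<le> n * (x \<bullet> b)"
    using b assms(2) by (auto)
  then show ?thesis
    unfolding box_bump_def using b(1)
    by (intro prod_zero) (auto simp: flat_exp_def inner_commute intro!: bexI[of _ b])
qed

lemma box_bump_nonneg: "0 \<le> box_bump a c n x"
  unfolding box_bump_def by (intro prod_nonneg mult_nonneg_nonneg flat_exp_nonneg)

lemma box_bump_le_1: "box_bump a c n x \<le> 1"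
  unfolding box_bump_def
  by (intro prod_le_1 conjI mult_nonneg_nonneg flat_exp_nonneg mult_le_one) (auto simp: flat_exp_def)

lemma box_bump_tendsto: "(\<lambda>n. box_bump a c (real (Suc n)) x) \<longlonglongrightarrow> indicator (box a c) x"
proof (cases "x \<in> box a c")
  case False
  then show ?thesis by (simp add: box_bump_eq_0)
next
  case True
  have *: "(\<lambda>n. flat_exp 0 (real (Suc n) * t)) \<longlonglongrightarrow> 1" if "t > 0" for t
  proof -
    have "(\<lambda>n. exp (- (inverse (real (Suc n)) * (1 / t)))) \<longlonglongrightarrow> exp (- (0 * (1 / t)))"
      by (intro tendsto_intros LIMSEQ_inverse_real_of_nat)
    moreover have "flat_exp 0 (real (Suc n) * t) = exp (- (inverse (real (Suc n)) * (1 / t)))" for n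
      using that by (simp add: flat_exp_def field_simps del: of_nat_Suc)
    ultimately show ?thesis by simp
  qed
  have "(\<lambda>n. box_bump a c (real (Suc n)) x) \<longlonglongrightarrow> (\<Prod>b\<in>(Basis::'a set). 1 * 1)"
    unfolding box_bump_def
  proof (intro tendsto_prod tendsto_mult)
    fix b :: 'a assume b: "b \<in> Basis"
    have "(real (Suc n) *\<^sub>R b) \<bullet> x - real (Suc n) * (a \<bullet> b) = real (Suc n) * ((x - a) \<bullet> b)"
      "(- real (Suc n) *\<^sub>R b) \<bullet> x - - real (Suc n) * (c \<bullet> b) = real (Suc n) * ((c - x) \<bullet> b)" for n
      by (simp_all add: inner_commute algebra_simps)
    moreover have "(x - a) \<bullet> b > 0" "(c - x) \<bullet> b > 0"
      using b True by (auto simp: mem_box inner_diff_left)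
    ultimately show "(\<lambda>n. flat_exp 0 ((real (Suc n) *\<^sub>R b) \<bullet> x - real (Suc n) * (a \<bullet> b))) \<longlonglongrightarrow> 1"
      "(\<lambda>n. flat_exp 0 ((- real (Suc n) *\<^sub>R b) \<bullet> x - - real (Suc n) * (c \<bullet> b))) \<longlonglongrightarrow> 1"
      by (simp_all only: *)
  qed
  then show ?thesis using True by simp
qed

section \<open>From vanishing integrals to vanishing functions\<close>

lemma box_bump_Cc_infinity:
  assumes "cbox a c \<subseteq> \<Omega>" "n > 0"
  shows "box_bump a c n \<in> Cc_infinity \<Omega>"
proof -
  have "closure {x. box_bump a c n x \<noteq> 0} \<subseteq> cbox a c"
    by (rule closure_minimal) (use box_bump_eq_0[OF _ assms(2)] box_subset_cbox in blast)+
  then show ?thesis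
    using assms unfolding Cc_infinity_def
    by (auto simp: cutoff_algebra_C_k[OF box_bump_cutoff] intro: compact_closure[THEN iffD2] bounded_subset[OF bounded_cbox[of a c]] bounded_subset[OF _ closure_subset])
qed

text \<open>Open boxes generate the Borel sets and are closed under intersection, so the vanishing
  of the integral spreads from boxes to all Borel sets by a Dynkin argument.\<close>

lemma AE_zero_if_box_integrals_zero:
  fixes h :: "'a::euclidean_space \<Rightarrow> real"
  assumes h: "integrable lborel h"
    and z: "\<And>a c. (\<integral>x. indicator (box a c) x *\<^sub>R h x \<partial>lborel) = 0"
  shows "AE x in lborel. h x = 0"
proof (rule density_unique_real[OF h integrable_zero])
  \<comment> \<open>The case of complements requires the integral over the whole space, which is
    exhausted by growing boxes around the origin.\<close>
  have nn: "(\<integral>x. h x \<partial>lborel) = 0"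
  proof -
    have "(\<lambda>n. \<integral>x. indicator (box (- real n *\<^sub>R One) (real n *\<^sub>R One)) x *\<^sub>R h x \<partial>lborel) \<longlonglongrightarrow> (\<integral>x. h x \<partial>lborel)"
    proof (rule integral_dominated_convergence[where w = "\<lambda>x. \<bar>h x\<bar>"])
      show "AE x in lborel. (\<lambda>n. indicator (box (- real n *\<^sub>R One) (real n *\<^sub>R One)) x *\<^sub>R h x) \<longlonglongrightarrow> h x"
      proof (rule AE_I2)
        fix x :: 'a
        obtain N :: nat where N: "norm x < N" using reals_Archimedean2 by blast
        have "x \<in> box (- real n *\<^sub>R One) (real n *\<^sub>R One)" if "n \<ge> N" for n
          unfolding mem_box
        proof
          fix b :: 'a assume b: "b \<in> Basis"
          then have "\<bar>x \<bullet> b\<bar> < n" using Basis_le_norm[OF b, of x] N that by linarith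
          then show "(- real n *\<^sub>R One) \<bullet> b < x \<bullet> b \<and> x \<bullet> b < (real n *\<^sub>R One) \<bullet> b"
            using b by auto
        qed
        then show "(\<lambda>n. indicator (box (- real n *\<^sub>R One) (real n *\<^sub>R One)) x *\<^sub>R h x) \<longlonglongrightarrow> h x"
          by (intro tendsto_eventually eventually_sequentiallyI[of N]) simp
      qed
    qed (use h in \<open>auto simp: indicator_def\<close>)
    then show ?thesis using z LIMSEQ_unique tendsto_const by (simp add: LIMSEQ_const_iff)
  qed
  fix A :: "'a set" assume "A \<in> sets lborel"
  then have A: "A \<in> sigma_sets UNIV (range (\<lambda>(a, b). box a b))"
    by (simp add: borel_eq_box)
  have "Int_stable (range (\<lambda>(a, b). box a (b::'a)))"
    by (auto simp: Int_stable_def box_Int_box)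
  moreover have "range (\<lambda>(a, b). box a (b::'a)) \<subseteq> Pow UNIV" by simp
  moreover note A
  ultimately have "A \<in> sets borel \<and> set_lebesgue_integral lborel A h = 0"
  proof (induction rule: sigma_sets_induct_disjoint[consumes 3, case_names basic empty compl union])
    case (compl A)
    have i: "integrable lborel (\<lambda>x. indicator A x *\<^sub>R h x)"
      using compl by (intro integrable_mult_indicator h) auto
    have "set_lebesgue_integral lborel (UNIV - A) h = (\<integral>x. h x - indicator A x *\<^sub>R h x \<partial>lborel)"
      unfolding set_lebesgue_integral_def by (rule Bochner_Integration.integral_cong) (auto simp: indicator_def)
    also have "\<dots> = 0"
      using compl nn by (subst Bochner_Integration.integral_diff[OF h i])
        (auto simp: set_lebesgue_integral_def)
    finally show ?case using compl by auto
  next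
    case (union A)
    then have "set_integrable lborel (\<Union>i. A i) h"
      unfolding set_integrable_def by (intro integrable_mult_indicator h) auto
    then have "set_lebesgue_integral lborel (\<Union>i. A i) h = (\<Sum>i. set_lebesgue_integral lborel (A i) h)"
      using union by (intro lebesgue_integral_countable_add) (auto simp: disjoint_family_on_def)
    then show ?case using union by auto
  qed (use z in \<open>auto simp: set_lebesgue_integral_def\<close>)
  then show "set_lebesgue_integral lborel A h = set_lebesgue_integral lborel A (\<lambda>x. 0)"
    by (simp add: set_lebesgue_integral_def)
qed

text \<open>The bumps \<open>box_bump a c n\<close> converge boundedly to the indicator of the box, so the
  integral of \<open>h\<close> over every box vanishes.\<close>

lemma fundamental_lemma_variations:
  fixes h :: "'a::euclidean_space \<Rightarrow> real"
  assumes \<Omega>: "open \<Omega>"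
    and h: "\<And>a c. cbox a c \<subseteq> \<Omega> \<Longrightarrow> integrable (lebesgue_on (cbox a c)) h"
    and z: "\<And>\<phi>. \<phi> \<in> Cc_infinity \<Omega> \<Longrightarrow> (LINT x|lebesgue_on \<Omega>. h x * \<phi> x) = 0"
  shows "AE x in lebesgue_on \<Omega>. h x = 0"
proof -
  have cb: "AE x in lebesgue. x \<in> cbox a c \<longrightarrow> h x = 0" if sub: "cbox a c \<subseteq> \<Omega>" for a c
  proof -
    define H where "H x = indicator (cbox a c) x * h x" for x
    have H: "integrable lebesgue H"
      using h[OF sub] by (simp add: integrable_restrict_space H_def[abs_def])
    \<comment> \<open>Boxes generate only the Borel sets, hence the passage from the Lebesgue
      measurable \<open>H\<close> to a Borel representative.\<close>
    then obtain H' where H': "H' \<in> borel_measurable lborel" "AE x in lborel. H x = H' x"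
      using completion_ex_borel_measurable_real[of H lborel] by (auto dest: borel_measurable_integrable)
    have ae: "AE x in lebesgue. H x = H' x" using H'(2) by (rule AE_completion)
    have H'm: "H' \<in> borel_measurable lebesgue" using H'(1) by (simp add: measurable_completion)
    have iH': "integrable lborel H'"
      using H H'(1) integrable_cong_AE[OF _ H'm ae] by (simp add: integrable_completion)
    have box0: "(\<integral>x. indicator (box p q) x *\<^sub>R H x \<partial>lebesgue) = 0" for p q
    proof -
      \<comment> \<open>Intersecting with \<open>box a c\<close> turns the bumps into admissible
        test functions for \<open>\<Omega>\<close>. The integral of \<open>H\<close> is unaffected,
        since \<open>H\<close> vanishes off \<open>cbox a c\<close> and the boundary of that box is
        a null set.\<close>
      have "\<exists>p' q'. box p q \<inter> box a c = box p' q' \<and> cbox p' q' \<subseteq> cbox a c"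
      proof -
        define p' where "p' = (\<Sum>i\<in>Basis. max (p \<bullet> i) (a \<bullet> i) *\<^sub>R i)"
        define q' where "q' = (\<Sum>i\<in>Basis. min (q \<bullet> i) (c \<bullet> i) *\<^sub>R i)"
        have "box p q \<inter> box a c = box p' q'" unfolding p'_def q'_def by (rule box_Int_box)
        moreover have "cbox p' q' \<subseteq> cbox a c" by (auto simp: p'_def q'_def mem_box)
        ultimately show ?thesis by blast
      qed
      then obtain p' q' where pq: "box p q \<inter> box a c = box p' q'" "cbox p' q' \<subseteq> cbox a c" by blast
      have lim: "(\<lambda>n. \<integral>x. box_bump p' q' (real (Suc n)) x * H x \<partial>lebesgue) \<longlonglongrightarrow> (\<integral>x. indicator (box p' q') x * H x \<partial>lebesgue)"
      proof (rule integral_dominated_convergence[where w = "\<lambda>x. \<bar>H x\<bar>"])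
        have m: "box_bump p' q' r \<in> borel_measurable lebesgue" for r
          using cutoff_algebra_continuous[OF box_bump_cutoff, of UNIV p' q' r]
          by (intro measurable_completion) (simp add: borel_measurable_continuous_onI)
        show "(\<lambda>x. box_bump p' q' (real (Suc n)) x * H x) \<in> borel_measurable lebesgue" for n
          using m H by (intro borel_measurable_times) auto
        show "(\<lambda>x. indicator (box p' q') x * H x) \<in> borel_measurable lebesgue"
          using H by (intro borel_measurable_times borel_measurable_indicator) auto
        show "AE x in lebesgue. norm (box_bump p' q' (real (Suc n)) x * H x) \<le> \<bar>H x\<bar>" for n
          using box_bump_le_1[of p' q' "real (Suc n)"] box_bump_nonneg[of p' q' "real (Suc n)"]
          by (intro AE_I2) (simp add: abs_mult mult_left_le_one_le)
        show "AE x in lebesgue. (\<lambda>n. box_bump p' q' (real (Suc n)) x * H x) \<longlonglongrightarrow> indicator (box p' q') x * H x"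
          by (intro AE_I2 tendsto_mult box_bump_tendsto tendsto_const)
      qed (use H in auto)
      have "(\<integral>x. box_bump p' q' (real (Suc n)) x * H x \<partial>lebesgue) = 0" for n
      proof -
        have \<phi>: "box_bump p' q' (real (Suc n)) \<in> Cc_infinity \<Omega>"
          using pq sub by (intro box_bump_Cc_infinity) auto
        have "(LINT x|lebesgue_on \<Omega>. h x * box_bump p' q' (real (Suc n)) x) =
            (\<integral>x. indicator \<Omega> x *\<^sub>R (h x * box_bump p' q' (real (Suc n)) x) \<partial>lebesgue)"
          using \<Omega> by (intro integral_restrict_space) auto
        also have "\<dots> = (\<integral>x. box_bump p' q' (real (Suc n)) x * H x \<partial>lebesgue)"
        proof (rule Bochner_Integration.integral_cong)
          fix x
          show "indicator \<Omega> x *\<^sub>R (h x * box_bump p' q' (real (Suc n)) x) = box_bump p' q' (real (Suc n)) x * H x"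
            using pq(2) sub box_subset_cbox[of p' q'] box_bump_eq_0[of x p' q' "real (Suc n)"]
            by (cases "x \<in> box p' q'") (auto simp: H_def indicator_def)
        qed simp
        finally show ?thesis using z[OF \<phi>] by simp
      qed
      then have 1: "(\<integral>x. indicator (box p' q') x * H x \<partial>lebesgue) = 0"
        using lim by (simp add: LIMSEQ_const_iff)
      have nbox: "AE x in lebesgue. x \<notin> cbox a c - box a c"
      proof -
        have "cbox a c - box a c \<in> null_sets lebesgue"
          using negligible_frontier_interval[of a c] by (simp add: negligible_iff_null_sets)
        then show ?thesis by (rule AE_not_in)
      qed
      have "(\<integral>x. indicator (box p q) x *\<^sub>R H x \<partial>lebesgue) = (\<integral>x. indicator (box p' q') x * H x \<partial>lebesgue)"
      proof (rule integral_cong_AE)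
        show "AE x in lebesgue. indicator (box p q) x *\<^sub>R H x = indicator (box p' q') x * H x"
          using nbox by eventually_elim (auto simp: H_def indicator_def simp flip: pq(1))
        show "(\<lambda>x. indicator (box p q) x *\<^sub>R H x) \<in> borel_measurable lebesgue"
           "(\<lambda>x. indicator (box p' q') x * H x) \<in> borel_measurable lebesgue"
          using H by (auto intro!: borel_measurable_times borel_measurable_indicator)
      qed
      then show ?thesis using 1 by simp
    qed
    have "(\<integral>x. indicator (box p q) x *\<^sub>R H' x \<partial>lborel) = 0" for p q
    proof -
      have "(\<integral>x. indicator (box p q) x *\<^sub>R H' x \<partial>lborel) = (\<integral>x. indicator (box p q) x *\<^sub>R H' x \<partial>lebesgue)"
        using H'(1) by (intro integral_completion[symmetric]) auto
      also have "\<dots> = (\<integral>x. indicator (box p q) x *\<^sub>R H x \<partial>lebesgue)"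
        using H H'm ae by (intro integral_cong_AE borel_measurable_scaleR borel_measurable_indicator) auto
      finally show ?thesis using box0 by simp
    qed
    then have "AE x in lborel. H' x = 0" by (intro AE_zero_if_box_integrals_zero iH')
    then have "AE x in lebesgue. H' x = 0" by (rule AE_completion)
    with ae show ?thesis by eventually_elim (auto simp: H_def)
  qed
  \<comment> \<open>\<open>h\<close> need not be integrable on all of \<open>\<Omega>\<close>, so
    the conclusion is assembled from countably many closed boxes that fill
    \<open>\<Omega>\<close>.\<close>
  obtain \<D> where D: "countable \<D>" "\<D> \<subseteq> Pow \<Omega>" "\<And>X. X \<in> \<D> \<Longrightarrow> \<exists>a b. X = cbox a b" "\<Union>\<D> = \<Omega>"
    using open_countable_Union_open_cbox[OF \<Omega>] by metis
  have "AE x in lebesgue. \<forall>X\<in>\<D>. x \<in> X \<longrightarrow> h x = 0"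
    using D by (subst AE_ball_countable) (auto, use cb in blast)
  then have "AE x in lebesgue. x \<in> \<Omega> \<longrightarrow> h x = 0"
    by eventually_elim (use D(4) in auto)
  then show ?thesis using \<Omega> by (simp add: AE_restrict_space_iff)
qed

section \<open>Continuously differentiable functions with explicit gradient\<close>

lemma inner_deriv_bound:
  fixes f :: "'a::euclidean_space \<Rightarrow> real"
  assumes "convex S" "\<And>x. x \<in> S \<Longrightarrow> (f has_derivative (\<lambda>h. g x \<bullet> h)) (at x)"
    and "\<And>x. x \<in> S \<Longrightarrow> norm (g x) \<le> L" "x \<in> S" "y \<in> S"
  shows "\<bar>f x - f y\<bar> \<le> L * norm (x - y)"
proof -
  have "norm (f x - f y) \<le> L * norm (x - y)"
  proof (rule differentiable_bound[OF assms(1)])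
    show "(f has_derivative (\<lambda>h. g z \<bullet> h)) (at z within S)" if "z \<in> S" for z
      by (rule has_derivative_at_withinI[OF assms(2)[OF that]])
    show "onorm (\<lambda>h. g z \<bullet> h) \<le> L" if "z \<in> S" for z
    proof (rule onorm_le)
      fix h
      have "norm (g z \<bullet> h) \<le> norm (g z) * norm h" by (simp add: Cauchy_Schwarz_ineq2)
      also have "\<dots> \<le> L * norm h" using assms(3)[OF that] by (simp add: mult_right_mono)
      finally show "norm (g z \<bullet> h) \<le> L * norm h" .
    qed
  qed (use assms in auto)
  then show ?thesis by simp
qed

text \<open>The weight \<open>w\<close> is only integrable, so all regularity has to sit in
  \<open>k\<close>. The mean value inequality bounds the difference quotients of \<open>k\<close> by
  \<open>L\<close>, and the remainder divided by the length of the increment is dominated by 2 L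
  |w|.\<close>

lemma has_derivative_param_integral:
  fixes k :: "'a::euclidean_space \<Rightarrow> 'b \<Rightarrow> real" and K :: "'a \<Rightarrow> 'b \<Rightarrow> 'a"
  assumes r: "r > 0"
    and d: "\<And>x y. x \<in> ball x0 r \<Longrightarrow> y \<in> space M \<Longrightarrow> ((\<lambda>x. k x y) has_derivative (\<lambda>h. K x y \<bullet> h)) (at x)"
    and bd: "\<And>x y. x \<in> ball x0 r \<Longrightarrow> y \<in> space M \<Longrightarrow> norm (K x y) \<le> L"
    and w: "integrable M w"
    and int: "\<And>x. x \<in> ball x0 r \<Longrightarrow> integrable M (\<lambda>y. k x y * w y)"
    and meas: "(\<lambda>y. K x0 y) \<in> borel_measurable M"
  shows "((\<lambda>x. \<integral>y. k x y * w y \<partial>M) has_derivative (\<lambda>h. (\<integral>y. w y *\<^sub>R K x0 y \<partial>M) \<bullet> h)) (at x0)"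
proof -
  have x0: "x0 \<in> ball x0 r" using r by simp
  have iK: "integrable M (\<lambda>y. w y *\<^sub>R K x0 y)"
  proof (rule Bochner_Integration.integrable_bound)
    show "integrable M (\<lambda>y. L * w y)" using w by simp
    show "(\<lambda>y. w y *\<^sub>R K x0 y) \<in> borel_measurable M" using w meas by auto
    show "AE y in M. norm (w y *\<^sub>R K x0 y) \<le> norm (L * w y)"
    proof (rule AE_I2)
      fix y assume "y \<in> space M"
      then have "norm (K x0 y) \<le> \<bar>L\<bar>" using bd[OF x0, of y] by linarith
      then show "norm (w y *\<^sub>R K x0 y) \<le> norm (L * w y)"
        using mult_left_mono[of "norm (K x0 y)" "\<bar>L\<bar>" "\<bar>w y\<bar>"] by (simp add: abs_mult mult.commute)
    qed
  qed
  have "((\<lambda>y. norm ((\<integral>z. k y z * w z \<partial>M) - (\<integral>z. k x0 z * w z \<partial>M) - (\<integral>z. w z *\<^sub>R K x0 z \<partial>M) \<bullet> (y - x0)) / norm (y - x0)) \<longlongrightarrow> 0) (at x0)"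
    unfolding tendsto_at_iff_sequentially
  proof (intro allI impI)
    fix X assume X: "\<forall>i. X i \<in> UNIV - {x0}" "X \<longlonglongrightarrow> x0"
    from X(2) r obtain N where N: "\<And>n. n \<ge> N \<Longrightarrow> X n \<in> ball x0 r"
      by (metis dist_commute lim_sequentially mem_ball)
    \<comment> \<open>Dropping finitely many terms puts the whole sequence into the ball, where the
      bounds hold for every index. The shift is undone at the end by
      \<open>LIMSEQ_offset\<close>.\<close>
    define Y where "Y n = X (n + N)" for n
    have Yb: "Y n \<in> ball x0 r" and Yne: "Y n \<noteq> x0" for n using N X(1) by (auto simp: Y_def)
    have Yl: "Y \<longlonglongrightarrow> x0" unfolding Y_def by (rule LIMSEQ_ignore_initial_segment[OF X(2)])
    define s where "s n z = w z * ((k (Y n) z - k x0 z - K x0 z \<bullet> (Y n - x0)) / norm (Y n - x0))" for n z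
    have sint: "integrable M (\<lambda>z. (k (Y n) z * w z - k x0 z * w z - (w z *\<^sub>R K x0 z) \<bullet> (Y n - x0)) / norm (Y n - x0))" for n
      using int[OF Yb] int[OF x0] iK by (intro integrable_divide Bochner_Integration.integrable_diff integrable_inner_left) auto
    have seq: "s n z = (k (Y n) z * w z - k x0 z * w z - (w z *\<^sub>R K x0 z) \<bullet> (Y n - x0)) / norm (Y n - x0)" for n z
      by (simp add: s_def algebra_simps diff_divide_distrib)
    have lim: "(\<lambda>n. \<integral>z. s n z \<partial>M) \<longlonglongrightarrow> (\<integral>z. 0 \<partial>M)"
    proof (rule integral_dominated_convergence[where w = "\<lambda>z. 2 * L * \<bar>w z\<bar>"])
      show "s n \<in> borel_measurable M" for n
        using borel_measurable_integrable[OF sint[of n]] by (simp add: seq[abs_def])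
      show "integrable M (\<lambda>z. 2 * L * \<bar>w z\<bar>)" using w by simp
      show "AE z in M. norm (s n z) \<le> 2 * L * \<bar>w z\<bar>" for n
      proof (rule AE_I2)
        fix z assume z: "z \<in> space M"
        have "\<bar>k (Y n) z - k x0 z\<bar> \<le> L * norm (Y n - x0)"
          by (rule inner_deriv_bound[where S = "ball x0 r", OF convex_ball d[OF _ z] bd[OF _ z] Yb x0])
        moreover have "\<bar>K x0 z \<bullet> (Y n - x0)\<bar> \<le> L * norm (Y n - x0)"
          using Cauchy_Schwarz_ineq2[of "K x0 z" "Y n - x0"] mult_right_mono[OF bd[OF x0 z], of "norm (Y n - x0)"] by simp
        ultimately have "\<bar>k (Y n) z - k x0 z - K x0 z \<bullet> (Y n - x0)\<bar> \<le> 2 * L * norm (Y n - x0)" by linarith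
        then have "\<bar>k (Y n) z - k x0 z - K x0 z \<bullet> (Y n - x0)\<bar> / norm (Y n - x0) \<le> 2 * L"
          using Yne[of n] by (simp add: divide_simps)
        then have "\<bar>w z\<bar> * (\<bar>k (Y n) z - k x0 z - K x0 z \<bullet> (Y n - x0)\<bar> / norm (Y n - x0)) \<le> \<bar>w z\<bar> * (2 * L)"
          by (rule mult_left_mono) simp
        then show "norm (s n z) \<le> 2 * L * \<bar>w z\<bar>"
          by (simp add: s_def abs_mult mult.commute)
      qed
      show "AE z in M. (\<lambda>n. s n z) \<longlonglongrightarrow> 0"
      proof (rule AE_I2)
        fix z assume z: "z \<in> space M"
        have "((\<lambda>y. norm (k y z - k x0 z - K x0 z \<bullet> (y - x0)) / norm (y - x0)) \<longlongrightarrow> 0) (at x0)"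
          using d[OF x0 z] by (simp add: has_derivative_iff_norm)
        then have "(\<lambda>n. norm (k (Y n) z - k x0 z - K x0 z \<bullet> (Y n - x0)) / norm (Y n - x0)) \<longlonglongrightarrow> 0"
          using Yne Yl unfolding tendsto_at_iff_sequentially by (auto simp: comp_def)
        then have "(\<lambda>n. (k (Y n) z - k x0 z - K x0 z \<bullet> (Y n - x0)) / norm (Y n - x0)) \<longlonglongrightarrow> 0"
          by (subst tendsto_norm_zero_iff[symmetric]) simp
        then have "(\<lambda>n. w z * ((k (Y n) z - k x0 z - K x0 z \<bullet> (Y n - x0)) / norm (Y n - x0))) \<longlonglongrightarrow> w z * 0"
          by (intro tendsto_mult tendsto_const)
        then show "(\<lambda>n. s n z) \<longlonglongrightarrow> 0" by (simp add: s_def)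
      qed
    qed simp
    have Is: "(\<integral>z. s n z \<partial>M) = ((\<integral>z. k (Y n) z * w z \<partial>M) - (\<integral>z. k x0 z * w z \<partial>M) - (\<integral>z. w z *\<^sub>R K x0 z \<partial>M) \<bullet> (Y n - x0)) / norm (Y n - x0)" for n
    proof -
      have i: "integrable M (\<lambda>z. k (Y n) z * w z - k x0 z * w z)"
        by (rule Bochner_Integration.integrable_diff[OF int[OF Yb] int[OF x0]])
      have i': "integrable M (\<lambda>z. (w z *\<^sub>R K x0 z) \<bullet> (Y n - x0))"
        by (rule integrable_inner_left[OF iK])
      show ?thesis
        unfolding seq integral_divide_zero Bochner_Integration.integral_diff[OF i i']
          Bochner_Integration.integral_diff[OF int[OF Yb] int[OF x0]]
        using iK by (subst integral_inner_left) auto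
    qed
    have "(\<lambda>n. norm (((\<integral>z. k (Y n) z * w z \<partial>M) - (\<integral>z. k x0 z * w z \<partial>M) - (\<integral>z. w z *\<^sub>R K x0 z \<partial>M) \<bullet> (Y n - x0)) / norm (Y n - x0))) \<longlonglongrightarrow> 0"
      by (rule tendsto_norm_zero, rule lim[unfolded Is Bochner_Integration.integral_zero])
    then show "((\<lambda>y. norm ((\<integral>z. k y z * w z \<partial>M) - (\<integral>z. k x0 z * w z \<partial>M) - (\<integral>z. w z *\<^sub>R K x0 z \<partial>M) \<bullet> (y - x0)) / norm (y - x0)) \<circ> X) \<longlonglongrightarrow> 0"
      unfolding Y_def by - (rule LIMSEQ_offset[of _ N], simp add: comp_def)
  qed
  then show ?thesis
    by (simp add: has_derivative_iff_norm bounded_linear_inner_right)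
qed

lemma isCont_param_integral:
  fixes K :: "'a::euclidean_space \<Rightarrow> 'b \<Rightarrow> 'c::euclidean_space"
  assumes r: "r > 0"
    and c: "\<And>y. y \<in> space M \<Longrightarrow> isCont (\<lambda>x. K x y) x0"
    and bd: "\<And>x y. x \<in> ball x0 r \<Longrightarrow> y \<in> space M \<Longrightarrow> norm (K x y) \<le> L"
    and w: "integrable M w"
    and meas: "\<And>x. x \<in> ball x0 r \<Longrightarrow> (\<lambda>y. K x y) \<in> borel_measurable M"
  shows "isCont (\<lambda>x. \<integral>y. w y *\<^sub>R K x y \<partial>M) x0"
  unfolding isCont_def tendsto_at_iff_sequentially
proof (intro allI impI)
  fix X assume X: "\<forall>i. X i \<in> UNIV - {x0}" "X \<longlonglongrightarrow> x0"
  from X(2) r obtain N where N: "\<And>n. n \<ge> N \<Longrightarrow> X n \<in> ball x0 r"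
    by (metis dist_commute lim_sequentially mem_ball)
  have Yl: "(\<lambda>n. X (n + N)) \<longlonglongrightarrow> x0" by (rule LIMSEQ_ignore_initial_segment[OF X(2)])
  have "(\<lambda>n. \<integral>y. w y *\<^sub>R K (X (n + N)) y \<partial>M) \<longlonglongrightarrow> (\<integral>y. w y *\<^sub>R K x0 y \<partial>M)"
  proof (rule integral_dominated_convergence[where w = "\<lambda>z. L * \<bar>w z\<bar>"])
    show "(\<lambda>y. w y *\<^sub>R K x0 y) \<in> borel_measurable M" "(\<lambda>y. w y *\<^sub>R K (X (n + N)) y) \<in> borel_measurable M" for n
      using w meas N r by (auto intro!: borel_measurable_scaleR)
    show "AE y in M. norm (w y *\<^sub>R K (X (n + N)) y) \<le> L * \<bar>w y\<bar>" for n
    proof (rule AE_I2)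
      fix y assume "y \<in> space M"
      then have "norm (K (X (n + N)) y) \<le> L" using bd[OF N[of "n + N"]] by simp
      then show "norm (w y *\<^sub>R K (X (n + N)) y) \<le> L * \<bar>w y\<bar>"
        using mult_left_mono[of "norm (K (X (n + N)) y)" L "\<bar>w y\<bar>"] by (simp add: mult.commute)
    qed
    show "AE y in M. (\<lambda>n. w y *\<^sub>R K (X (n + N)) y) \<longlonglongrightarrow> w y *\<^sub>R K x0 y"
      using isCont_tendsto_compose[OF c Yl] by (intro AE_I2 tendsto_scaleR tendsto_const) auto
  qed (use w in auto)
  then show "((\<lambda>x. \<integral>y. w y *\<^sub>R K x y \<partial>M) \<circ> X) \<longlonglongrightarrow> (\<integral>y. w y *\<^sub>R K x0 y \<partial>M)"
    by - (rule LIMSEQ_offset[of _ N], simp add: comp_def)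
qed

text \<open>The gradient is carried along as an explicit vector field because its formula, and not
  only its existence, enters the estimates.\<close>

definition C1_grad :: "'a::euclidean_space set \<Rightarrow> ('a \<Rightarrow> real) \<Rightarrow> ('a \<Rightarrow> 'a) \<Rightarrow> bool" where
  "C1_grad S f g \<longleftrightarrow> (\<forall>x\<in>S. (f has_derivative (\<lambda>h. g x \<bullet> h)) (at x)) \<and> continuous_on S g"

lemma C1_gradD:
  assumes "C1_grad S f g"
  shows "x \<in> S \<Longrightarrow> (f has_derivative (\<lambda>h. g x \<bullet> h)) (at x)" "continuous_on S g" "continuous_on S f"
proof -
  show "x \<in> S \<Longrightarrow> (f has_derivative (\<lambda>h. g x \<bullet> h)) (at x)" "continuous_on S g"
    using assms by (auto simp: C1_grad_def)
  show "continuous_on S f"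
    using assms has_derivative_continuous unfolding C1_grad_def
    by (metis continuous_at_imp_continuous_on)
qed

lemma C1_grad_subset: "C1_grad S f g \<Longrightarrow> T \<subseteq> S \<Longrightarrow> C1_grad T f g"
  by (auto simp: C1_grad_def intro: continuous_on_subset)

lemma C1_grad_mult:
  assumes "C1_grad S f g" "C1_grad S f' g'"
  shows "C1_grad S (\<lambda>x. f x * f' x) (\<lambda>x. f x *\<^sub>R g' x + f' x *\<^sub>R g x)"
  unfolding C1_grad_def
proof (intro conjI ballI)
  fix x assume x: "x \<in> S"
  show "((\<lambda>x. f x * f' x) has_derivative (\<lambda>h. (f x *\<^sub>R g' x + f' x *\<^sub>R g x) \<bullet> h)) (at x)"
    by (rule has_derivative_eq_rhs[OF has_derivative_mult[OF C1_gradD(1)[OF assms(1) x] C1_gradD(1)[OF assms(2) x]]])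
      (auto simp: inner_add_left)
qed (intro continuous_intros C1_gradD[OF assms(1)] C1_gradD[OF assms(2)])

lemma C1_grad_inverse:
  assumes "C1_grad S f g" "\<And>x. x \<in> S \<Longrightarrow> f x \<noteq> 0"
  shows "C1_grad S (\<lambda>x. inverse (f x)) (\<lambda>x. - (inverse (f x))\<^sup>2 *\<^sub>R g x)"
  unfolding C1_grad_def
proof (intro conjI ballI)
  fix x assume x: "x \<in> S"
  show "((\<lambda>x. inverse (f x)) has_derivative (\<lambda>h. (- (inverse (f x))\<^sup>2 *\<^sub>R g x) \<bullet> h)) (at x)"
    by (rule has_derivative_eq_rhs[OF Deriv.has_derivative_inverse[OF assms(2)[OF x] C1_gradD(1)[OF assms(1) x]]])
      (auto simp: power2_eq_square)
qed (intro continuous_intros C1_gradD[OF assms(1)] ballI assms(2), auto)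



lemma C1_grad_power:
  assumes "C1_grad S f g"
  shows "C1_grad S (\<lambda>x. f x ^ n) (\<lambda>x. (real n * f x ^ (n - 1)) *\<^sub>R g x)"
  unfolding C1_grad_def
proof (intro conjI ballI)
  fix x assume x: "x \<in> S"
  show "((\<lambda>x. f x ^ n) has_derivative (\<lambda>h. ((real n * f x ^ (n - 1)) *\<^sub>R g x) \<bullet> h)) (at x)"
    by (rule has_derivative_eq_rhs[OF has_derivative_power[OF C1_gradD(1)[OF assms x]]]) (auto simp: mult_ac)
qed (intro continuous_intros C1_gradD[OF assms])

text \<open>Away from the origin this is the chain rule. At the origin, where the norm is not
  differentiable, \<open>\<rho>' 0 = 0\<close> gives both the derivative 0 and the continuity of the
  gradient.\<close>

lemma C1_grad_radial:
  fixes \<rho> :: "real \<Rightarrow> real"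
  assumes d: "\<And>r. r \<ge> 0 \<Longrightarrow> (\<rho> has_real_derivative \<rho>' r) (at r within {0..})"
    and c: "continuous_on {0..} \<rho>'" and z: "\<rho>' 0 = 0"
  shows "C1_grad (UNIV :: 'a::euclidean_space set) (\<lambda>v. \<rho> (norm v)) (\<lambda>v. \<rho>' (norm v) *\<^sub>R sgn v)"
  unfolding C1_grad_def
proof (intro conjI ballI)
  fix v :: 'a
  show "((\<lambda>v. \<rho> (norm v)) has_derivative (\<lambda>h. (\<rho>' (norm v) *\<^sub>R sgn v) \<bullet> h)) (at v)"
  proof (cases "v = 0")
    case False
    have "(\<rho> has_real_derivative \<rho>' (norm v)) (at (norm v))"
      using d[of "norm v"] False at_within_interior[of "norm v" "{0..}"] by (simp add: interior_real_atLeast)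
    from DERIV_compose_FDERIV[OF this has_derivative_norm[OF False]]
    show ?thesis by (simp add: sgn_div_norm inner_commute mult_ac)
  next
    case True
    have "((\<lambda>r. (\<rho> r - \<rho> 0) / r) \<longlongrightarrow> 0) (at 0 within {0..})"
      using d[of 0] z by (simp add: has_field_derivative_iff)
    moreover have "filterlim norm (at 0 within {0..}) (at (0::'a))"
      by (auto simp: filterlim_at eventually_at_filter intro!: tendsto_eq_intros)
    ultimately have "((\<lambda>v::'a. (\<rho> (norm v) - \<rho> 0) / norm v) \<longlongrightarrow> 0) (at 0)"
      by (rule filterlim_compose)
    then have "((\<lambda>v::'a. norm (\<rho> (norm v) - \<rho> 0) / norm v) \<longlongrightarrow> 0) (at 0)"
      by (rule Lim_transform_eventually[OF tendsto_norm_zero]) (simp add: always_eventually)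
    then show ?thesis using True by (simp add: has_derivative_iff_norm)
  qed
next
  have cn: "continuous_on UNIV (\<lambda>v::'a. \<rho>' (norm v))"
    by (rule continuous_on_compose2[OF c]) (auto intro!: continuous_intros)
  show "continuous_on UNIV (\<lambda>v::'a. \<rho>' (norm v) *\<^sub>R sgn v)"
  proof (rule continuous_at_imp_continuous_on, intro ballI)
    fix v :: 'a
    show "isCont (\<lambda>v. \<rho>' (norm v) *\<^sub>R sgn v) v"
    proof (cases "v = 0")
      case False
      then show ?thesis
        using cn by (intro continuous_intros) (auto simp: continuous_on_eq_continuous_at)
    next
      case True
      have "((\<lambda>v::'a. \<rho>' (norm v)) \<longlongrightarrow> 0) (at 0)"
        using cn z by (simp add: continuous_on_eq_continuous_at isCont_def) (metis norm_zero)
      then have "((\<lambda>v::'a. \<rho>' (norm v) *\<^sub>R sgn v) \<longlongrightarrow> 0) (at 0)"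
        by (rule Lim_null_comparison[OF _ tendsto_rabs_zero, rotated]) (auto simp: norm_sgn intro!: always_eventually)
      then show ?thesis using True by (simp add: isCont_def)
    qed
  qed
qed

lemma C1_grad_cong:
  assumes "C1_grad S f g" "open S" "\<And>x. x \<in> S \<Longrightarrow> f x = f' x"
  shows "C1_grad S f' g"
  unfolding C1_grad_def
proof (intro conjI ballI)
  fix x assume x: "x \<in> S"
  show "(f' has_derivative (\<lambda>h. g x \<bullet> h)) (at x)"
    by (rule has_derivative_transform_within_open[OF C1_gradD(1)[OF assms(1) x] assms(2) x assms(3)])
qed (rule C1_gradD(2)[OF assms(1)])

lemma C1_grad_zero:
  assumes "C1_grad S f g" "open U" "U \<subseteq> S" "\<And>x. x \<in> U \<Longrightarrow> f x = 0" "x \<in> U"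
  shows "g x = 0"
proof -
  have "((\<lambda>x. 0) has_derivative (\<lambda>h. g x \<bullet> h)) (at x)"
    by (rule has_derivative_transform_within_open[OF C1_gradD(1)[OF assms(1)] assms(2,5)]) (use assms in auto)
  then have "(\<lambda>h. g x \<bullet> h) = (\<lambda>h. 0)"
    using has_derivative_unique has_derivative_const by metis
  then show ?thesis by (metis inner_eq_zero_iff)
qed

lemma C1_grad_zero_outside:
  assumes "C1_grad UNIV f g" "compact K" "\<And>x. x \<notin> K \<Longrightarrow> f x = 0" "x \<notin> K"
  shows "g x = 0"
  by (rule C1_grad_zero[OF assms(1), of "- K"]) (use assms in \<open>auto simp: compact_imp_closed open_Compl\<close>)

text \<open>The extension is C1 on each of the two open sets \<open>\<Omega>\<close> and
  \<open>- K\<close>. They cover the space, and on their overlap both the function and its gradient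
  vanish.\<close>

lemma C1_grad_extend:
  assumes f: "C1_grad \<Omega> f g" and \<Omega>: "open \<Omega>"
    and K: "compact K" "K \<subseteq> \<Omega>" "\<And>x. x \<in> \<Omega> - K \<Longrightarrow> f x = 0"
  shows "C1_grad UNIV (\<lambda>x. if x \<in> K then f x else 0) (\<lambda>x. if x \<in> K then g x else 0)"
proof -
  have oK: "open (- K)" and o\<Omega>K: "open (\<Omega> - K)"
    using K \<Omega> by (simp_all add: compact_imp_closed open_Compl open_Diff)
  have g0: "g x = 0" if "x \<in> \<Omega> - K" for x
    using C1_grad_zero[OF f o\<Omega>K _ K(3)] that by auto
  let ?h = "\<lambda>x. if x \<in> K then f x else 0" and ?H = "\<lambda>x. if x \<in> K then g x else 0"
  have 1: "C1_grad \<Omega> ?h ?H"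
    unfolding C1_grad_def
  proof (intro conjI ballI)
    fix x assume x: "x \<in> \<Omega>"
    have "?H x = g x" using x g0 by auto
    then have "(f has_derivative (\<lambda>h. ?H x \<bullet> h)) (at x)" using C1_gradD(1)[OF f x] by simp
    then show "(?h has_derivative (\<lambda>h. ?H x \<bullet> h)) (at x)"
      by (rule has_derivative_transform_within_open[OF _ \<Omega> x]) (use K(3) in auto)
  next
    show "continuous_on \<Omega> ?H"
      by (rule continuous_on_eq[OF C1_gradD(2)[OF f]]) (use g0 in auto)
  qed
  have 2: "C1_grad (- K) ?h ?H"
    unfolding C1_grad_def
  proof (intro conjI ballI)
    fix x assume x: "x \<in> - K"
    have "((\<lambda>x. 0) has_derivative (\<lambda>h. ?H x \<bullet> h)) (at x)" using x by simp
    then show "(?h has_derivative (\<lambda>h. ?H x \<bullet> h)) (at x)"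
      by (rule has_derivative_transform_within_open[OF _ oK x]) auto
  next
    show "continuous_on (- K) ?H"
      by (rule continuous_on_eq[OF continuous_on_const[of _ 0]]) auto
  qed
  have "\<Omega> \<union> - K = UNIV" using K by auto
  moreover have "continuous_on (\<Omega> \<union> - K) ?H"
    using 1 2 \<Omega> oK unfolding C1_grad_def by (intro continuous_on_open_Un) simp_all
  then have "C1_grad (\<Omega> \<union> - K) ?h ?H"
    using 1 2 unfolding C1_grad_def by blast
  ultimately show ?thesis by metis
qed

lemma C1_grad_mult_extend:
  assumes f: "C1_grad \<Omega> f g" and \<Omega>: "open \<Omega>" and \<phi>: "C1_grad UNIV \<phi> \<psi>"
    and K: "compact K" "K \<subseteq> \<Omega>" "\<And>x. x \<notin> K \<Longrightarrow> \<phi> x = 0"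
  shows "C1_grad UNIV (\<lambda>x. if x \<in> K then f x * \<phi> x else 0)
     (\<lambda>x. if x \<in> K then f x *\<^sub>R \<psi> x + \<phi> x *\<^sub>R g x else 0)"
  by (rule C1_grad_extend[OF C1_grad_mult[OF f C1_grad_subset[OF \<phi>]] \<Omega> K(1,2)]) (use K(3) in auto)

text \<open>All translates of \<open>f\<close> have the same integral, so each difference quotient
  in direction \<open>b\<close> integrates to zero. Dominated convergence passes this on to the
  derivative.\<close>

lemma integral_grad_compact_support:
  fixes f :: "'a::euclidean_space \<Rightarrow> real"
  assumes f: "C1_grad UNIV f g" and K: "compact K" "\<And>x. x \<notin> K \<Longrightarrow> f x = 0"
  shows "(\<integral>x. g x \<bullet> b \<partial>lborel) = 0"
proof -
  have g0: "g x = 0" if "x \<notin> K" for x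
    by (rule C1_grad_zero_outside[OF f K(1) K(2) that])
  have cf: "continuous_on UNIV f" and cg: "continuous_on UNIV g" using C1_gradD[OF f] by auto
  have fm: "f \<in> borel_measurable borel" "g \<in> borel_measurable borel"
    using cf cg by (auto intro: borel_measurable_continuous_onI)
  obtain r where r: "r > 0" "\<And>x. x \<in> K \<Longrightarrow> norm x \<le> r"
    using K(1) compact_imp_bounded bounded_pos by metis
  have "bounded (g ` K)"
    using K(1) cg by (intro compact_imp_bounded compact_continuous_image continuous_on_subset[OF cg]) auto
  then obtain L where "L > 0" "\<And>x. x \<in> K \<Longrightarrow> norm (g x) \<le> L" by (auto simp: bounded_pos)
  then have L: "L > 0" "\<And>x. norm (g x) \<le> L" using g0 by (metis less_eq_real_def norm_zero)+
  have "bounded (f ` K)"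
    using K(1) cf by (intro compact_imp_bounded compact_continuous_image continuous_on_subset[OF cf]) auto
  then obtain B where "B > 0" "\<And>x. x \<in> K \<Longrightarrow> norm (f x) \<le> B" by (auto simp: bounded_pos)
  then have B: "B > 0" "\<And>x. norm (f x) \<le> B" using K(2) by (metis less_eq_real_def norm_zero)+
  have int_ind: "integrable lborel (\<lambda>x::'a. C * indicator (cball 0 s) x :: real)" for C s
    using emeasure_lborel_cball_finite[of "0::'a" s] by (intro integrable_mult_right integrable_real_indicator) auto
  have fi: "integrable lborel f"
  proof (rule Bochner_Integration.integrable_bound[OF int_ind[of B r]])
    show "AE x in lborel. norm (f x) \<le> norm (B * indicator (cball 0 r) x)"
      using B r K(2) by (intro AE_I2) (auto simp: indicator_def dest: r(2))
  qed (use fm in auto)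
  \<comment> \<open>Difference quotient with step 1 / (n + 1). The increment is no longer than
    \<open>norm b\<close>, which is why the dominating function lives on a ball enlarged by
    \<open>norm b\<close>.\<close>
  define s where "s n x = real (Suc n) * (f (x + (1 / real (Suc n)) *\<^sub>R b) - f x)" for n x
  have "(\<lambda>n. \<integral>x. s n x \<partial>lborel) \<longlonglongrightarrow> (\<integral>x. g x \<bullet> b \<partial>lborel)"
  proof (rule integral_dominated_convergence[where w = "\<lambda>x. (L * norm b) * indicator (cball 0 (r + norm b)) x"])
    show "(\<lambda>x. g x \<bullet> b) \<in> borel_measurable lborel"
      using fm by simp
    have "continuous_on UNIV (s n)" for n
      unfolding s_def[abs_def] by (intro continuous_intros continuous_on_compose2[OF cf]) auto
    then show "s n \<in> borel_measurable lborel" for n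
      by (simp add: borel_measurable_continuous_onI)
    show "AE x in lborel. norm (s n x) \<le> (L * norm b) * indicator (cball 0 (r + norm b)) x" for n
    proof (rule AE_I2)
      fix x
      let ?y = "x + (1 / real (Suc n)) *\<^sub>R b"
      show "norm (s n x) \<le> (L * norm b) * indicator (cball 0 (r + norm b)) x"
      proof (cases "norm x \<le> r + norm b")
        case True
        have "\<bar>f ?y - f x\<bar> \<le> L * norm (?y - x)"
          by (rule inner_deriv_bound[of UNIV]) (use L C1_gradD(1)[OF f] in auto)
        then have "real (Suc n) * \<bar>f ?y - f x\<bar> \<le> real (Suc n) * (L * norm (?y - x))"
          by (intro mult_left_mono) auto
        also have "\<dots> = L * norm b" by simp
        finally show ?thesis using True by (simp add: s_def abs_mult)
      next
        case False
        have "norm ((1 / real (Suc n)) *\<^sub>R b) = norm b / real (Suc n)" by simp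
        also have "\<dots> \<le> norm b / 1" by (intro divide_left_mono) auto
        finally have "norm ((1 / real (Suc n)) *\<^sub>R b) \<le> norm b" by simp
        moreover have "norm x \<le> norm ?y + norm ((1 / real (Suc n)) *\<^sub>R b)"
          using norm_triangle_ineq4[of ?y "(1 / real (Suc n)) *\<^sub>R b"] by simp
        ultimately have "norm ?y > r" "norm x > r" using False norm_ge_zero[of b] by linarith+
        then have "?y \<notin> K" "x \<notin> K" using r(2) by (meson not_less)+
        then have "f ?y = 0" "f x = 0" using K(2) by blast+
        then show ?thesis using False L by (simp add: s_def)
      qed
    qed
    show "AE x in lborel. (\<lambda>n. s n x) \<longlonglongrightarrow> g x \<bullet> b"
    proof (rule AE_I2)
      fix x
      have "((\<lambda>t. x + t *\<^sub>R b) has_derivative (\<lambda>t. t *\<^sub>R b)) (at 0)"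
        by (auto intro!: derivative_eq_intros)
      moreover have "(f has_derivative (\<lambda>h. g x \<bullet> h)) (at (x + 0 *\<^sub>R b))" using C1_gradD(1)[OF f, of x] by simp
      ultimately have "((\<lambda>t. f (x + t *\<^sub>R b)) has_derivative (\<lambda>t. g x \<bullet> (t *\<^sub>R b))) (at 0)"
        by (rule has_derivative_compose)
      then have "((\<lambda>t. f (x + t *\<^sub>R b)) has_real_derivative (g x \<bullet> b)) (at 0)"
        by (simp add: has_field_derivative_def mult_commute_abs)
      then have "((\<lambda>t. (f (x + t *\<^sub>R b) - f x) / t) \<longlongrightarrow> g x \<bullet> b) (at 0)"
        by (simp add: has_field_derivative_iff)
      moreover have "filterlim (\<lambda>n. 1 / real (Suc n)) (at 0) sequentially"
        using LIMSEQ_inverse_real_of_nat by (auto simp: filterlim_at inverse_eq_divide)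
      ultimately have "(\<lambda>n. (f (x + (1 / real (Suc n)) *\<^sub>R b) - f x) / (1 / real (Suc n))) \<longlonglongrightarrow> g x \<bullet> b"
        by (rule filterlim_compose)
      then show "(\<lambda>n. s n x) \<longlonglongrightarrow> g x \<bullet> b" by (simp add: s_def mult.commute)
    qed
  qed (rule int_ind)
  moreover have "(\<integral>x. s n x \<partial>lborel) = 0" for n
  proof -
    let ?c = "(1 / real (Suc n)) *\<^sub>R b"
    have "integrable (distr lborel borel ((+) ?c)) f" using fi by (simp add: lborel_distr_plus)
    then have 1: "integrable lborel (\<lambda>x. f (?c + x))" by (subst (asm) integrable_distr_eq) (use fm in auto)
    have "(\<integral>x. f x \<partial>lborel) = (\<integral>x. f x \<partial>distr lborel borel ((+) ?c))" by (simp add: lborel_distr_plus)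
    also have "\<dots> = (\<integral>x. f (?c + x) \<partial>lborel)" by (rule integral_distr) (use fm in auto)
    finally show ?thesis using fi 1 by (simp add: s_def[abs_def] add.commute)
  qed
  ultimately show ?thesis by (simp add: LIMSEQ_const_iff)
qed

text \<open>After multiplication with \<open>indicator K\<close> a function continuous on
  \<open>\<Omega>\<close> is Borel measurable and integrable. This allows integrals over
  \<open>\<Omega>\<close> to be computed with \<open>lborel\<close>, where translation invariance is
  used.\<close>

lemma integral_compact_support:
  fixes F :: "'a::euclidean_space \<Rightarrow> real"
  assumes \<Omega>: "open \<Omega>" and K: "compact K" "K \<subseteq> \<Omega>"
    and F: "continuous_on \<Omega> F" "\<And>x. x \<in> \<Omega> - K \<Longrightarrow> F x = 0"
  shows "integrable (lebesgue_on \<Omega>) F"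
    "(LINT x|lebesgue_on \<Omega>. F x) = (\<integral>x. indicator K x * F x \<partial>lborel)"
    "integrable lborel (\<lambda>x. indicator K x * F x)"
proof -
  have eq: "(\<lambda>x. indicator \<Omega> x *\<^sub>R F x) = (\<lambda>x. indicator K x * F x)"
    using F(2) K(2) by (auto simp: indicator_def fun_eq_iff)
  show i: "integrable lborel (\<lambda>x. indicator K x * F x)"
    using borel_integrable_compact[OF K(1) continuous_on_subset[OF F(1) K(2)]]
    by (simp add: indicator_def if_distrib cong: if_cong)
  then have m: "(\<lambda>x. indicator K x * F x) \<in> borel_measurable lborel"
    by (rule borel_measurable_integrable)
  have "\<Omega> \<inter> space lebesgue \<in> sets lebesgue" using \<Omega> by auto
  from integrable_restrict_space[OF this, of F] integral_restrict_space[OF this, of F]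
  show "integrable (lebesgue_on \<Omega>) F"
    "(LINT x|lebesgue_on \<Omega>. F x) = (\<integral>x. indicator K x * F x \<partial>lborel)"
    unfolding eq integrable_completion[OF m] integral_completion[OF m] using i by simp_all
qed

text \<open>Although \<open>f\<close> is controlled only on \<open>\<Omega>\<close>, its product
  with \<open>\<phi>\<close> extends by zero to a C1 function on the whole space, and the gradient
  of that extension integrates to zero.\<close>

lemma integral_by_parts_C1:
  fixes f :: "'a::euclidean_space \<Rightarrow> real"
  assumes f: "C1_grad \<Omega> f g" and \<Omega>: "open \<Omega>" and \<phi>: "C1_grad UNIV \<phi> \<psi>"
    and K: "compact K" "K \<subseteq> \<Omega>" "\<And>x. x \<notin> K \<Longrightarrow> \<phi> x = 0"
  shows "(LINT x|lebesgue_on \<Omega>. f x * (\<psi> x \<bullet> b)) = - (LINT x|lebesgue_on \<Omega>. (g x \<bullet> b) * \<phi> x)"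
    (is "?A = - ?B")
proof -
  have \<psi>0: "\<psi> x = 0" if "x \<notin> K" for x
    by (rule C1_grad_zero_outside[OF \<phi> K(1) K(3) that])
  have c: "continuous_on \<Omega> f" "continuous_on \<Omega> g" "continuous_on \<Omega> \<phi>" "continuous_on \<Omega> \<psi>"
    using C1_gradD(2,3)[OF f] C1_gradD(2,3)[OF \<phi>] by (auto intro: continuous_on_subset)
  have 1: "continuous_on \<Omega> (\<lambda>x. f x * (\<psi> x \<bullet> b))" "continuous_on \<Omega> (\<lambda>x. (g x \<bullet> b) * \<phi> x)"
    by (intro continuous_intros c)+
  have 2: "?A = (\<integral>x. indicator K x * (f x * (\<psi> x \<bullet> b)) \<partial>lborel)" "integrable lborel (\<lambda>x. indicator K x * (f x * (\<psi> x \<bullet> b)))"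
    using integral_compact_support[OF \<Omega> K(1,2) 1(1)] \<psi>0 by auto
  have 3: "?B = (\<integral>x. indicator K x * ((g x \<bullet> b) * \<phi> x) \<partial>lborel)" "integrable lborel (\<lambda>x. indicator K x * ((g x \<bullet> b) * \<phi> x))"
    using integral_compact_support[OF \<Omega> K(1,2) 1(2)] K(3) by auto
  have "?A + ?B = (\<integral>x. (if x \<in> K then f x *\<^sub>R \<psi> x + \<phi> x *\<^sub>R g x else 0) \<bullet> b \<partial>lborel)"
    unfolding 2(1) 3(1)
    by (subst Bochner_Integration.integral_add[symmetric, OF 2(2) 3(2)], intro Bochner_Integration.integral_cong)
      (auto simp: indicator_def algebra_simps)
  also have "\<dots> = 0"
    by (rule integral_grad_compact_support[OF C1_grad_mult_extend[OF f \<Omega> \<phi> K] K(1)]) simp_all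
  finally show ?thesis by simp
qed

section \<open>Mollification\<close>

lemma Cc_infinity_C1_grad:
  assumes "\<phi> \<in> Cc_infinity \<Omega>"
  obtains \<psi> K where "C1_grad UNIV \<phi> \<psi>" "compact K" "K \<subseteq> \<Omega>" "\<And>x. x \<notin> K \<Longrightarrow> \<phi> x = 0"
    "\<And>x b. frechet_derivative \<phi> (at x) b = \<psi> x \<bullet> b"
proof -
  have "C_k (Suc 0) UNIV \<phi>" using assms unfolding Cc_infinity_def by blast
  then have d: "\<And>x. \<phi> differentiable (at x)" and c: "\<And>v. continuous_on UNIV (\<lambda>x. frechet_derivative \<phi> (at x) v)"
    by auto
  define \<psi> where "\<psi> x = (\<Sum>b\<in>Basis. frechet_derivative \<phi> (at x) b *\<^sub>R b)" for x
  have fd: "(\<phi> has_derivative frechet_derivative \<phi> (at x)) (at x)" for x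
    using d frechet_derivative_works by blast
  have eq: "frechet_derivative \<phi> (at x) h = \<psi> x \<bullet> h" for x h
  proof -
    have "frechet_derivative \<phi> (at x) h = frechet_derivative \<phi> (at x) (\<Sum>b\<in>Basis. (h \<bullet> b) *\<^sub>R b)"
      by (simp add: euclidean_representation)
    also have "\<dots> = (\<Sum>b\<in>Basis. (h \<bullet> b) * frechet_derivative \<phi> (at x) b)"
      using has_derivative_linear[OF fd[of x]] by (simp add: linear_sum linear_cmul)
    also have "\<dots> = \<psi> x \<bullet> h"
      by (simp add: \<psi>_def inner_sum_left inner_commute[of h] mult.commute)
    finally show ?thesis .
  qed
  have "(\<phi> has_derivative (\<lambda>h. \<psi> x \<bullet> h)) (at x)" for x
    using fd[of x] by (simp add: eq[abs_def])
  moreover have "continuous_on UNIV \<psi>"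
    unfolding \<psi>_def[abs_def] by (intro continuous_intros c)
  ultimately have "C1_grad UNIV \<phi> \<psi>" by (simp add: C1_grad_def)
  moreover have "compact (closure {x. \<phi> x \<noteq> 0})" "closure {x. \<phi> x \<noteq> 0} \<subseteq> \<Omega>"
    using assms by (auto simp: Cc_infinity_def)
  moreover have "\<phi> x = 0" if "x \<notin> closure {x. \<phi> x \<noteq> 0}" for x
    using that closure_subset[of "{x. \<phi> x \<noteq> 0}"] by blast
  ultimately show ?thesis using that eq by blast
qed

lemma cutoff_algebra_C1_grad:
  assumes "\<beta> \<in> cutoff_algebra"
  obtains g where "C1_grad UNIV \<beta> g" "\<And>v. (\<lambda>x. g x \<bullet> v) \<in> cutoff_algebra"
proof -
  obtain D where D: "\<And>x. (\<beta> has_derivative D x) (at x)" "\<And>v. (\<lambda>x. D x v) \<in> cutoff_algebra"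
    using cutoff_algebra_derivative[OF assms] by blast
  define g where "g x = (\<Sum>b\<in>Basis. D x b *\<^sub>R b)" for x
  have eq: "D x h = g x \<bullet> h" for x h
  proof -
    have "D x h = D x (\<Sum>b\<in>Basis. (h \<bullet> b) *\<^sub>R b)"
      by (simp add: euclidean_representation)
    also have "\<dots> = (\<Sum>b\<in>Basis. (h \<bullet> b) * D x b)"
      using has_derivative_linear[OF D(1)[of x]] by (simp add: linear_sum linear_cmul)
    also have "\<dots> = g x \<bullet> h"
      by (simp add: g_def inner_sum_left inner_commute[of h] mult.commute)
    finally show ?thesis .
  qed
  have "(\<beta> has_derivative (\<lambda>h. g x \<bullet> h)) (at x)" for x
    using D(1)[of x] by (simp add: eq[abs_def])
  moreover have "continuous_on UNIV g"
    unfolding g_def[abs_def] by (intro continuous_intros cutoff_algebra_continuous D)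
  moreover have "(\<lambda>x. g x \<bullet> v) \<in> cutoff_algebra" for v
    using D(2)[of v] by (simp add: eq)
  ultimately show ?thesis using that[of g] unfolding C1_grad_def by blast
qed

section \<open>Convolution with smooth cutoff functions\<close>

lemma continuous_compact_support_bounded:
  fixes f :: "'a::euclidean_space \<Rightarrow> 'b::real_normed_vector"
  assumes "continuous_on K f" "compact K" "\<And>x. x \<notin> K \<Longrightarrow> f x = 0"
  obtains B where "B > 0" "\<And>x. norm (f x) \<le> B"
proof -
  have "bounded (f ` K)"
    using assms by (intro compact_imp_bounded compact_continuous_image)
  then obtain B where "B > 0" "\<And>x. x \<in> K \<Longrightarrow> norm (f x) \<le> B" by (auto simp: bounded_pos)
  then have "norm (f x) \<le> B" for x by (cases "x \<in> K") (use assms(3) in auto)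
  then show ?thesis using that \<open>B > 0\<close> by blast
qed

lemma lborel_integral_reflect:
  fixes F :: "'a::euclidean_space \<Rightarrow> 'b::{banach, second_countable_topology}"
  assumes "F \<in> borel_measurable borel"
  shows "(\<integral>y. F (x - y) \<partial>lborel) = (\<integral>y. F y \<partial>lborel)"
proof -
  have "(\<integral>y. F y \<partial>lborel) = (\<integral>y. F y \<partial>distr lborel borel ((+) x))" by (simp add: lborel_distr_plus)
  also have "\<dots> = (\<integral>y. F (x + y) \<partial>lborel)" by (rule integral_distr) (use assms in auto)
  also have "\<dots> = (\<integral>y. F (x + y) \<partial>distr lborel borel (\<lambda>y. - y))"
    using lborel_affine[of "-1" "0::'a"] by (simp add: density_1)
  also have "\<dots> = (\<integral>y. F (x + - y) \<partial>lborel)" by (rule integral_distr) (use assms in auto)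
  finally show ?thesis by simp
qed

lemma integrable_continuous_compact_support:
  fixes f :: "'a::euclidean_space \<Rightarrow> real"
  assumes "continuous_on UNIV f" "compact K" "\<And>x. x \<notin> K \<Longrightarrow> f x = 0"
  shows "integrable lborel f"
proof -
  have "(\<lambda>x. indicator K x * f x) = f" using assms(3) by (auto simp: indicator_def fun_eq_iff)
  then show ?thesis
    using integral_compact_support(3)[of UNIV K f] assms by simp
qed

text \<open>The derivative falls on \<open>\<beta>\<close>. Its components stay in
  \<open>cutoff_algebra\<close> and keep the support \<open>S\<close>, so the same statement applies
  to them: this is the induction step for the smoothness of the convolution.\<close>

lemma cutoff_convolution_derivative:
  fixes \<psi> :: "'a::euclidean_space \<Rightarrow> real"
  assumes \<beta>: "\<beta> \<in> cutoff_algebra" "compact S" "\<And>x. x \<notin> S \<Longrightarrow> \<beta> x = 0"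
    and \<psi>: "continuous_on UNIV \<psi>" "compact K" "\<And>x. x \<notin> K \<Longrightarrow> \<psi> x = 0"
  shows "\<exists>g. (\<forall>x. ((\<lambda>x. \<integral>y. \<beta> (x - y) * \<psi> y \<partial>lborel) has_derivative (\<lambda>h. \<integral>y. (g (x - y) \<bullet> h) * \<psi> y \<partial>lborel)) (at x)) \<and>
    (\<forall>v. (\<lambda>x. g x \<bullet> v) \<in> cutoff_algebra) \<and> (\<forall>x. x \<notin> S \<longrightarrow> g x = 0)"
proof -
  obtain g where g: "C1_grad UNIV \<beta> g" "\<And>v. (\<lambda>x. g x \<bullet> v) \<in> cutoff_algebra"
    using cutoff_algebra_C1_grad[OF \<beta>(1)] by blast
  have oS: "open (- S)" using \<beta>(2) by (simp add: compact_imp_closed open_Compl)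
  have g0: "g x = 0" if "x \<notin> S" for x
    using C1_grad_zero[OF g(1) oS] \<beta>(3) that by auto
  have cg: "continuous_on UNIV g" and c\<beta>: "continuous_on UNIV \<beta>" using C1_gradD[OF g(1)] by auto
  obtain L where L: "\<And>x. norm (g x) \<le> L"
    using continuous_compact_support_bounded[OF continuous_on_subset[OF cg subset_UNIV] \<beta>(2) g0] by blast
  have i\<psi>: "integrable lborel \<psi>" by (rule integrable_continuous_compact_support[OF \<psi>])
  have "((\<lambda>x. \<integral>y. \<beta> (x - y) * \<psi> y \<partial>lborel) has_derivative (\<lambda>h. \<integral>y. (g (x - y) \<bullet> h) * \<psi> y \<partial>lborel)) (at x)" for x
  proof -
    have m: "(\<lambda>y. g (x - y)) \<in> borel_measurable lborel" for x
      unfolding measurable_lborel2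
      by (rule borel_measurable_continuous_onI, rule continuous_on_compose2[OF cg])
        (auto intro!: continuous_intros)
    have "((\<lambda>x. \<integral>y. \<beta> (x - y) * \<psi> y \<partial>lborel) has_derivative (\<lambda>h. (\<integral>y. \<psi> y *\<^sub>R g (x - y) \<partial>lborel) \<bullet> h)) (at x)"
    proof (rule has_derivative_param_integral[where r = 1 and L = L])
      fix x' y :: 'a
      have "((\<lambda>x. x - y) has_derivative (\<lambda>h. h)) (at x')" by (auto intro!: derivative_eq_intros)
      from has_derivative_compose[OF this C1_gradD(1)[OF g(1) UNIV_I, of "x' - y"]]
      show "((\<lambda>x. \<beta> (x - y)) has_derivative (\<lambda>h. g (x' - y) \<bullet> h)) (at x')" by simp
      show "integrable lborel (\<lambda>y. \<beta> (x' - y) * \<psi> y)"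
        by (rule integrable_continuous_compact_support[OF _ \<psi>(2)])
          (auto intro!: continuous_intros continuous_on_compose2[OF c\<beta>] \<psi> simp: \<psi>(3))
    qed (use L m i\<psi> in auto)
    moreover have "(\<integral>y. \<psi> y *\<^sub>R g (x - y) \<partial>lborel) \<bullet> h = (\<integral>y. (g (x - y) \<bullet> h) * \<psi> y \<partial>lborel)" for h
    proof -
      have "integrable lborel (\<lambda>y. \<psi> y *\<^sub>R g (x - y))"
      proof (rule Bochner_Integration.integrable_bound)
        show "integrable lborel (\<lambda>y. L * \<psi> y)" using i\<psi> by simp
        show "AE y in lborel. norm (\<psi> y *\<^sub>R g (x - y)) \<le> norm (L * \<psi> y)"
        proof (rule AE_I2)
          fix y
          have "norm (g (x - y)) \<le> \<bar>L\<bar>" using L[of "x - y"] by linarith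
          then show "norm (\<psi> y *\<^sub>R g (x - y)) \<le> norm (L * \<psi> y)"
            using mult_left_mono[of "norm (g (x - y))" "\<bar>L\<bar>" "\<bar>\<psi> y\<bar>"] by (simp add: abs_mult mult.commute)
        qed
      qed (use m i\<psi> in auto)
      then show ?thesis by (subst integral_inner_left[symmetric]) (auto simp: mult.commute)
    qed
    ultimately show ?thesis by simp
  qed
  then show ?thesis by (intro exI[of _ g] conjI allI impI g(2) g0)
qed

lemma cutoff_convolution_C_k:
  fixes \<psi> :: "'a::euclidean_space \<Rightarrow> real"
  assumes \<beta>: "\<beta> \<in> cutoff_algebra" "compact S" "\<And>x. x \<notin> S \<Longrightarrow> \<beta> x = 0"
    and \<psi>: "continuous_on UNIV \<psi>" "compact K" "\<And>x. x \<notin> K \<Longrightarrow> \<psi> x = 0"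
  shows "C_k k UNIV (\<lambda>x. \<integral>y. \<beta> (x - y) * \<psi> y \<partial>lborel)"
  using \<beta>
proof (induction k arbitrary: \<beta>)
  case 0
  have "\<exists>g. (\<forall>x. ((\<lambda>x. \<integral>y. \<beta> (x - y) * \<psi> y \<partial>lborel) has_derivative (\<lambda>h. \<integral>y. (g (x - y) \<bullet> h) * \<psi> y \<partial>lborel)) (at x)) \<and>
    (\<forall>v. (\<lambda>x. g x \<bullet> v) \<in> cutoff_algebra) \<and> (\<forall>x. x \<notin> S \<longrightarrow> g x = 0)"
    by (rule cutoff_convolution_derivative[of \<beta> S \<psi> K, OF 0(1,2) _ \<psi>(1,2)]) (use 0(3) \<psi>(3) in auto)
  then obtain g where g: "\<forall>x. ((\<lambda>x. \<integral>y. \<beta> (x - y) * \<psi> y \<partial>lborel) has_derivative (\<lambda>h. \<integral>y. (g (x - y) \<bullet> h) * \<psi> y \<partial>lborel)) (at x)"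
     "\<forall>v. (\<lambda>x. g x \<bullet> v) \<in> cutoff_algebra" "\<forall>x. x \<notin> S \<longrightarrow> g x = 0"
    by (elim exE conjE)
  show ?case
    unfolding C_k.simps by (intro continuous_at_imp_continuous_on ballI has_derivative_continuous[OF g(1)[rule_format]])
next
  case (Suc k)
  have "\<exists>g. (\<forall>x. ((\<lambda>x. \<integral>y. \<beta> (x - y) * \<psi> y \<partial>lborel) has_derivative (\<lambda>h. \<integral>y. (g (x - y) \<bullet> h) * \<psi> y \<partial>lborel)) (at x)) \<and>
    (\<forall>v. (\<lambda>x. g x \<bullet> v) \<in> cutoff_algebra) \<and> (\<forall>x. x \<notin> S \<longrightarrow> g x = 0)"
    by (rule cutoff_convolution_derivative[of \<beta> S \<psi> K, OF Suc.prems(1,2) _ \<psi>(1,2)]) (use Suc.prems(3) \<psi>(3) in auto)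
  then obtain g where g: "\<forall>x. ((\<lambda>x. \<integral>y. \<beta> (x - y) * \<psi> y \<partial>lborel) has_derivative (\<lambda>h. \<integral>y. (g (x - y) \<bullet> h) * \<psi> y \<partial>lborel)) (at x)"
     "\<forall>v. (\<lambda>x. g x \<bullet> v) \<in> cutoff_algebra" "\<forall>x. x \<notin> S \<longrightarrow> g x = 0"
    by (elim exE conjE)
  have fd: "frechet_derivative (\<lambda>x. \<integral>y. \<beta> (x - y) * \<psi> y \<partial>lborel) (at x) = (\<lambda>h. \<integral>y. (g (x - y) \<bullet> h) * \<psi> y \<partial>lborel)" for x
    by (rule frechet_derivative_at[OF g(1)[rule_format], symmetric])
  have "C_k k UNIV (\<lambda>x. \<integral>y. (g (x - y) \<bullet> v) * \<psi> y \<partial>lborel)" for v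
    using g(3) by (intro Suc.IH[OF g(2)[rule_format] Suc.prems(2)]) simp
  then show ?case
    unfolding C_k.simps fd differentiable_def using g(1) by blast
qed

text \<open>All the mass of \<open>\<beta> n\<close> lies within \<open>\<epsilon> n\<close> of the
  origin, where \<open>G (x - y)\<close> is close to \<open>G x\<close> by continuity at
  \<open>x\<close>.\<close>

lemma approximate_identity_tendsto:
  fixes G :: "'a::euclidean_space \<Rightarrow> 'b::euclidean_space"
  assumes G: "continuous_on UNIV G" "\<And>x. norm (G x) \<le> B"
    and \<beta>: "\<And>n. integrable lborel (\<beta> n)" "\<And>n x. 0 \<le> \<beta> n x" "\<And>n. (\<integral>x. \<beta> n x \<partial>lborel) = 1"
    and s: "\<And>n x. \<beta> n x \<noteq> 0 \<Longrightarrow> norm x \<le> \<epsilon> n" "\<epsilon> \<longlonglongrightarrow> 0"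
  shows "(\<lambda>n. \<integral>y. \<beta> n y *\<^sub>R G (x - y) \<partial>lborel) \<longlonglongrightarrow> G x"
    "integrable lborel (\<lambda>y. \<beta> n y *\<^sub>R G (x - y))"
    "norm (\<integral>y. \<beta> n y *\<^sub>R G (x - y) \<partial>lborel) \<le> B"
proof -
  have m: "(\<lambda>y. G (x - y)) \<in> borel_measurable lborel"
    unfolding measurable_lborel2
    by (rule borel_measurable_continuous_onI, rule continuous_on_compose2[OF G(1)])
      (auto intro!: continuous_intros)
  have B0: "B \<ge> 0" using norm_ge_zero G(2) order_trans by blast
  show i: "integrable lborel (\<lambda>y. \<beta> n y *\<^sub>R G (x - y))" for n
  proof (rule Bochner_Integration.integrable_bound)
    show "integrable lborel (\<lambda>y. \<beta> n y * B)" using \<beta>(1) by simp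
    show "AE y in lborel. norm (\<beta> n y *\<^sub>R G (x - y)) \<le> norm (\<beta> n y * B)"
      using \<beta>(2) G(2) B0 by (intro AE_I2) (simp add: abs_mult mult_left_mono)
  qed (use m \<beta>(1) in auto)
  have bd: "norm (\<integral>y. \<beta> n y *\<^sub>R H y \<partial>lborel) \<le> c"
    if "integrable lborel (\<lambda>y. \<beta> n y *\<^sub>R H y)" "\<And>y. \<beta> n y \<noteq> 0 \<Longrightarrow> norm (H y) \<le> c" for n c and H :: "'a \<Rightarrow> 'b"
  proof -
    have "norm (\<integral>y. \<beta> n y *\<^sub>R H y \<partial>lborel) \<le> (\<integral>y. \<beta> n y * c \<partial>lborel)"
    proof (rule Bochner_Integration.integral_norm_bound_integral)
      show "norm (\<beta> n y *\<^sub>R H y) \<le> \<beta> n y * c" for y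
        using that(2)[of y] \<beta>(2)[of n y] by (cases "\<beta> n y = 0") (auto intro: mult_left_mono)
    qed (use \<beta>(1) that(1) in auto)
    then show ?thesis using \<beta> by simp
  qed
  show "norm (\<integral>y. \<beta> n y *\<^sub>R G (x - y) \<partial>lborel) \<le> B" by (rule bd[OF i]) (rule G(2))
  show "(\<lambda>n. \<integral>y. \<beta> n y *\<^sub>R G (x - y) \<partial>lborel) \<longlonglongrightarrow> G x"
  proof (rule LIMSEQ_I)
    fix r :: real assume r: "r > 0"
    have "isCont G x" using G(1) by (simp add: continuous_on_eq_continuous_at)
    then obtain d where d: "d > 0" "\<And>z. dist z x < d \<Longrightarrow> dist (G z) (G x) < r / 2"
      unfolding continuous_at_eps_delta using r half_gt_zero by metis
    from s(2) d(1) obtain N where N: "\<And>n. n \<ge> N \<Longrightarrow> \<bar>\<epsilon> n\<bar> < d"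
      by (auto simp: lim_sequentially)
    show "\<exists>no. \<forall>n\<ge>no. norm ((\<integral>y. \<beta> n y *\<^sub>R G (x - y) \<partial>lborel) - G x) < r"
    proof (intro exI allI impI)
      fix n assume n: "n \<ge> N"
      have "(\<integral>y. \<beta> n y *\<^sub>R G (x - y) \<partial>lborel) - G x = (\<integral>y. \<beta> n y *\<^sub>R G (x - y) - \<beta> n y *\<^sub>R G x \<partial>lborel)"
        using \<beta> i by (subst Bochner_Integration.integral_diff) auto
      also have "\<dots> = (\<integral>y. \<beta> n y *\<^sub>R (G (x - y) - G x) \<partial>lborel)" by (simp add: scaleR_diff_right)
      also have "norm \<dots> \<le> r / 2"
      proof (rule bd)
        show "integrable lborel (\<lambda>y. \<beta> n y *\<^sub>R (G (x - y) - G x))"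
          using i \<beta>(1) by (simp add: scaleR_diff_right)
        fix y assume "\<beta> n y \<noteq> 0"
        then have "norm y < d" using s(1) N[OF n] by fastforce
        then show "norm (G (x - y) - G x) \<le> r / 2" using d(2)[of "x - y"] by (simp add: dist_norm)
      qed
      finally show "norm ((\<integral>y. \<beta> n y *\<^sub>R G (x - y) \<partial>lborel) - G x) < r" using r by linarith
    qed
  qed
qed

lemma box_bump_integral_pos:
  assumes "box a c \<noteq> {}" "n > 0"
  shows "integrable lborel (box_bump a c n)" "(\<integral>x. box_bump a c n x \<partial>lborel) > 0"
proof -
  have b0: "box_bump a c n x = 0" if "x \<notin> cbox a c" for x
    using that box_subset_cbox box_bump_eq_0[OF _ assms(2)] by blast
  show i: "integrable lborel (box_bump a c n)"
    by (rule integrable_continuous_compact_support[OF cutoff_algebra_continuous[OF box_bump_cutoff] compact_cbox b0])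
  have "(\<integral>x. box_bump a c n x \<partial>lborel) \<noteq> 0"
  proof
    assume "(\<integral>x. box_bump a c n x \<partial>lborel) = 0"
    then have "AE x in lborel. box_bump a c n x = 0"
      using integral_nonneg_eq_0_iff_AE[OF i] by (simp add: box_bump_nonneg)
    then have "AE x in lborel. x \<notin> box a c"
      by eventually_elim (use box_bump_pos[OF _ assms(2)] in fastforce)
    then have "box a c \<in> null_sets lborel"
      by (subst (asm) AE_iff_null_sets[symmetric]) auto
    then have "negligible (box a c)"
      by (simp add: negligible_iff_null_sets null_sets_completionI)
    then show False using open_not_negligible[OF open_box assms(1)] by simp
  qed
  moreover have "(\<integral>x. box_bump a c n x \<partial>lborel) \<ge> 0"
    by (intro integral_nonneg_AE AE_I2 box_bump_nonneg)
  ultimately show "(\<integral>x. box_bump a c n x \<partial>lborel) > 0" by linarith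
qed

text \<open>Multiplying a test function by a C1 coefficient leaves the class of smooth functions, so
  weak identities have to be extended to C1 functions of compact support. The bound
  \<open>B\<close>, uniform in \<open>n\<close>, lets the limit pass through integrals against
  merely integrable functions.\<close>

lemma C1_approximation_by_test_functions:
  fixes \<psi> :: "'a::euclidean_space \<Rightarrow> real"
  assumes \<psi>: "C1_grad UNIV \<psi> \<Psi>" and \<Omega>: "open \<Omega>"
    and K: "compact K" "K \<subseteq> \<Omega>" "\<And>x. x \<notin> K \<Longrightarrow> \<psi> x = 0"
  obtains \<phi> \<Phi> B where "\<And>n. \<phi> n \<in> Cc_infinity \<Omega>"
    "\<And>n x. (\<phi> n has_derivative (\<lambda>h. \<Phi> n x \<bullet> h)) (at x)"
    "\<And>x. (\<lambda>n::nat. \<phi> n x) \<longlonglongrightarrow> \<psi> x" "\<And>x. (\<lambda>n. \<Phi> n x) \<longlonglongrightarrow> \<Psi> x"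
    "\<And>n x. \<bar>\<phi> n x\<bar> \<le> B" "\<And>n x. norm (\<Phi> n x) \<le> B"
proof -
  have \<Psi>0: "\<Psi> x = 0" if "x \<notin> K" for x
    by (rule C1_grad_zero_outside[OF \<psi> K(1) K(3) that])
  have c: "continuous_on UNIV \<psi>" "continuous_on UNIV \<Psi>" using C1_gradD[OF \<psi>] by auto
  obtain B1 where B1: "\<And>x. norm (\<psi> x) \<le> B1"
    using continuous_compact_support_bounded[OF continuous_on_subset[OF c(1) subset_UNIV] K(1) K(3)] by blast
  obtain B2 where B2: "\<And>x. norm (\<Psi> x) \<le> B2"
    using continuous_compact_support_bounded[OF continuous_on_subset[OF c(2) subset_UNIV] K(1) \<Psi>0] by blast
  obtain e where e: "e > 0" "(\<Union>x\<in>K. cball x e) \<subseteq> \<Omega>"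
    using compact_subset_open_imp_cball_epsilon_subset[OF K(1) \<Omega> K(2)] by blast
  define \<epsilon> where "\<epsilon> n = e / real (Suc n)" for n
  \<comment> \<open>With half side \<open>\<epsilon> n\<close> / d the sum of the absolute
    coordinates, and with it the Euclidean norm, is at most \<open>\<epsilon> n\<close> on the
    box.\<close>
  define s where "s n = \<epsilon> n / real DIM('a)" for n
  define a where "a n = - s n *\<^sub>R (One::'a)" for n
  define c' where "c' n = s n *\<^sub>R (One::'a)" for n
  have sp: "s n > 0" "\<epsilon> n > 0" "\<epsilon> n \<le> e" for n
    using e by (auto simp: s_def \<epsilon>_def divide_simps intro: mult_nonneg_nonneg)
  have ne: "box (a n) (c' n) \<noteq> {}" for n
    using sp by (auto simp: box_ne_empty a_def c'_def)
  define I where "I n = (\<integral>x. box_bump (a n) (c' n) 1 x \<partial>lborel)" for n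
  have I: "I n > 0" for n unfolding I_def by (rule box_bump_integral_pos[OF ne]) simp
  define \<beta> where "\<beta> n x = (1 / I n) * box_bump (a n) (c' n) 1 x" for n x
  have \<beta>alg: "\<beta> n \<in> cutoff_algebra" for n
    unfolding \<beta>_def[abs_def] by (intro cutoff_algebra.mult cutoff_algebra.const box_bump_cutoff)
  have \<beta>int: "integrable lborel (\<beta> n)" "(\<integral>x. \<beta> n x \<partial>lborel) = 1" for n
    using box_bump_integral_pos(1)[OF ne[of n], of 1] I[of n]
    by (auto simp: \<beta>_def[abs_def] I_def[symmetric])
  have \<beta>nn: "0 \<le> \<beta> n x" for n x
    using I[of n] by (auto simp: \<beta>_def box_bump_nonneg)
  have \<beta>s: "norm x \<le> \<epsilon> n" if "\<beta> n x \<noteq> 0" for n x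
  proof -
    have "x \<in> box (a n) (c' n)"
      using that box_bump_eq_0[of x "a n" "c' n" 1] by (auto simp: \<beta>_def)
    then have "\<bar>x \<bullet> b\<bar> \<le> s n" if "b \<in> Basis" for b
      using that by (force simp: mem_box a_def c'_def abs_le_iff)
    then have "(\<Sum>b\<in>Basis. \<bar>x \<bullet> b\<bar>) \<le> (\<Sum>b\<in>(Basis::'a set). s n)" by (intro sum_mono)
    also have "\<dots> = \<epsilon> n" by (simp add: s_def)
    finally show ?thesis using norm_le_l1[of x] by linarith
  qed
  have \<epsilon>0: "\<epsilon> \<longlonglongrightarrow> 0"
    unfolding \<epsilon>_def[abs_def] using tendsto_mult_left[OF LIMSEQ_inverse_real_of_nat, of e] by (simp add: divide_inverse)
  define \<phi> where "\<phi> n x = (\<integral>y. \<beta> n y * \<psi> (x - y) \<partial>lborel)" for n x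
  define \<Phi> where "\<Phi> n x = (\<integral>y. \<beta> n y *\<^sub>R \<Psi> (x - y) \<partial>lborel)" for n x
  note ai1 = approximate_identity_tendsto[of \<psi> B1 \<beta> \<epsilon>, OF c(1) B1 \<beta>int(1) \<beta>nn \<beta>int(2) \<beta>s \<epsilon>0]
  note ai2 = approximate_identity_tendsto[of \<Psi> B2 \<beta> \<epsilon>, OF c(2) B2 \<beta>int(1) \<beta>nn \<beta>int(2) \<beta>s \<epsilon>0]
  have \<beta>0: "\<beta> n x = 0" if "x \<notin> cball 0 (\<epsilon> n)" for n x
    using \<beta>s[of n x] that by auto
  \<comment> \<open>In this form derivatives fall on the cutoff function, which gives smoothness. In
    the defining form they fall on \<open>\<psi>\<close>, which shows the gradient to be a
    mollification of \<open>\<Psi>\<close>.\<close>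
  have conv: "\<phi> n x = (\<integral>y. \<beta> n (x - y) * \<psi> y \<partial>lborel)" for n x
  proof -
    have "continuous_on UNIV (\<lambda>y. \<beta> n y * \<psi> (x - y))"
      by (intro continuous_intros cutoff_algebra_continuous[OF \<beta>alg] continuous_on_compose2[OF c(1)]) auto
    then have "(\<lambda>y. \<beta> n y * \<psi> (x - y)) \<in> borel_measurable borel" by (rule borel_measurable_continuous_onI)
    from lborel_integral_reflect[OF this, of x] show ?thesis by (simp add: \<phi>_def)
  qed
  have Ck: "C_k k UNIV (\<phi> n)" for k n
    unfolding conv[abs_def]
    by (rule cutoff_convolution_C_k[OF \<beta>alg compact_cball \<beta>0 c(1) K(1,3)])
  let ?S = "\<Union>x\<in>K. cball x e"
  have S: "compact ?S"
  proof -
    have "?S = (\<Union>x\<in>K. \<Union>y\<in>cball 0 e. {x + y})"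
    proof (intro equalityI subsetI)
      fix z assume "z \<in> ?S"
      then obtain x where "x \<in> K" "dist x z \<le> e" by auto
      then show "z \<in> (\<Union>x\<in>K. \<Union>y\<in>cball 0 e. {x + y})"
        by (intro UN_I[of x] UN_I[of "z - x"]) (auto simp: dist_norm norm_minus_commute)
    next
      fix z assume "z \<in> (\<Union>x\<in>K. \<Union>y\<in>cball 0 e. {x + y})"
      then obtain x y where "x \<in> K" "norm y \<le> e" "z = x + y" by auto
      then show "z \<in> ?S" by (intro UN_I[of x]) (auto simp: dist_norm)
    qed
    then show ?thesis using compact_sums'[OF K(1) compact_cball[of "0::'a" e]] by metis
  qed
  have supp: "\<phi> n x = 0" if "x \<notin> ?S" for n x
  proof -
    have "\<beta> n y * \<psi> (x - y) = 0" for y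
    proof (rule ccontr)
      assume "\<beta> n y * \<psi> (x - y) \<noteq> 0"
      then have "norm y \<le> e" "x - y \<in> K" using \<beta>s[of n y] sp(3)[of n] K(3) by fastforce+
      then have "x \<in> ?S" by (intro UN_I[of "x - y"]) (auto simp: dist_norm)
      then show False using that by blast
    qed
    then have "(\<lambda>y. \<beta> n y * \<psi> (x - y)) = (\<lambda>_. 0)" by (rule ext)
    then show ?thesis by (simp only: \<phi>_def Bochner_Integration.integral_zero)
  qed
  have "\<phi> n \<in> Cc_infinity \<Omega>" for n
  proof -
    have "closure {x. \<phi> n x \<noteq> 0} \<subseteq> ?S"
      by (rule closure_minimal) (use supp compact_imp_closed[OF S] in blast)+
    moreover have "{x. \<phi> n x \<noteq> 0} \<subseteq> ?S" using supp by blast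
    then have "compact (closure {x. \<phi> n x \<noteq> 0})"
      using bounded_subset[OF compact_imp_bounded[OF S]] by simp
    ultimately show ?thesis
      using Ck e(2) unfolding Cc_infinity_def by blast
  qed
  moreover have "(\<phi> n has_derivative (\<lambda>h. \<Phi> n x \<bullet> h)) (at x)" for n x
  proof -
    have "((\<lambda>x. \<integral>y. \<psi> (x - y) * \<beta> n y \<partial>lborel) has_derivative (\<lambda>h. (\<integral>y. \<beta> n y *\<^sub>R \<Psi> (x - y) \<partial>lborel) \<bullet> h)) (at x)"
    proof (rule has_derivative_param_integral[where r = 1 and L = B2])
      fix x' y :: 'a
      have "((\<lambda>x. x - y) has_derivative (\<lambda>h. h)) (at x')" by (auto intro!: derivative_eq_intros)
      from has_derivative_compose[OF this C1_gradD(1)[OF \<psi> UNIV_I, of "x' - y"]]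
      show "((\<lambda>x. \<psi> (x - y)) has_derivative (\<lambda>h. \<Psi> (x' - y) \<bullet> h)) (at x')" by simp
      show "integrable lborel (\<lambda>y. \<psi> (x' - y) * \<beta> n y)"
        using ai1(2)[of n x'] by (simp add: mult.commute)
      show "(\<lambda>y. \<Psi> (x - y)) \<in> borel_measurable lborel"
        unfolding measurable_lborel2
        by (rule borel_measurable_continuous_onI, rule continuous_on_compose2[OF c(2)])
          (auto intro!: continuous_intros)
    qed (use B2 \<beta>int in auto)
    then show ?thesis by (simp add: \<phi>_def[abs_def] \<Phi>_def mult.commute)
  qed
  moreover have "(\<lambda>n. \<phi> n x) \<longlonglongrightarrow> \<psi> x" "(\<lambda>n. \<Phi> n x) \<longlonglongrightarrow> \<Psi> x" for x
    using ai1(1)[of x] ai2(1)[of x] by (simp_all add: \<phi>_def \<Phi>_def)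
  moreover have "\<bar>\<phi> n x\<bar> \<le> max B1 B2" "norm (\<Phi> n x) \<le> max B1 B2" for n x
    using ai1(3)[of n x] ai2(3)[of n x] by (auto simp: \<phi>_def \<Phi>_def le_max_iff_disj)
  ultimately show ?thesis by (rule that)
qed

lemma C_k_cmult:
  assumes "C_k k UNIV f"
  shows "C_k k UNIV (\<lambda>x. c * f x)"
  using assms
proof (induction k arbitrary: f)
  case 0
  then show ?case by (auto intro: continuous_intros)
next
  case (Suc k)
  then have d: "f differentiable (at x)" for x by simp
  have "((\<lambda>x. c * f x) has_derivative (\<lambda>v. c * frechet_derivative f (at x) v)) (at x)" for x
    using d[of x] by (intro has_derivative_mult_right) (simp add: frechet_derivative_works)
  note fd = this frechet_derivative_at[OF this, symmetric]
  have "C_k k UNIV (\<lambda>x. c * frechet_derivative f (at x) v)" for v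
    using Suc.prems by (intro Suc.IH) simp
  then show ?case
    unfolding C_k.simps fd(2) differentiable_def using fd(1) by blast
qed

lemma Cc_infinity_cmult:
  assumes "\<phi> \<in> Cc_infinity \<Omega>" "c \<noteq> 0"
  shows "(\<lambda>x. c * \<phi> x) \<in> Cc_infinity \<Omega>"
proof -
  have "{x. c * \<phi> x \<noteq> 0} = {x. \<phi> x \<noteq> 0}" using assms(2) by auto
  moreover have "C_k k UNIV (\<lambda>x. c * \<phi> x)" for k
    by (rule C_k_cmult) (use assms(1) in \<open>simp add: Cc_infinity_def\<close>)
  ultimately show ?thesis using assms(1) unfolding Cc_infinity_def by simp
qed

section \<open>Square integrable functions and weak gradients\<close>

lemma finite_measure_lebesgue_on_open:
  fixes \<Omega> :: "'a::euclidean_space set"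
  assumes "open \<Omega>" "bounded \<Omega>"
  shows "finite_measure (lebesgue_on \<Omega>)"
  by (rule finite_measure_lebesgue_on[OF lmeasurable_open[OF assms(2,1)]])

lemma borel_measurable_lebesgue_on_continuous:
  fixes f :: "'a::euclidean_space \<Rightarrow> 'b::euclidean_space"
  assumes "open \<Omega>" "continuous_on \<Omega> f"
  shows "f \<in> borel_measurable (lebesgue_on \<Omega>)"
  using assms by (intro continuous_imp_measurable_on_sets_lebesgue) auto

section \<open>Elementary properties of square integrable functions\<close>

lemma L2D:
  assumes "u \<in> L2 \<Omega>"
  shows "u \<in> borel_measurable (lebesgue_on \<Omega>)" "integrable (lebesgue_on \<Omega>) (\<lambda>x. (norm (u x))\<^sup>2)"
  using assms by (auto simp: L2_def)

lemma L2_bound: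
  assumes "u \<in> borel_measurable (lebesgue_on \<Omega>)" "integrable (lebesgue_on \<Omega>) h"
    and "\<And>x. x \<in> \<Omega> \<Longrightarrow> (norm (u x))\<^sup>2 \<le> h x"
  shows "u \<in> L2 \<Omega>"
proof -
  have "integrable (lebesgue_on \<Omega>) (\<lambda>x. (norm (u x))\<^sup>2)"
  proof (rule Bochner_Integration.integrable_bound[OF assms(2)])
    show "AE x in lebesgue_on \<Omega>. norm ((norm (u x))\<^sup>2) \<le> norm (h x)"
      using assms(3) by (intro AE_I2) (simp add: order_trans[OF _ abs_ge_self])
  qed (use assms(1) in measurable)
  then show ?thesis using assms(1) by (simp add: L2_def)
qed

lemma L2_integrable:
  fixes u :: "'a::euclidean_space \<Rightarrow> 'b::euclidean_space"
  assumes "open \<Omega>" "bounded \<Omega>" "u \<in> L2 \<Omega>"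
  shows "integrable (lebesgue_on \<Omega>) u"
proof -
  interpret finite_measure "lebesgue_on \<Omega>" by (rule finite_measure_lebesgue_on_open[OF assms(1,2)])
  show ?thesis
  proof (rule Bochner_Integration.integrable_bound)
    show "integrable (lebesgue_on \<Omega>) (\<lambda>x. (norm (u x))\<^sup>2 + 1)"
      using L2D[OF assms(3)] by simp
    show "AE x in lebesgue_on \<Omega>. norm (u x) \<le> norm ((norm (u x))\<^sup>2 + 1)"
    proof (rule AE_I2)
      fix x
      have "0 \<le> (norm (u x) - 1)\<^sup>2" by simp
      then show "norm (u x) \<le> norm ((norm (u x))\<^sup>2 + 1)"
        unfolding power2_diff using norm_ge_zero[of "u x"] by (simp del: norm_ge_zero)
    qed
  qed (use L2D[OF assms(3)] in auto)
qed

lemma L2_add: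
  assumes "u \<in> L2 \<Omega>" "v \<in> L2 \<Omega>"
  shows "(\<lambda>x. u x + v x) \<in> L2 \<Omega>"
proof (rule L2_bound)
  show "integrable (lebesgue_on \<Omega>) (\<lambda>x. 2 * (norm (u x))\<^sup>2 + 2 * (norm (v x))\<^sup>2)"
    using L2D[OF assms(1)] L2D[OF assms(2)] by simp
  show "(norm (u x + v x))\<^sup>2 \<le> 2 * (norm (u x))\<^sup>2 + 2 * (norm (v x))\<^sup>2" for x
  proof -
    have "(norm (u x + v x))\<^sup>2 \<le> (norm (u x) + norm (v x))\<^sup>2" by (intro power_mono norm_triangle_ineq) simp
    also have "\<dots> \<le> 2 * (norm (u x))\<^sup>2 + 2 * (norm (v x))\<^sup>2"
      using sum_squares_bound[of "norm (u x)" "norm (v x)"] by (simp add: power2_sum)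
    finally show ?thesis .
  qed
qed (use L2D[OF assms(1)] L2D[OF assms(2)] in auto)

lemma L2_scaleR_bounded:
  fixes m :: "'a::euclidean_space \<Rightarrow> real"
  assumes "m \<in> borel_measurable (lebesgue_on \<Omega>)" "\<And>x. x \<in> \<Omega> \<Longrightarrow> \<bar>m x\<bar> \<le> B" "u \<in> L2 \<Omega>"
  shows "(\<lambda>x. m x *\<^sub>R u x) \<in> L2 \<Omega>"
proof (rule L2_bound)
  show "integrable (lebesgue_on \<Omega>) (\<lambda>x. B\<^sup>2 * (norm (u x))\<^sup>2)" using L2D[OF assms(3)] by simp
  show "(norm (m x *\<^sub>R u x))\<^sup>2 \<le> B\<^sup>2 * (norm (u x))\<^sup>2" if "x \<in> \<Omega>" for x
    using power_mono[OF assms(2)[OF that] abs_ge_zero, of 2] by (simp add: power_mult_distrib mult_right_mono)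
qed (use L2D[OF assms(3)] assms(1) in auto)

lemma L2_scaleR_bounded':
  fixes \<mu> :: "'a::euclidean_space \<Rightarrow> 'b::euclidean_space"
  assumes "\<mu> \<in> borel_measurable (lebesgue_on \<Omega>)" "\<And>x. x \<in> \<Omega> \<Longrightarrow> norm (\<mu> x) \<le> B" "u \<in> L2 \<Omega>"
  shows "(\<lambda>x. (u x :: real) *\<^sub>R \<mu> x) \<in> L2 \<Omega>"
proof (rule L2_bound)
  show "integrable (lebesgue_on \<Omega>) (\<lambda>x. B\<^sup>2 * (norm (u x))\<^sup>2)" using L2D[OF assms(3)] by simp
  show "(norm (u x *\<^sub>R \<mu> x))\<^sup>2 \<le> B\<^sup>2 * (norm (u x))\<^sup>2" if "x \<in> \<Omega>" for x
    using mult_left_mono[OF power_mono[OF assms(2)[OF that] norm_ge_zero, of 2], of "(u x)\<^sup>2"]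
    by (simp add: power_mult_distrib mult.commute)
qed (use L2D[OF assms(3)] assms(1) in auto)

lemma L2_scaleR:
  assumes "u \<in> L2 \<Omega>"
  shows "(\<lambda>x. (c::real) *\<^sub>R u x) \<in> L2 \<Omega>"
  by (rule L2_scaleR_bounded[OF _ _ assms, of _ "\<bar>c\<bar>"]) auto

lemma L2_mult_integrable:
  fixes f g :: "'a::euclidean_space \<Rightarrow> real"
  assumes "f \<in> L2 \<Omega>" "g \<in> L2 \<Omega>"
  shows "integrable (lebesgue_on \<Omega>) (\<lambda>x. f x * g x)"
proof (rule Bochner_Integration.integrable_bound)
  show "integrable (lebesgue_on \<Omega>) (\<lambda>x. (norm (f x))\<^sup>2 + (norm (g x))\<^sup>2)"
    using L2D[OF assms(1)] L2D[OF assms(2)] by simp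
  show "AE x in lebesgue_on \<Omega>. norm (f x * g x) \<le> norm ((norm (f x))\<^sup>2 + (norm (g x))\<^sup>2)"
  proof (rule AE_I2)
    fix x
    have "2 * (\<bar>f x\<bar> * \<bar>g x\<bar>) \<le> (f x)\<^sup>2 + (g x)\<^sup>2"
      using sum_squares_bound[of "\<bar>f x\<bar>" "\<bar>g x\<bar>"] by (simp add: mult.assoc)
    then show "norm (f x * g x) \<le> norm ((norm (f x))\<^sup>2 + (norm (g x))\<^sup>2)"
      by (simp add: abs_mult) (smt (verit) abs_ge_zero mult_nonneg_nonneg)
  qed
qed (use L2D[OF assms(1)] L2D[OF assms(2)] in auto)

lemma integrable_mult_bounded:
  fixes f m :: "'a \<Rightarrow> real"
  assumes "integrable M f" "m \<in> borel_measurable M" "\<And>x. x \<in> space M \<Longrightarrow> \<bar>m x\<bar> \<le> B"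
  shows "integrable M (\<lambda>x. f x * m x)"
proof (rule Bochner_Integration.integrable_bound)
  show "integrable M (\<lambda>x. B * f x)" using assms by simp
  show "AE x in M. norm (f x * m x) \<le> norm (B * f x)"
  proof (rule AE_I2)
    fix x assume "x \<in> space M"
    then have "\<bar>m x\<bar> \<le> \<bar>B\<bar>" using assms(3)[of x] by linarith
    then show "norm (f x * m x) \<le> norm (B * f x)"
      using mult_left_mono[of "\<bar>m x\<bar>" "\<bar>B\<bar>" "\<bar>f x\<bar>"] by (simp add: abs_mult mult.commute)
  qed
qed (use assms in auto)

lemma integrable_lebesgue_on_subset:
  fixes w :: "'a::euclidean_space \<Rightarrow> real"
  assumes "integrable (lebesgue_on \<Omega>) w" "S \<subseteq> \<Omega>" "S \<in> sets lebesgue" "\<Omega> \<in> sets lebesgue"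
  shows "integrable (lebesgue_on S) w"
proof -
  have "integrable lebesgue (\<lambda>x. indicator \<Omega> x *\<^sub>R w x)"
    using assms(1,4) by (subst (asm) integrable_restrict_space) auto
  from integrable_mult_indicator[OF assms(3) this]
  have "integrable lebesgue (\<lambda>x. indicator S x *\<^sub>R (indicator \<Omega> x *\<^sub>R w x))" .
  also have "(\<lambda>x. indicator S x *\<^sub>R (indicator \<Omega> x *\<^sub>R w x)) = (\<lambda>x. indicator S x *\<^sub>R w x)"
    using assms(2) by (auto simp: indicator_def fun_eq_iff)
  finally show ?thesis using assms(3) by (subst integrable_restrict_space) auto
qed

lemma integrable_continuous_mult_cbox:
  fixes w :: "'a::euclidean_space \<Rightarrow> real"
  assumes "integrable (lebesgue_on (cbox a c)) w" "continuous_on (cbox a c) p"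
  shows "integrable (lebesgue_on (cbox a c)) (\<lambda>x. w x * p x)"
proof -
  have "bounded (p ` cbox a c)"
    using assms(2) by (intro compact_imp_bounded compact_continuous_image) auto
  then obtain L where L: "\<And>x. x \<in> cbox a c \<Longrightarrow> norm (p x) \<le> L" by (auto simp: bounded_iff)
  show ?thesis
  proof (rule integrable_mult_bounded[OF assms(1)])
    show "p \<in> borel_measurable (lebesgue_on (cbox a c))"
      using assms(2) by (intro continuous_imp_measurable_on_sets_lebesgue) auto
  qed (use L in auto)
qed

section \<open>Weak gradients: C1 test functions, product rule, uniqueness\<close>

lemma weak_gradient_C1_test:
  fixes f :: "'a::euclidean_space \<Rightarrow> real"
  assumes \<Omega>: "open \<Omega>" and f: "integrable (lebesgue_on \<Omega>) f" and F: "integrable (lebesgue_on \<Omega>) F"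
    and wg: "weak_gradient \<Omega> f F" and b: "b \<in> Basis"
    and \<psi>: "C1_grad UNIV \<psi> \<Psi>" and K: "compact K" "K \<subseteq> \<Omega>" "\<And>x. x \<notin> K \<Longrightarrow> \<psi> x = 0"
  shows "(LINT x|lebesgue_on \<Omega>. f x * (\<Psi> x \<bullet> b)) = - (LINT x|lebesgue_on \<Omega>. (F x \<bullet> b) * \<psi> x)"
proof -
  obtain \<phi> \<Phi> B where \<phi>: "\<And>n. \<phi> n \<in> Cc_infinity \<Omega>"
    "\<And>n x. (\<phi> n has_derivative (\<lambda>h. \<Phi> n x \<bullet> h)) (at x)"
    "\<And>x. (\<lambda>n::nat. \<phi> n x) \<longlonglongrightarrow> \<psi> x" "\<And>x. (\<lambda>n. \<Phi> n x) \<longlonglongrightarrow> \<Psi> x"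
    "\<And>n x. \<bar>\<phi> n x\<bar> \<le> B" "\<And>n x. norm (\<Phi> n x) \<le> B"
    by (rule C1_approximation_by_test_functions[OF \<psi> \<Omega> K]) (assumption | (rule that; assumption))+
  have Fb: "integrable (lebesgue_on \<Omega>) (\<lambda>x. F x \<bullet> b)" by (rule integrable_inner_left[OF F])
  have c\<psi>: "continuous_on \<Omega> \<psi>" "continuous_on \<Omega> \<Psi>"
    using C1_gradD[OF \<psi>] by (auto intro: continuous_on_subset)
  have c\<phi>: "continuous_on \<Omega> (\<phi> n)" "continuous_on \<Omega> (\<Phi> n)" for n
  proof -
    obtain \<psi>' where p: "C1_grad UNIV (\<phi> n) \<psi>'" by (rule Cc_infinity_C1_grad[OF \<phi>(1)[of n]])
    have "(\<lambda>h. \<psi>' x \<bullet> h) = (\<lambda>h. \<Phi> n x \<bullet> h)" for x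
      by (rule has_derivative_unique[OF C1_gradD(1)[OF p UNIV_I] \<phi>(2)])
    then have "\<psi>' x = \<Phi> n x" for x by (metis inner_commute vector_eq_ldot)
    then have "\<psi>' = \<Phi> n" by (rule ext)
    then show "continuous_on \<Omega> (\<phi> n)" "continuous_on \<Omega> (\<Phi> n)"
      using C1_gradD(2,3)[OF p] by (auto intro: continuous_on_subset)
  qed
  have 1: "(\<lambda>n. LINT x|lebesgue_on \<Omega>. f x * (\<Phi> n x \<bullet> b)) \<longlonglongrightarrow> (LINT x|lebesgue_on \<Omega>. f x * (\<Psi> x \<bullet> b))"
  proof (rule integral_dominated_convergence[where w = "\<lambda>x. B * \<bar>f x\<bar>"])
    show "(\<lambda>x. f x * (\<Psi> x \<bullet> b)) \<in> borel_measurable (lebesgue_on \<Omega>)"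
      using f borel_measurable_lebesgue_on_continuous[OF \<Omega> c\<psi>(2)] by (intro borel_measurable_times borel_measurable_inner) auto
    show "(\<lambda>x. f x * (\<Phi> n x \<bullet> b)) \<in> borel_measurable (lebesgue_on \<Omega>)" for n
      using f borel_measurable_lebesgue_on_continuous[OF \<Omega> c\<phi>(2)] by (intro borel_measurable_times borel_measurable_inner) auto
    show "AE x in lebesgue_on \<Omega>. norm (f x * (\<Phi> n x \<bullet> b)) \<le> B * \<bar>f x\<bar>" for n
    proof (rule AE_I2)
      fix x
      have "\<bar>\<Phi> n x \<bullet> b\<bar> \<le> B" using Basis_le_norm[OF b, of "\<Phi> n x"] \<phi>(6)[of n x] by linarith
      then show "norm (f x * (\<Phi> n x \<bullet> b)) \<le> B * \<bar>f x\<bar>"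
        using mult_left_mono[of "\<bar>\<Phi> n x \<bullet> b\<bar>" B "\<bar>f x\<bar>"] by (simp add: abs_mult mult.commute)
    qed
    show "AE x in lebesgue_on \<Omega>. (\<lambda>n. f x * (\<Phi> n x \<bullet> b)) \<longlonglongrightarrow> f x * (\<Psi> x \<bullet> b)"
      by (intro AE_I2 tendsto_intros \<phi>(4))
  qed (use f in simp)
  have 2: "(\<lambda>n. LINT x|lebesgue_on \<Omega>. (F x \<bullet> b) * \<phi> n x) \<longlonglongrightarrow> (LINT x|lebesgue_on \<Omega>. (F x \<bullet> b) * \<psi> x)"
  proof (rule integral_dominated_convergence[where w = "\<lambda>x. B * \<bar>F x \<bullet> b\<bar>"])
    show "(\<lambda>x. (F x \<bullet> b) * \<psi> x) \<in> borel_measurable (lebesgue_on \<Omega>)"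
      using Fb borel_measurable_lebesgue_on_continuous[OF \<Omega> c\<psi>(1)] by (intro borel_measurable_times) auto
    show "(\<lambda>x. (F x \<bullet> b) * \<phi> n x) \<in> borel_measurable (lebesgue_on \<Omega>)" for n
      using Fb borel_measurable_lebesgue_on_continuous[OF \<Omega> c\<phi>(1)] by (intro borel_measurable_times) auto
    show "AE x in lebesgue_on \<Omega>. norm ((F x \<bullet> b) * \<phi> n x) \<le> B * \<bar>F x \<bullet> b\<bar>" for n
    proof (rule AE_I2)
      fix x
      show "norm ((F x \<bullet> b) * \<phi> n x) \<le> B * \<bar>F x \<bullet> b\<bar>"
        using mult_left_mono[OF \<phi>(5)[of n x], of "\<bar>F x \<bullet> b\<bar>"] by (simp add: abs_mult mult.commute)
    qed
    show "AE x in lebesgue_on \<Omega>. (\<lambda>n. (F x \<bullet> b) * \<phi> n x) \<longlonglongrightarrow> (F x \<bullet> b) * \<psi> x"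
      by (intro AE_I2 tendsto_intros \<phi>(3))
  qed (use Fb in simp)
  have fd: "frechet_derivative (\<phi> n) (at x) = (\<lambda>h. \<Phi> n x \<bullet> h)" for n x
    by (rule frechet_derivative_at[OF \<phi>(2), symmetric])
  have "(LINT x|lebesgue_on \<Omega>. f x * (\<Phi> n x \<bullet> b)) = - (LINT x|lebesgue_on \<Omega>. (F x \<bullet> b) * \<phi> n x)" for n
    using wg[unfolded weak_gradient_def, rule_format, OF \<phi>(1)[of n] b] unfolding fd .
  then have "(\<lambda>n. LINT x|lebesgue_on \<Omega>. f x * (\<Phi> n x \<bullet> b)) \<longlonglongrightarrow> - (LINT x|lebesgue_on \<Omega>. (F x \<bullet> b) * \<psi> x)"
    using tendsto_minus[OF 2] by simp
  with 1 show ?thesis by (rule LIMSEQ_unique)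
qed

lemma weak_gradient_C1:
  assumes "open \<Omega>" "C1_grad \<Omega> f g"
  shows "weak_gradient \<Omega> f g"
  unfolding weak_gradient_def
proof (intro ballI)
  fix \<phi> b assume \<phi>: "\<phi> \<in> Cc_infinity \<Omega>"
  from \<phi> obtain \<psi> K where *: "C1_grad UNIV \<phi> \<psi>" "compact K" "K \<subseteq> \<Omega>" "\<And>x. x \<notin> K \<Longrightarrow> \<phi> x = 0"
    "\<And>x b. frechet_derivative \<phi> (at x) b = \<psi> x \<bullet> b" by (rule Cc_infinity_C1_grad) (assumption | (rule that; assumption))+
  show "(LINT x|lebesgue_on \<Omega>. f x * frechet_derivative \<phi> (at x) b) = - (LINT x|lebesgue_on \<Omega>. (g x \<bullet> b) * \<phi> x)"
    unfolding *(5) by (rule integral_by_parts_C1[OF assms(2,1) *(1,2,3,4)])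
qed

lemma Cc_infinity_bounds:
  fixes \<Omega> :: "'a::euclidean_space set"
  assumes "open \<Omega>" "\<phi> \<in> Cc_infinity \<Omega>"
  obtains B where "B > 0" "\<And>x. \<bar>\<phi> x\<bar> \<le> B" "\<And>x b. b \<in> Basis \<Longrightarrow> \<bar>frechet_derivative \<phi> (at x) b\<bar> \<le> B"
    "\<phi> \<in> borel_measurable (lebesgue_on \<Omega>)" "\<And>b. (\<lambda>x. frechet_derivative \<phi> (at x) b) \<in> borel_measurable (lebesgue_on \<Omega>)"
proof -
  obtain \<psi> K where *: "C1_grad UNIV \<phi> \<psi>" "compact K" "K \<subseteq> \<Omega>" "\<And>x. x \<notin> K \<Longrightarrow> \<phi> x = 0"
    "\<And>x b. frechet_derivative \<phi> (at x) b = \<psi> x \<bullet> b" by (rule Cc_infinity_C1_grad[OF assms(2)]) (assumption | (rule that; assumption))+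
  have \<psi>0: "\<psi> x = 0" if "x \<notin> K" for x
    by (rule C1_grad_zero_outside[OF *(1) *(2) *(4) that])
  have c: "continuous_on S \<phi>" "continuous_on S \<psi>" for S using C1_gradD[OF *(1)] by (auto intro: continuous_on_subset)
  obtain B1 where B1: "B1 > 0" "\<And>x. norm (\<phi> x) \<le> B1"
    using continuous_compact_support_bounded[OF c(1) *(2,4)] by blast
  obtain B2 where B2: "\<And>x. norm (\<psi> x) \<le> B2"
    using continuous_compact_support_bounded[OF c(2) *(2) \<psi>0] by blast
  show ?thesis
  proof (rule that[of "max B1 B2"])
    show "\<bar>frechet_derivative \<phi> (at x) b\<bar> \<le> max B1 B2" if "b \<in> Basis" for x b
      using Basis_le_norm[OF that, of "\<psi> x"] B2[of x] unfolding *(5) by linarith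
    show "\<bar>\<phi> x\<bar> \<le> max B1 B2" for x using B1(2)[of x] by simp
    show "\<phi> \<in> borel_measurable (lebesgue_on \<Omega>)" by (rule borel_measurable_lebesgue_on_continuous[OF assms(1) c(1)])
    show "(\<lambda>x. frechet_derivative \<phi> (at x) b) \<in> borel_measurable (lebesgue_on \<Omega>)" for b
      unfolding *(5) by (intro borel_measurable_lebesgue_on_continuous[OF assms(1)] continuous_intros c)
  qed (use B1 in simp)
qed

text \<open>Testing the identity for \<open>f\<close> with the product of \<open>m\<close> and
  \<open>\<phi>\<close>, and expanding the gradient of that product, gives the identity for the
  product of \<open>m\<close> and \<open>f\<close>. The test function is only C1 because
  \<open>m\<close> is. The bound \<open>B\<close> keeps all integrands integrable.\<close>

lemma weak_gradient_mult:
  fixes f :: "'a::euclidean_space \<Rightarrow> real"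
  assumes \<Omega>: "open \<Omega>" and f: "integrable (lebesgue_on \<Omega>) f" and F: "integrable (lebesgue_on \<Omega>) F"
    and wg: "weak_gradient \<Omega> f F"
    and m: "C1_grad \<Omega> m \<mu>" "\<And>x. x \<in> \<Omega> \<Longrightarrow> \<bar>m x\<bar> \<le> B" "\<And>x. x \<in> \<Omega> \<Longrightarrow> norm (\<mu> x) \<le> B"
  shows "weak_gradient \<Omega> (\<lambda>x. m x * f x) (\<lambda>x. m x *\<^sub>R F x + f x *\<^sub>R \<mu> x)"
  unfolding weak_gradient_def
proof (intro ballI)
  fix \<phi> b assume \<phi>: "\<phi> \<in> Cc_infinity \<Omega>" and b: "b \<in> (Basis :: 'a set)"
  from \<phi> obtain \<psi> K where *: "C1_grad UNIV \<phi> \<psi>" "compact K" "K \<subseteq> \<Omega>" "\<And>x. x \<notin> K \<Longrightarrow> \<phi> x = 0"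
    "\<And>x b. frechet_derivative \<phi> (at x) b = \<psi> x \<bullet> b" by (rule Cc_infinity_C1_grad) (assumption | (rule that; assumption))+
  obtain C where C: "C > 0" "\<And>x. \<bar>\<phi> x\<bar> \<le> C" "\<And>x b. b \<in> Basis \<Longrightarrow> \<bar>frechet_derivative \<phi> (at x) b\<bar> \<le> C"
    "\<phi> \<in> borel_measurable (lebesgue_on \<Omega>)" "\<And>b. (\<lambda>x. frechet_derivative \<phi> (at x) b) \<in> borel_measurable (lebesgue_on \<Omega>)"
    by (rule Cc_infinity_bounds[OF \<Omega> \<phi>]) (assumption | (rule that; assumption))+
  have \<psi>0: "\<psi> x = 0" if "x \<notin> K" for x
    by (rule C1_grad_zero_outside[OF *(1) *(2) *(4) that])
  have mm: "m \<in> borel_measurable (lebesgue_on \<Omega>)" "(\<lambda>x. \<mu> x \<bullet> b) \<in> borel_measurable (lebesgue_on \<Omega>)"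
    using C1_gradD(2,3)[OF m(1)] by (auto intro!: borel_measurable_lebesgue_on_continuous[OF \<Omega>] continuous_intros)
  have \<mu>b: "\<bar>\<mu> x \<bullet> b\<bar> \<le> B" if "x \<in> \<Omega>" for x
    using Basis_le_norm[OF b, of "\<mu> x"] m(3)[OF that] by linarith
  have "(LINT x|lebesgue_on \<Omega>. f x * ((if x \<in> K then m x *\<^sub>R \<psi> x + \<phi> x *\<^sub>R \<mu> x else 0) \<bullet> b)) =
      - (LINT x|lebesgue_on \<Omega>. (F x \<bullet> b) * (if x \<in> K then m x * \<phi> x else 0))"
    by (rule weak_gradient_C1_test[OF \<Omega> f F wg b C1_grad_mult_extend[OF m(1) \<Omega> *(1,2,3,4)] *(2,3)]) auto
  also have "(\<lambda>x. f x * ((if x \<in> K then m x *\<^sub>R \<psi> x + \<phi> x *\<^sub>R \<mu> x else 0) \<bullet> b)) =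
      (\<lambda>x. (f x * frechet_derivative \<phi> (at x) b) * m x + (f x * \<phi> x) * (\<mu> x \<bullet> b))"
    using *(4) \<psi>0 by (auto simp: fun_eq_iff *(5) algebra_simps)
  also have "(\<lambda>x. (F x \<bullet> b) * (if x \<in> K then m x * \<phi> x else 0)) = (\<lambda>x. ((F x \<bullet> b) * \<phi> x) * m x)"
    using *(4) by (auto simp: fun_eq_iff algebra_simps)
  finally have eq: "(LINT x|lebesgue_on \<Omega>. (f x * frechet_derivative \<phi> (at x) b) * m x + (f x * \<phi> x) * (\<mu> x \<bullet> b)) =
    - (LINT x|lebesgue_on \<Omega>. ((F x \<bullet> b) * \<phi> x) * m x)" .
  have i1: "integrable (lebesgue_on \<Omega>) (\<lambda>x. (f x * frechet_derivative \<phi> (at x) b) * m x)"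
    by (rule integrable_mult_bounded[OF integrable_mult_bounded[OF f C(5) C(3)[OF b]] mm(1) m(2)]) auto
  have i2: "integrable (lebesgue_on \<Omega>) (\<lambda>x. (f x * \<phi> x) * (\<mu> x \<bullet> b))"
    by (rule integrable_mult_bounded[OF integrable_mult_bounded[OF f C(4) C(2)] mm(2) \<mu>b]) auto
  have i3: "integrable (lebesgue_on \<Omega>) (\<lambda>x. ((F x \<bullet> b) * \<phi> x) * m x)"
    by (rule integrable_mult_bounded[OF integrable_mult_bounded[OF integrable_inner_left[OF F] C(4) C(2)] mm(1) m(2)]) auto
  have "(LINT x|lebesgue_on \<Omega>. m x * f x * frechet_derivative \<phi> (at x) b) =
      (LINT x|lebesgue_on \<Omega>. (f x * frechet_derivative \<phi> (at x) b) * m x)"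
    by (simp add: mult_ac)
  also have "\<dots> = - ((LINT x|lebesgue_on \<Omega>. ((F x \<bullet> b) * \<phi> x) * m x) + (LINT x|lebesgue_on \<Omega>. (f x * \<phi> x) * (\<mu> x \<bullet> b)))"
    using eq unfolding Bochner_Integration.integral_add[OF i1 i2] by linarith
  also have "\<dots> = - (LINT x|lebesgue_on \<Omega>. ((F x \<bullet> b) * \<phi> x) * m x + (f x * \<phi> x) * (\<mu> x \<bullet> b))"
    by (simp only: Bochner_Integration.integral_add[OF i3 i2])
  also have "\<dots> = - (LINT x|lebesgue_on \<Omega>. ((m x *\<^sub>R F x + f x *\<^sub>R \<mu> x) \<bullet> b) * \<phi> x)"
    by (simp add: inner_add_left algebra_simps)
  finally show "(LINT x|lebesgue_on \<Omega>. m x * f x * frechet_derivative \<phi> (at x) b) =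
    - (LINT x|lebesgue_on \<Omega>. ((m x *\<^sub>R F x + f x *\<^sub>R \<mu> x) \<bullet> b) * \<phi> x)" .
qed

text \<open>The equation determines the solution only almost everywhere, so the sum rule is stated
  for a function that equals the combination off a null set.\<close>

lemma weak_gradient_add:
  fixes f :: "'a::euclidean_space \<Rightarrow> real"
  assumes \<Omega>: "open \<Omega>" and f: "integrable (lebesgue_on \<Omega>) f" "integrable (lebesgue_on \<Omega>) F" "weak_gradient \<Omega> f F"
    and g: "integrable (lebesgue_on \<Omega>) g" "integrable (lebesgue_on \<Omega>) G" "weak_gradient \<Omega> g G"
    and u: "u \<in> borel_measurable (lebesgue_on \<Omega>)" "AE x in lebesgue_on \<Omega>. u x = f x + c * g x"
  shows "weak_gradient \<Omega> u (\<lambda>x. F x + c *\<^sub>R G x)"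
  unfolding weak_gradient_def
proof (intro ballI)
  fix \<phi> b assume \<phi>: "\<phi> \<in> Cc_infinity \<Omega>" and b: "b \<in> (Basis :: 'a set)"
  obtain C where C: "C > 0" "\<And>x. \<bar>\<phi> x\<bar> \<le> C" "\<And>x b. b \<in> Basis \<Longrightarrow> \<bar>frechet_derivative \<phi> (at x) b\<bar> \<le> C"
    "\<phi> \<in> borel_measurable (lebesgue_on \<Omega>)" "\<And>b. (\<lambda>x. frechet_derivative \<phi> (at x) b) \<in> borel_measurable (lebesgue_on \<Omega>)"
    by (rule Cc_infinity_bounds[OF \<Omega> \<phi>]) (assumption | (rule that; assumption))+
  have i1: "integrable (lebesgue_on \<Omega>) (\<lambda>x. f x * frechet_derivative \<phi> (at x) b)"
     "integrable (lebesgue_on \<Omega>) (\<lambda>x. g x * frechet_derivative \<phi> (at x) b)"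
    by (rule integrable_mult_bounded[OF f(1) C(5) C(3)[OF b]] integrable_mult_bounded[OF g(1) C(5) C(3)[OF b]])+
  have i2: "integrable (lebesgue_on \<Omega>) (\<lambda>x. (F x \<bullet> b) * \<phi> x)"
     "integrable (lebesgue_on \<Omega>) (\<lambda>x. (G x \<bullet> b) * \<phi> x)"
    by (rule integrable_mult_bounded[OF integrable_inner_left[OF f(2)] C(4) C(2)] integrable_mult_bounded[OF integrable_inner_left[OF g(2)] C(4) C(2)])+
  have "(LINT x|lebesgue_on \<Omega>. u x * frechet_derivative \<phi> (at x) b) =
     (LINT x|lebesgue_on \<Omega>. f x * frechet_derivative \<phi> (at x) b + c * (g x * frechet_derivative \<phi> (at x) b))"
  proof (rule integral_cong_AE)
    show "AE x in lebesgue_on \<Omega>. u x * frechet_derivative \<phi> (at x) b = f x * frechet_derivative \<phi> (at x) b + c * (g x * frechet_derivative \<phi> (at x) b)"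
      using u(2) by eventually_elim (simp add: algebra_simps)
  qed (use u(1) C(5)[of b] i1 in \<open>auto\<close>)
  also have "\<dots> = (LINT x|lebesgue_on \<Omega>. f x * frechet_derivative \<phi> (at x) b) + c * (LINT x|lebesgue_on \<Omega>. g x * frechet_derivative \<phi> (at x) b)"
    using i1 by simp
  also have "\<dots> = - ((LINT x|lebesgue_on \<Omega>. (F x \<bullet> b) * \<phi> x) + c * (LINT x|lebesgue_on \<Omega>. (G x \<bullet> b) * \<phi> x))"
    using f(3)[unfolded weak_gradient_def, rule_format, OF \<phi> b] g(3)[unfolded weak_gradient_def, rule_format, OF \<phi> b] by simp
  also have "\<dots> = - (LINT x|lebesgue_on \<Omega>. (F x \<bullet> b) * \<phi> x + c * ((G x \<bullet> b) * \<phi> x))"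
    using i2 by simp
  also have "\<dots> = - (LINT x|lebesgue_on \<Omega>. ((F x + c *\<^sub>R G x) \<bullet> b) * \<phi> x)"
    by (simp add: inner_add_left algebra_simps)
  finally show "(LINT x|lebesgue_on \<Omega>. u x * frechet_derivative \<phi> (at x) b) = - (LINT x|lebesgue_on \<Omega>. ((F x + c *\<^sub>R G x) \<bullet> b) * \<phi> x)" .
qed

text \<open>\<open>H1_nrm\<close> picks a weak gradient by Hilbert choice. Uniqueness up to null
  sets is what allows any explicitly known gradient to be used in its place.\<close>

lemma weak_gradient_unique:
  fixes \<Omega> :: "'a::euclidean_space set"
  assumes \<Omega>: "open \<Omega>" and F: "integrable (lebesgue_on \<Omega>) F" and G: "integrable (lebesgue_on \<Omega>) G"
    and w: "weak_gradient \<Omega> f F" "weak_gradient \<Omega> f G"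
  shows "AE x in lebesgue_on \<Omega>. F x = G x"
proof -
  have "AE x in lebesgue_on \<Omega>. (F x - G x) \<bullet> b = 0" if b: "b \<in> Basis" for b
  proof (rule fundamental_lemma_variations[OF \<Omega>])
    have i: "integrable (lebesgue_on \<Omega>) (\<lambda>x. (F x - G x) \<bullet> b)"
      using F G by (intro integrable_inner_left) auto
    show "integrable (lebesgue_on (cbox a c)) (\<lambda>x. (F x - G x) \<bullet> b)" if "cbox a c \<subseteq> \<Omega>" for a c
      by (rule integrable_lebesgue_on_subset[OF i that]) (use \<Omega> in auto)
    fix \<phi> assume \<phi>: "\<phi> \<in> Cc_infinity \<Omega>"
    obtain C where C: "\<And>x. \<bar>\<phi> x\<bar> \<le> C" "\<phi> \<in> borel_measurable (lebesgue_on \<Omega>)"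
      by (rule Cc_infinity_bounds[OF \<Omega> \<phi>]) (assumption | (rule that; assumption))+
    have i2: "integrable (lebesgue_on \<Omega>) (\<lambda>x. (F x \<bullet> b) * \<phi> x)"
       "integrable (lebesgue_on \<Omega>) (\<lambda>x. (G x \<bullet> b) * \<phi> x)"
      by (rule integrable_mult_bounded[OF integrable_inner_left[OF F] C(2,1)] integrable_mult_bounded[OF integrable_inner_left[OF G] C(2,1)])+
    have "(LINT x|lebesgue_on \<Omega>. (F x - G x) \<bullet> b * \<phi> x) = (LINT x|lebesgue_on \<Omega>. (F x \<bullet> b) * \<phi> x - (G x \<bullet> b) * \<phi> x)"
      by (simp add: inner_diff_left algebra_simps)
    also have "\<dots> = (LINT x|lebesgue_on \<Omega>. (F x \<bullet> b) * \<phi> x) - (LINT x|lebesgue_on \<Omega>. (G x \<bullet> b) * \<phi> x)"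
      using i2 by simp
    also have "\<dots> = 0"
      using w[unfolded weak_gradient_def, rule_format, OF \<phi> b] by linarith
    finally show "(LINT x|lebesgue_on \<Omega>. (F x - G x) \<bullet> b * \<phi> x) = 0" .
  qed
  then have "AE x in lebesgue_on \<Omega>. \<forall>b\<in>Basis. (F x - G x) \<bullet> b = 0"
    by (subst AE_ball_countable) (auto intro: countable_finite)
  then show ?thesis
    by eventually_elim (auto simp: euclidean_eq_iff[of "F _"] inner_diff_left)
qed

lemma H1I:
  assumes "u \<in> L2 \<Omega>" "g \<in> L2 \<Omega>" "weak_gradient \<Omega> u g"
  shows "u \<in> H1 \<Omega>"
  using assms by (auto simp: H1_def)

lemma H1_nrm_eq:
  fixes \<Omega> :: "'a::euclidean_space set"
  assumes \<Omega>: "open \<Omega>" "bounded \<Omega>" and g: "g \<in> L2 \<Omega>" "weak_gradient \<Omega> u g"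
  shows "H1_nrm \<Omega> u = sqrt ((L2_nrm \<Omega> u)\<^sup>2 + (L2_nrm \<Omega> g)\<^sup>2)"
proof -
  define g' where "g' = (SOME g. g \<in> L2 \<Omega> \<and> weak_gradient \<Omega> u g)"
  have g': "g' \<in> L2 \<Omega>" "weak_gradient \<Omega> u g'"
    using someI[of "\<lambda>g. g \<in> L2 \<Omega> \<and> weak_gradient \<Omega> u g" g] g by (auto simp: g'_def)
  have "AE x in lebesgue_on \<Omega>. g' x = g x"
    by (rule weak_gradient_unique[OF \<Omega>(1) L2_integrable[OF \<Omega> g'(1)] L2_integrable[OF \<Omega> g(1)] g'(2) g(2)])
  then have "(LINT x|lebesgue_on \<Omega>. (norm (g' x))\<^sup>2) = (LINT x|lebesgue_on \<Omega>. (norm (g x))\<^sup>2)"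
    using L2D(1)[OF g(1)] L2D(1)[OF g'(1)] by (intro integral_cong_AE) (auto elim: eventually_mono)
  then show ?thesis by (simp add: H1_nrm_def g'_def[symmetric] L2_nrm_def)
qed

lemma L2_nrm_sq: "(L2_nrm \<Omega> u)\<^sup>2 = (LINT x|lebesgue_on \<Omega>. (norm (u x))\<^sup>2)"
  by (simp add: L2_nrm_def)

text \<open>A coordinate function has derivative 1 in its own direction, so integration by parts
  turns the integral of h^2 into -2 times that of h times the coordinate times the partial
  derivative of h. The coordinate is bounded by \<open>D\<close>; Young's inequality and absorbing
  half of the left side yield \<open>4 * D\<^sup>2\<close>.\<close>

lemma friedrichs_inequality:
  fixes h :: "'a::euclidean_space \<Rightarrow> real"
  assumes \<Omega>: "open \<Omega>" "\<And>x. x \<in> \<Omega> \<Longrightarrow> norm x \<le> D"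
    and h: "C1_grad \<Omega> h H" and K: "compact K" "K \<subseteq> \<Omega>" "\<And>x. x \<in> \<Omega> - K \<Longrightarrow> h x = 0"
  shows "(LINT x|lebesgue_on \<Omega>. (h x)\<^sup>2) \<le> 4 * D\<^sup>2 * (LINT x|lebesgue_on \<Omega>. (norm (H x))\<^sup>2)"
    "integrable (lebesgue_on \<Omega>) (\<lambda>x. (norm (H x))\<^sup>2)" "integrable (lebesgue_on \<Omega>) (\<lambda>x. (h x)\<^sup>2)"
proof -
  have o\<Omega>K: "open (\<Omega> - K)" using K \<Omega> by (simp add: compact_imp_closed open_Diff)
  have H0: "H x = 0" if "x \<in> \<Omega> - K" for x
    using C1_grad_zero[OF h o\<Omega>K _ K(3)] that by auto
  have c: "continuous_on \<Omega> h" "continuous_on \<Omega> H" using C1_gradD[OF h] by auto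
  obtain b :: 'a where b: "b \<in> Basis" using nonempty_Basis by blast
  show iH: "integrable (lebesgue_on \<Omega>) (\<lambda>x. (norm (H x))\<^sup>2)"
    by (rule integral_compact_support[OF \<Omega>(1) K(1,2)]) (auto intro!: continuous_intros c simp: H0)
  show ih: "integrable (lebesgue_on \<Omega>) (\<lambda>x. (h x)\<^sup>2)"
    by (rule integral_compact_support[OF \<Omega>(1) K(1,2)]) (auto intro!: continuous_intros c simp: K(3))
  have ix: "integrable (lebesgue_on \<Omega>) (\<lambda>x. h x * (x \<bullet> b) * (H x \<bullet> b))"
    by (rule integral_compact_support[OF \<Omega>(1) K(1,2)]) (auto intro!: continuous_intros c simp: H0)
  define k where "k x = (if x \<in> K then h x else 0)" for x
  define k' where "k' x = (if x \<in> K then H x else 0)" for x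
  have k: "C1_grad UNIV k k'" unfolding k_def[abs_def] k'_def[abs_def] by (rule C1_grad_extend[OF h \<Omega>(1) K])
  have k\<Omega>: "k x = h x" "k' x = H x" if "x \<in> \<Omega>" for x
    using that K(3) H0 by (auto simp: k_def k'_def)
  have l: "C1_grad \<Omega> (\<lambda>x. x \<bullet> b) (\<lambda>x. b)"
    unfolding C1_grad_def by (auto intro!: derivative_eq_intros simp: inner_commute)
  have "(LINT x|lebesgue_on \<Omega>. (h x * (x \<bullet> b)) * (k' x \<bullet> b)) = - (LINT x|lebesgue_on \<Omega>. ((h x *\<^sub>R b + (x \<bullet> b) *\<^sub>R H x) \<bullet> b) * k x)"
    by (rule integral_by_parts_C1[OF C1_grad_mult[OF h l] \<Omega>(1) k K(1,2)]) (auto simp: k_def)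
  also have "(LINT x|lebesgue_on \<Omega>. (h x * (x \<bullet> b)) * (k' x \<bullet> b)) = (LINT x|lebesgue_on \<Omega>. h x * (x \<bullet> b) * (H x \<bullet> b))"
    by (rule Bochner_Integration.integral_cong) (auto simp: k\<Omega>)
  also have "(LINT x|lebesgue_on \<Omega>. ((h x *\<^sub>R b + (x \<bullet> b) *\<^sub>R H x) \<bullet> b) * k x) = (LINT x|lebesgue_on \<Omega>. (h x)\<^sup>2 + h x * (x \<bullet> b) * (H x \<bullet> b))"
    using b by (intro Bochner_Integration.integral_cong) (auto simp: k\<Omega> inner_add_left algebra_simps power2_eq_square)
  also have "\<dots> = (LINT x|lebesgue_on \<Omega>. (h x)\<^sup>2) + (LINT x|lebesgue_on \<Omega>. h x * (x \<bullet> b) * (H x \<bullet> b))"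
    by (rule Bochner_Integration.integral_add[OF ih ix])
  finally have "(LINT x|lebesgue_on \<Omega>. (h x)\<^sup>2) = (LINT x|lebesgue_on \<Omega>. - 2 * (h x * (x \<bullet> b) * (H x \<bullet> b)))"
    by (simp only: integral_mult_right_zero)
  also have "\<dots> \<le> (LINT x|lebesgue_on \<Omega>. 1 / 2 * (h x)\<^sup>2 + 2 * D\<^sup>2 * (norm (H x))\<^sup>2)"
  proof (rule integral_mono)
    fix x assume "x \<in> space (lebesgue_on \<Omega>)"
    then have x: "x \<in> \<Omega>" by simp
    have "\<bar>x \<bullet> b\<bar> \<le> D" using Basis_le_norm[OF b, of x] \<Omega>(2)[OF x] by linarith
    moreover have "\<bar>H x \<bullet> b\<bar> \<le> norm (H x)" by (rule Basis_le_norm[OF b])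
    ultimately have "\<bar>(x \<bullet> b) * (H x \<bullet> b)\<bar> \<le> D * norm (H x)"
      unfolding abs_mult by (intro mult_mono) auto
    then have 1: "((x \<bullet> b) * (H x \<bullet> b))\<^sup>2 \<le> (D * norm (H x))\<^sup>2"
      by (intro abs_le_square_iff[THEN iffD1]) (simp add: order_trans[OF _ abs_ge_self])
    have "0 \<le> (h x + 2 * ((x \<bullet> b) * (H x \<bullet> b)))\<^sup>2 / 2" by simp
    also have "\<dots> = 1 / 2 * (h x)\<^sup>2 + 2 * (h x * (x \<bullet> b) * (H x \<bullet> b)) + 2 * ((x \<bullet> b) * (H x \<bullet> b))\<^sup>2"
      by (simp add: power2_eq_square algebra_simps)
    finally show "- 2 * (h x * (x \<bullet> b) * (H x \<bullet> b)) \<le> 1 / 2 * (h x)\<^sup>2 + 2 * D\<^sup>2 * (norm (H x))\<^sup>2"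
      using 1 by (simp add: power_mult_distrib)
  qed (use ix ih iH in simp_all)
  also have "\<dots> = 1 / 2 * (LINT x|lebesgue_on \<Omega>. (h x)\<^sup>2) + 2 * D\<^sup>2 * (LINT x|lebesgue_on \<Omega>. (norm (H x))\<^sup>2)"
    using ih iH by simp
  finally show "(LINT x|lebesgue_on \<Omega>. (h x)\<^sup>2) \<le> 4 * D\<^sup>2 * (LINT x|lebesgue_on \<Omega>. (norm (H x))\<^sup>2)"
    by linarith
qed

section \<open>The nonlocal energy\<close>

text \<open>The segment from \<open>x\<close> to \<open>z\<close> leaves \<open>\<Omega>\<close> and
  therefore meets the frontier at a point no farther from \<open>x\<close> than \<open>z\<close>
  is.\<close>

lemma infdist_frontier_le_dist:
  fixes \<Omega> :: "'a::euclidean_space set"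
  assumes "x \<in> \<Omega>" "z \<notin> \<Omega>"
  shows "infdist x (frontier \<Omega>) \<le> dist x z"
proof -
  have "closed_segment x z \<inter> frontier \<Omega> \<noteq> {}"
    by (rule connected_Int_frontier) (use assms in auto)
  then obtain w where w: "w \<in> closed_segment x z" "w \<in> frontier \<Omega>" by blast
  have "infdist x (frontier \<Omega>) \<le> dist x w" by (rule infdist_le[OF w(2)])
  also have "\<dots> \<le> dist x z" using segment_bound1[OF w(1)] by (simp add: dist_norm norm_minus_commute)
  finally show ?thesis .
qed

lemma ennreal_double_add:
  assumes "0 \<le> p" "0 \<le> q"
  shows "ennreal (2 * p + 2 * q) = 2 * ennreal p + 2 * ennreal q"
  using assms by (simp add: ennreal_plus ennreal_mult)

lemma ennreal_if_power2:
  "0 \<le> c \<Longrightarrow> (ennreal (if b then c else 0))\<^sup>2 = ennreal (if b then c\<^sup>2 else 0)"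
  using ennreal_power[of c 2] by (cases b) simp_all

lemma ennreal_if_mult:
  "0 \<le> p \<Longrightarrow> 0 \<le> q \<Longrightarrow> ennreal p * ennreal (if b then q else 0) = ennreal (if b then p * q else 0)"
  using ennreal_mult[of p q] by (cases b) simp_all

text \<open>Both summands carry the 2 of (a + b)^2 <= 2 a^2 + 2 b^2. The power of 20 is the ratio of
  the volumes of balls of radius s \<eta> and s \<eta> / 20. The power of 6/5 is the price of
  replacing \<open>\<eta> x\<close> by \<open>\<eta> z\<close>, with exponent n from the
  normalization of the average and n + 2 from the weight of the energy.\<close>

definition chain_const :: "nat \<Rightarrow> real" where
  "chain_const n = 2 * 20 ^ n + 2 * (20 ^ n * (6/5) ^ (2 * n + 2))"

lemma chain_const_pos: "chain_const n > 0"
  by (simp add: chain_const_def add_pos_pos)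

definition chain_steps :: "real \<Rightarrow> nat" where
  "chain_steps r = (LEAST k. (3/4) ^ k \<le> r)"

lemma chain_steps: "r > 0 \<Longrightarrow> (3/4) ^ chain_steps r \<le> r"
  unfolding chain_steps_def
  by (rule LeastI_ex) (use real_arch_pow_inv[of r "3/4"] in \<open>auto intro: less_imp_le\<close>)

text \<open>\<delta> does not occur here: it acts only through such bounds on \<open>\<eta>\<close>,
  so constants derived from them are uniform in \<delta>.\<close>

locale localized_domain =
  fixes \<Omega> :: "'a::euclidean_space set" and \<eta> :: "'a \<Rightarrow> real" and g :: "'a \<Rightarrow> 'a"
  assumes open_domain: "open \<Omega>" and bounded_domain: "bounded \<Omega>"
    and eta_C1: "C1_grad \<Omega> \<eta> g"
    and eta_pos: "\<And>x. x \<in> \<Omega> \<Longrightarrow> 0 < \<eta> x"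
    and grad_eta: "\<And>x. x \<in> \<Omega> \<Longrightarrow> norm (g x) \<le> 1 / 3"
    and eta_le_infdist: "\<And>x. x \<in> \<Omega> \<Longrightarrow> \<eta> x \<le> 3 / 4 * infdist x (frontier \<Omega>)"
begin

abbreviation "M \<equiv> lebesgue_on \<Omega>"

sublocale finite_measure M
  by (rule finite_measure_lebesgue_on_open[OF open_domain bounded_domain])

sublocale P: pair_sigma_finite M M ..

lemma eta_measurable[measurable]: "\<eta> \<in> borel_measurable M"
  by (rule borel_measurable_lebesgue_on_continuous[OF open_domain C1_gradD(3)[OF eta_C1]])

lemma id_measurable[measurable]: "(\<lambda>x. x) \<in> M \<rightarrow>\<^sub>M borel"
  by (rule borel_measurable_lebesgue_on_continuous[OF open_domain continuous_on_id])

lemma dist_measurable[measurable (raw)]: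
  assumes "p \<in> N \<rightarrow>\<^sub>M M" "q \<in> N \<rightarrow>\<^sub>M M"
  shows "(\<lambda>w. dist (p w) (q w)) \<in> borel_measurable N"
  using measurable_compose[OF assms(1) id_measurable] measurable_compose[OF assms(2) id_measurable]
  by measurable


lemma cball_eta_subset: "x \<in> \<Omega> \<Longrightarrow> cball x (\<eta> x) \<subseteq> \<Omega>"
proof
  fix z assume x: "x \<in> \<Omega>" and z: "z \<in> cball x (\<eta> x)"
  show "z \<in> \<Omega>"
  proof (rule ccontr)
    assume "z \<notin> \<Omega>"
    then show False
      using infdist_frontier_le_dist[OF x, of z] z eta_le_infdist[OF x] eta_pos[OF x] by (simp)
  qed
qed

text \<open>\<open>\<Omega>\<close> need not be convex, so the mean value inequality is applied on
  the ball \<open>cball x (\<eta> x)\<close>, which lies in \<open>\<Omega>\<close>.\<close>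

lemma eta_lipschitz:
  assumes x: "x \<in> \<Omega>" and xy: "dist x y \<le> \<eta> x"
  shows "y \<in> \<Omega>" "\<bar>\<eta> x - \<eta> y\<bar> \<le> dist x y / 3"
proof -
  have sub: "cball x (\<eta> x) \<subseteq> \<Omega>" by (rule cball_eta_subset[OF x])
  then show "y \<in> \<Omega>" using xy by auto
  have "\<bar>\<eta> x - \<eta> y\<bar> \<le> 1 / 3 * norm (x - y)"
  proof (rule inner_deriv_bound[OF convex_cball[of x "\<eta> x"]])
    show "(\<eta> has_derivative (\<lambda>h. g z \<bullet> h)) (at z)" "norm (g z) \<le> 1 / 3" if "z \<in> cball x (\<eta> x)" for z
      using that sub C1_gradD(1)[OF eta_C1] grad_eta by blast+
  qed (use eta_pos[OF x] xy in auto)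
  then show "\<bar>\<eta> x - \<eta> y\<bar> \<le> dist x y / 3" by (simp add: dist_norm)
qed

text \<open>Like the kernel, which is nonzero only on such pairs, the relation is symmetric: either
  of the two radii may reach the other point.\<close>

definition near :: "'a \<Rightarrow> 'a \<Rightarrow> bool" where
  "near x y \<longleftrightarrow> dist x y \<le> \<eta> x \<or> dist x y \<le> \<eta> y"

text \<open>The Lipschitz constant 1/3 leaves one value of \<open>\<eta>\<close> between 2/3 and 4/3
  of the other; the factor 3/2 covers both directions.\<close>

lemma near_comparable:
  assumes "x \<in> \<Omega>" "y \<in> \<Omega>" "near x y"
  shows "\<eta> x \<le> 3 / 2 * \<eta> y" "\<eta> y \<le> 3 / 2 * \<eta> x"
proof -
  have "\<eta> x \<le> 3 / 2 * \<eta> y \<and> \<eta> y \<le> 3 / 2 * \<eta> x"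
    if "x \<in> \<Omega>" "y \<in> \<Omega>" "dist x y \<le> \<eta> x" for x y
    using eta_lipschitz(2)[OF that(1,3)] that eta_pos[of x] by (auto simp: abs_if split: if_splits)
  then show "\<eta> x \<le> 3 / 2 * \<eta> y" "\<eta> y \<le> 3 / 2 * \<eta> x"
    using assms unfolding near_def by (metis dist_commute)+
qed

lemma nn_integral_ball_le:
  assumes "c \<ge> 0" "r \<ge> 0"
  shows "(\<integral>\<^sup>+y. ennreal (if dist x y \<le> r then c else 0) \<partial>M) \<le> ennreal (c * (unit_ball_vol (real DIM('a)) * r ^ DIM('a)))"
proof -
  have "(\<integral>\<^sup>+y. ennreal (if dist x y \<le> r then c else 0) \<partial>M) = (\<integral>\<^sup>+y. ennreal (if dist x y \<le> r then c else 0) * indicator \<Omega> y \<partial>lebesgue)"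
    using open_domain by (subst nn_integral_restrict_space) auto
  also have "\<dots> \<le> (\<integral>\<^sup>+y. ennreal c * indicator (cball x r) y \<partial>lebesgue)"
    by (intro nn_integral_mono) (auto simp: indicator_def)
  also have "\<dots> = ennreal c * emeasure lebesgue (cball x r)"
    by (rule nn_integral_cmult_indicator) auto
  also have "\<dots> = ennreal (c * (unit_ball_vol (real DIM('a)) * r ^ DIM('a)))"
    using assms by (simp add: emeasure_cball ennreal_mult)
  finally show ?thesis .
qed

lemma nn_integral_ball_eq:
  assumes "c \<ge> 0" "r \<ge> 0" "cball x r \<subseteq> \<Omega>"
  shows "(\<integral>\<^sup>+y. ennreal (if dist x y \<le> r then c else 0) \<partial>M) = ennreal (c * (unit_ball_vol (real DIM('a)) * r ^ DIM('a)))"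
proof -
  have "(\<integral>\<^sup>+y. ennreal (if dist x y \<le> r then c else 0) \<partial>M) = (\<integral>\<^sup>+y. ennreal (if dist x y \<le> r then c else 0) * indicator \<Omega> y \<partial>lebesgue)"
    using open_domain by (subst nn_integral_restrict_space) auto
  also have "\<dots> = (\<integral>\<^sup>+y. ennreal c * indicator (cball x r) y \<partial>lebesgue)"
    using assms(3) by (intro nn_integral_cong) (auto simp: indicator_def)
  also have "\<dots> = ennreal c * emeasure lebesgue (cball x r)"
    by (rule nn_integral_cmult_indicator) auto
  also have "\<dots> = ennreal (c * (unit_ball_vol (real DIM('a)) * r ^ DIM('a)))"
    using assms by (simp add: emeasure_cball ennreal_mult)
  finally show ?thesis .
qed

text \<open>The radius is a parameter because three values have to be compared: \<open>R\<close>
  from the norm, \<open>r0\<close> from the lower bound of the kernel, and 1, for which the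
  estimates are stated.\<close>

definition energy :: "real \<Rightarrow> ('a \<Rightarrow> real) \<Rightarrow> ennreal" where
  "energy s u = (\<integral>\<^sup>+x. \<integral>\<^sup>+y. ennreal (if dist x y \<le> s * \<eta> x then (u x - u y)\<^sup>2 / \<eta> x ^ (DIM('a) + 2) else 0) \<partial>M \<partial>M)"

text \<open>The difference \<open>u x - u y\<close> is split at an intermediate point \<open>z\<close>, averaged over points close
  to the midpoint of \<open>x\<close> and \<open>y\<close>; since \<open>\<eta>\<close> is Lipschitz with constant \<open>1/3\<close>, the distances of \<open>z\<close> to
  both endpoints are at most \<open>3/4 s\<close> times \<open>\<eta>\<close>.\<close>

lemma energy_chain_step:
  assumes s: "0 < s" "s \<le> 1" and u[measurable]: "u \<in> borel_measurable M"
  shows "energy s u \<le> ennreal (chain_const DIM('a)) * energy (3 / 4 * s) u"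
proof -
  let ?V = "unit_ball_vol (real DIM('a))" and ?n = "DIM('a)"
  have V: "?V > 0" "?V \<noteq> 0" using unit_ball_vol_pos[of "real DIM('a)"] by linarith+
  \<comment> \<open>A point within s \<eta> / 20 of the midpoint is within (1/2 + 1/20) s \<eta> =
    11/20 s \<eta> of both ends.\<close>
  define A where "A x y z \<longleftrightarrow> dist x y \<le> s * \<eta> x \<and> dist x z \<le> 11/20 * s * \<eta> x \<and> dist y z \<le> 11/20 * s * \<eta> x" for x y z
  \<comment> \<open>Reciprocal volume of the averaging ball around the midpoint, so that the average
    over \<open>z\<close> has total mass 1.\<close>
  define c where "c x = 1 / (?V * (s * \<eta> x / 20) ^ ?n)" for x
  define F where "F x y z = ennreal (if A x y z then c x * ((u x - u z)\<^sup>2 / \<eta> x ^ (?n + 2)) else 0)" for x y z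
  define G where "G x y z = ennreal (if A x y z then c x * ((u z - u y)\<^sup>2 / \<eta> x ^ (?n + 2)) else 0)" for x y z
  define I where "I t x y = ennreal (if dist x y \<le> t * \<eta> x then (u x - u y)\<^sup>2 / \<eta> x ^ (?n + 2) else 0)" for t x y
  have c_pos: "c x > 0" if "x \<in> \<Omega>" for x
    using eta_pos[OF that] s V by (simp add: c_def)
  have step1: "I s x y \<le> 2 * (\<integral>\<^sup>+z. F x y z \<partial>M) + 2 * (\<integral>\<^sup>+z. G x y z \<partial>M)" if x: "x \<in> \<Omega>" and y: "y \<in> \<Omega>" for x y
  proof (cases "dist x y \<le> s * \<eta> x")
    case False
    then show ?thesis by (simp add: I_def)
  next
    case True
    define v where "v = (u x - u y)\<^sup>2 / \<eta> x ^ (?n + 2)"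
    define r where "r = s * \<eta> x / 20"
    define m where "m = (1/2) *\<^sub>R (x + y)"
    have ex: "\<eta> x > 0" by (rule eta_pos[OF x])
    have r: "r > 0" using ex s by (simp add: r_def)
    have "x - m = (1/2) *\<^sub>R (x - y)" "y - m = (1/2) *\<^sub>R (y - x)" by (auto simp: m_def algebra_simps simp flip: scaleR_add_left)
    then have dm: "dist x m = dist x y / 2" "dist y m = dist x y / 2" by (simp_all add: dist_norm norm_minus_commute)
    have s\<eta>: "s * \<eta> x \<le> \<eta> x" using s ex by simp
    have sub: "cball m r \<subseteq> \<Omega>"
    proof -
      have "cball m r \<subseteq> cball x (\<eta> x)"
      proof
        fix z assume "z \<in> cball m r"
        then have "dist x z \<le> dist x y / 2 + r" using dist_triangle[of x z m] dm by simp
        then show "z \<in> cball x (\<eta> x)" unfolding mem_cball using True s\<eta> ex unfolding r_def by linarith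
      qed
      then show ?thesis using cball_eta_subset[OF x] by blast
    qed
    have v0: "v \<ge> 0" using ex by (simp add: v_def)
    have "c x * (?V * r ^ ?n) = 1"
      using r V by (simp add: c_def r_def[symmetric])
    then have "v * c x * (?V * r ^ ?n) = v" by (simp add: mult.assoc)
    then have "ennreal v = (\<integral>\<^sup>+z. ennreal (if dist m z \<le> r then v * c x else 0) \<partial>M)"
      using nn_integral_ball_eq[of "v * c x" r m] v0 c_pos[OF x] r sub by simp
    also have "\<dots> \<le> (\<integral>\<^sup>+z. 2 * F x y z + 2 * G x y z \<partial>M)"
    proof (rule nn_integral_mono)
      fix z assume "z \<in> space M"
      show "ennreal (if dist m z \<le> r then v * c x else 0) \<le> 2 * F x y z + 2 * G x y z"
      proof (cases "dist m z \<le> r")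
        case mz: True
        have "dist x z \<le> dist x y / 2 + r" "dist y z \<le> dist x y / 2 + r"
          using dist_triangle[of x z m] dist_triangle[of y z m] dm mz by auto
        then have A: "A x y z" using True by (auto simp: A_def r_def)
        have "(u x - u y)\<^sup>2 \<le> 2 * (u x - u z)\<^sup>2 + 2 * (u z - u y)\<^sup>2"
        proof -
          have "0 \<le> ((u x - u z) - (u z - u y))\<^sup>2" by simp
          then show ?thesis by (simp add: power2_eq_square algebra_simps)
        qed
        then have "v \<le> (2 * (u x - u z)\<^sup>2 + 2 * (u z - u y)\<^sup>2) / \<eta> x ^ (?n + 2)"
          unfolding v_def using ex by (intro divide_right_mono) auto
        then have "v * c x \<le> (2 * (u x - u z)\<^sup>2 + 2 * (u z - u y)\<^sup>2) / \<eta> x ^ (?n + 2) * c x"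
          using c_pos[OF x] by (intro mult_right_mono) auto
        also have "\<dots> = 2 * (c x * ((u x - u z)\<^sup>2 / \<eta> x ^ (?n + 2))) + 2 * (c x * ((u z - u y)\<^sup>2 / \<eta> x ^ (?n + 2)))"
          by (simp add: add_divide_distrib algebra_simps)
        finally have "ennreal (v * c x) \<le> ennreal (2 * (c x * ((u x - u z)\<^sup>2 / \<eta> x ^ (?n + 2))) + 2 * (c x * ((u z - u y)\<^sup>2 / \<eta> x ^ (?n + 2))))"
          by (rule ennreal_leI)
        also have "\<dots> = 2 * F x y z + 2 * G x y z"
          using A ex c_pos[OF x] by (subst ennreal_double_add) (auto simp: F_def G_def)
        finally show ?thesis using mz by simp
      qed simp
    qed
    also have "\<dots> = 2 * (\<integral>\<^sup>+z. F x y z \<partial>M) + 2 * (\<integral>\<^sup>+z. G x y z \<partial>M)"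
    proof -
      have [measurable]: "x \<in> space M" "y \<in> space M" using x y by auto
      have "F x y \<in> borel_measurable M" "G x y \<in> borel_measurable M"
        unfolding F_def[abs_def] G_def[abs_def] A_def by measurable
      then show ?thesis by (simp add: nn_integral_add nn_integral_cmult)
    qed
    finally show ?thesis using True by (simp add: I_def v_def)
  qed
  have [measurable]: "c \<in> borel_measurable M" unfolding c_def[abs_def] by measurable
  have Fm[measurable]: "(\<lambda>w. F (p w) (q w) (t w)) \<in> borel_measurable N" "(\<lambda>w. G (p w) (q w) (t w)) \<in> borel_measurable N"
    if [measurable]: "p \<in> N \<rightarrow>\<^sub>M M" "q \<in> N \<rightarrow>\<^sub>M M" "t \<in> N \<rightarrow>\<^sub>M M" for p q t and N :: "'n measure"
    unfolding F_def G_def A_def by measurable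
  have I_cmult: "(\<integral>\<^sup>+x. \<integral>\<^sup>+z. ennreal r * I t x z \<partial>M \<partial>M) = ennreal r * energy t u" for r t
  proof -
    have [measurable]: "(\<lambda>w. I t (p w) (q w)) \<in> borel_measurable N"
      if [measurable]: "p \<in> N \<rightarrow>\<^sub>M M" "q \<in> N \<rightarrow>\<^sub>M M" for p q and N :: "'n measure"
      unfolding I_def by measurable
    have "(\<integral>\<^sup>+x. \<integral>\<^sup>+z. ennreal r * I t x z \<partial>M \<partial>M) = (\<integral>\<^sup>+x. ennreal r * (\<integral>\<^sup>+z. I t x z \<partial>M) \<partial>M)"
      by (intro nn_integral_cong nn_integral_cmult) measurable
    also have "\<dots> = ennreal r * (\<integral>\<^sup>+x. \<integral>\<^sup>+z. I t x z \<partial>M \<partial>M)"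
      by (rule nn_integral_cmult) measurable
    finally show ?thesis unfolding energy_def I_def .
  qed
  have "energy s u = (\<integral>\<^sup>+x. \<integral>\<^sup>+y. I s x y \<partial>M \<partial>M)" by (simp add: energy_def I_def)
  also have "\<dots> \<le> (\<integral>\<^sup>+x. \<integral>\<^sup>+y. 2 * (\<integral>\<^sup>+z. F x y z \<partial>M) + 2 * (\<integral>\<^sup>+z. G x y z \<partial>M) \<partial>M \<partial>M)"
    by (intro nn_integral_mono step1) auto
  also have "\<dots> = (\<integral>\<^sup>+x. 2 * (\<integral>\<^sup>+y. \<integral>\<^sup>+z. F x y z \<partial>M \<partial>M) + 2 * (\<integral>\<^sup>+y. \<integral>\<^sup>+z. G x y z \<partial>M \<partial>M) \<partial>M)"
    by (intro nn_integral_cong) (simp add: nn_integral_add nn_integral_cmult)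
  also have "\<dots> = 2 * (\<integral>\<^sup>+x. \<integral>\<^sup>+y. \<integral>\<^sup>+z. F x y z \<partial>M \<partial>M \<partial>M) + 2 * (\<integral>\<^sup>+x. \<integral>\<^sup>+y. \<integral>\<^sup>+z. G x y z \<partial>M \<partial>M \<partial>M)"
    by (simp add: nn_integral_add nn_integral_cmult)
  also have "(\<integral>\<^sup>+x. \<integral>\<^sup>+y. \<integral>\<^sup>+z. F x y z \<partial>M \<partial>M \<partial>M) = (\<integral>\<^sup>+x. \<integral>\<^sup>+z. \<integral>\<^sup>+y. F x y z \<partial>M \<partial>M \<partial>M)"
    by (intro nn_integral_cong P.Fubini') (simp add: split_beta')
  also have "\<dots> \<le> (\<integral>\<^sup>+x. \<integral>\<^sup>+z. ennreal (20 ^ ?n) * I (3/4 * s) x z \<partial>M \<partial>M)"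
  proof (intro nn_integral_mono)
    fix x z assume "x \<in> space M" "z \<in> space M"
    then have x: "x \<in> \<Omega>" and z: "z \<in> \<Omega>" by auto
    have ex: "\<eta> x > 0" by (rule eta_pos[OF x])
    define v where "v = (u x - u z)\<^sup>2 / \<eta> x ^ (?n + 2)"
    have v0: "v \<ge> 0" using ex by (simp add: v_def)
    show "(\<integral>\<^sup>+y. F x y z \<partial>M) \<le> ennreal (20 ^ ?n) * I (3/4 * s) x z"
    proof (cases "dist x z \<le> 3/4 * s * \<eta> x")
      case True
      have "(\<integral>\<^sup>+y. F x y z \<partial>M) \<le> (\<integral>\<^sup>+y. ennreal (if dist x y \<le> s * \<eta> x then c x * v else 0) \<partial>M)"
        using v0 c_pos[OF x] by (intro nn_integral_mono) (auto simp: F_def A_def v_def intro!: ennreal_leI)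
      also have "\<dots> \<le> ennreal (c x * v * (?V * (s * \<eta> x) ^ ?n))"
        using v0 c_pos[OF x] s ex by (intro nn_integral_ball_le) auto
      also have "c x * v * (?V * (s * \<eta> x) ^ ?n) = 20 ^ ?n * v"
        using V s ex by (simp add: c_def field_simps)
      also have "ennreal (20 ^ ?n * v) = ennreal (20 ^ ?n) * ennreal v" by (rule ennreal_mult[OF _ v0]) simp
      also have "ennreal v = I (3/4 * s) x z" using True by (simp add: I_def v_def)
      finally show ?thesis .
    next
      case False
      have "s * \<eta> x \<ge> 0" using s ex by simp
      then have "F x y z = 0" for y using False by (auto simp: F_def A_def)
      then show ?thesis by simp
    qed
  qed
  also have "\<dots> = ennreal (20 ^ ?n) * energy (3/4 * s) u" by (rule I_cmult)
  also have "(\<integral>\<^sup>+x. \<integral>\<^sup>+y. \<integral>\<^sup>+z. G x y z \<partial>M \<partial>M \<partial>M) = (\<integral>\<^sup>+x. \<integral>\<^sup>+z. \<integral>\<^sup>+y. G x y z \<partial>M \<partial>M \<partial>M)"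
    by (intro nn_integral_cong P.Fubini') (simp add: split_beta')
  also have "\<dots> = (\<integral>\<^sup>+z. \<integral>\<^sup>+x. \<integral>\<^sup>+y. G x y z \<partial>M \<partial>M \<partial>M)"
    by (intro P.Fubini') (simp add: split_beta')
  also have "\<dots> = (\<integral>\<^sup>+z. \<integral>\<^sup>+y. \<integral>\<^sup>+x. G x y z \<partial>M \<partial>M \<partial>M)"
    by (intro nn_integral_cong P.Fubini') (simp add: split_beta')
  also have "\<dots> \<le> (\<integral>\<^sup>+z. \<integral>\<^sup>+y. ennreal (20 ^ ?n * (6/5) ^ (2 * ?n + 2)) * I (3/4 * s) z y \<partial>M \<partial>M)"
  proof (intro nn_integral_mono)
    fix z y assume "z \<in> space M" "y \<in> space M"
    then have z: "z \<in> \<Omega>" and y: "y \<in> \<Omega>" by auto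
    have ez: "\<eta> z > 0" by (rule eta_pos[OF z])
    \<comment> \<open>Upper bound for the values of \<open>G\<close> with \<open>\<eta> x\<close>
      replaced throughout by \<open>\<eta> z\<close>, at the cost of powers of 6/5.\<close>
    define w where "w = (6/5) ^ ?n * (20 ^ ?n / (?V * (s * \<eta> z) ^ ?n)) * ((6/5) ^ (?n + 2) * ((u z - u y)\<^sup>2 / \<eta> z ^ (?n + 2)))"
    have w0: "w \<ge> 0" using ez V s by (auto simp: w_def intro!: mult_nonneg_nonneg divide_nonneg_nonneg)
    have key: "dist z y \<le> 3/4 * s * \<eta> z \<and> dist z x \<le> s * \<eta> z \<and> G x y z \<le> ennreal w"
      if x: "x \<in> \<Omega>" and A: "A x y z" for x
    proof -
      have ex: "\<eta> x > 0" by (rule eta_pos[OF x])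
      have xz: "dist x z \<le> 11/20 * (s * \<eta> x)" and yz: "dist y z \<le> 11/20 * (s * \<eta> x)"
        using A by (auto simp: A_def)
      have sx: "s * \<eta> x \<le> \<eta> x" "s * \<eta> x > 0" using s ex by auto
      have "\<bar>\<eta> x - \<eta> z\<bar> \<le> dist x z / 3" using xz sx by (intro eta_lipschitz(2)[OF x]) linarith
      \<comment> \<open>The difference of \<open>\<eta> x\<close> and \<open>\<eta> z\<close> is at
        most 11/60 of \<open>\<eta> x\<close>, so the two ratios are at most 71/60 < 6/5 and 60/49 <
        5/4.\<close>
      then have cmp: "\<eta> z \<le> 6/5 * \<eta> x" "\<eta> x \<le> 5/4 * \<eta> z" using xz sx by (auto simp: abs_if split: if_splits)
      have "s * \<eta> x \<le> s * (5/4 * \<eta> z)" using cmp s by (intro mult_left_mono) auto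
      then have q: "s * \<eta> x \<le> 5/4 * (s * \<eta> z)" by (simp only: mult.left_commute)
      have sz: "s * \<eta> z > 0" using s ez by simp
      \<comment> \<open>11/20 times 5/4 is 11/16, which is below 3/4: this is the source of the
        contraction factor of the radius.\<close>
      have 1: "dist z y \<le> 3/4 * s * \<eta> z" "dist z x \<le> s * \<eta> z"
        using xz yz q sz unfolding dist_commute[of z] mult.assoc by linarith+
      have "(5/6 * \<eta> z) ^ ?n \<le> \<eta> x ^ ?n" "(5/6 * \<eta> z) ^ (?n + 2) \<le> \<eta> x ^ (?n + 2)"
        using cmp ez by (intro power_mono; simp)+
      then have p1: "1 / \<eta> x ^ ?n \<le> 1 / (5/6 * \<eta> z) ^ ?n" and p2: "1 / \<eta> x ^ (?n + 2) \<le> 1 / (5/6 * \<eta> z) ^ (?n + 2)"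
        using ex ez by (intro divide_left_mono; simp)+
      have "c x = 20 ^ ?n / (?V * s ^ ?n) * (1 / \<eta> x ^ ?n)"
        by (simp add: c_def power_divide power_mult_distrib)
      also have "\<dots> \<le> 20 ^ ?n / (?V * s ^ ?n) * (1 / (5/6 * \<eta> z) ^ ?n)"
        using p1 V s by (intro mult_left_mono) auto
      also have "\<dots> = (6/5) ^ ?n * (20 ^ ?n / (?V * (s * \<eta> z) ^ ?n))"
        by (simp add: power_mult_distrib power_divide field_simps)
      finally have c: "c x \<le> (6/5) ^ ?n * (20 ^ ?n / (?V * (s * \<eta> z) ^ ?n))" .
      have "(u z - u y)\<^sup>2 * (1 / \<eta> x ^ (?n + 2)) \<le> (u z - u y)\<^sup>2 * (1 / (5/6 * \<eta> z) ^ (?n + 2))"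
        using p2 by (intro mult_left_mono) auto
      also have "\<dots> = (6/5) ^ (?n + 2) * ((u z - u y)\<^sup>2 / \<eta> z ^ (?n + 2))"
        by (simp add: power_mult_distrib power_divide field_simps)
      finally have "(u z - u y)\<^sup>2 / \<eta> x ^ (?n + 2) \<le> (6/5) ^ (?n + 2) * ((u z - u y)\<^sup>2 / \<eta> z ^ (?n + 2))"
        by simp
      then have "c x * ((u z - u y)\<^sup>2 / \<eta> x ^ (?n + 2)) \<le> w"
        unfolding w_def using c c_pos[OF x] ex by (intro mult_mono) auto
      then show ?thesis using 1 A by (auto simp: G_def intro: ennreal_leI)
    qed
    show "(\<integral>\<^sup>+x. G x y z \<partial>M) \<le> ennreal (20 ^ ?n * (6/5) ^ (2 * ?n + 2)) * I (3/4 * s) z y"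
    proof (cases "dist z y \<le> 3/4 * s * \<eta> z")
      case True
      have "(\<integral>\<^sup>+x. G x y z \<partial>M) \<le> (\<integral>\<^sup>+x. ennreal (if dist z x \<le> s * \<eta> z then w else 0) \<partial>M)"
      proof (rule nn_integral_mono)
        fix x assume "x \<in> space M"
        then show "G x y z \<le> ennreal (if dist z x \<le> s * \<eta> z then w else 0)"
          using key[of x] by (cases "A x y z") (auto simp: G_def)
      qed
      also have "\<dots> \<le> ennreal (w * (?V * (s * \<eta> z) ^ ?n))"
        using w0 s ez by (intro nn_integral_ball_le) auto
      also have "w * (?V * (s * \<eta> z) ^ ?n) = 20 ^ ?n * (6/5) ^ (2 * ?n + 2) * ((u z - u y)\<^sup>2 / \<eta> z ^ (?n + 2))"
      proof -
        have "(6/5::real) ^ (2 * ?n + 2) = (6/5) ^ ?n * (6/5) ^ (?n + 2)"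
          by (simp only: power_add[symmetric]) (simp add: mult_2)
        moreover have "?V * (s * \<eta> z) ^ ?n > 0" using V s ez by simp
        ultimately show ?thesis unfolding w_def using V s ez by (simp del: power_Suc power_mult_distrib)
      qed
      also have "ennreal \<dots> = ennreal (20 ^ ?n * (6/5) ^ (2 * ?n + 2)) * ennreal ((u z - u y)\<^sup>2 / \<eta> z ^ (?n + 2))"
        using ez by (intro ennreal_mult) auto
      also have "ennreal ((u z - u y)\<^sup>2 / \<eta> z ^ (?n + 2)) = I (3/4 * s) z y" using True by (simp add: I_def)
      finally show ?thesis .
    next
      case False
      have "(\<integral>\<^sup>+x. G x y z \<partial>M) = (\<integral>\<^sup>+x. 0 \<partial>M)"
        using key False by (intro nn_integral_cong) (auto simp: G_def)
      then show ?thesis by simp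
    qed
  qed
  also have "\<dots> = ennreal (20 ^ ?n * (6/5) ^ (2 * ?n + 2)) * energy (3/4 * s) u" by (rule I_cmult)
  finally have "energy s u \<le> 2 * (ennreal (20 ^ ?n) * energy (3/4 * s) u) + 2 * (ennreal (20 ^ ?n * (6/5) ^ (2 * ?n + 2)) * energy (3/4 * s) u)"
    by (simp add: add_mono mult_left_mono)
  also have "\<dots> = ennreal (chain_const DIM('a)) * energy (3/4 * s) u"
    by (simp add: chain_const_def ennreal_plus ennreal_mult algebra_simps del: power_Suc)
  finally show ?thesis .
qed

lemma energy_mono:
  assumes "s \<le> t"
  shows "energy s u \<le> energy t u"
  unfolding energy_def
proof (intro nn_integral_mono)
  fix x y assume "x \<in> space M" "y \<in> space M"
  then have "s * \<eta> x \<le> t * \<eta> x" using assms eta_pos[of x] by (simp add: mult_right_mono)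
  then have "dist x y \<le> t * \<eta> x" if "dist x y \<le> s * \<eta> x" using that by linarith
  then show "ennreal (if dist x y \<le> s * \<eta> x then (u x - u y)\<^sup>2 / \<eta> x ^ (DIM('a) + 2) else 0)
    \<le> ennreal (if dist x y \<le> t * \<eta> x then (u x - u y)\<^sup>2 / \<eta> x ^ (DIM('a) + 2) else 0)"
    using eta_pos[of x] \<open>x \<in> space M\<close> by auto
qed

text \<open>Each step shrinks the radius by the factor 3/4, so the number of steps depends on
  \<open>r\<close> alone.\<close>

lemma energy_chain:
  assumes u: "u \<in> borel_measurable M" and r: "r > 0"
  shows "energy 1 u \<le> ennreal (chain_const DIM('a) ^ chain_steps r) * energy r u"
proof -
  have "energy 1 u \<le> ennreal (chain_const DIM('a) ^ k) * energy ((3/4) ^ k) u" for k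
  proof (induction k)
    case (Suc k)
    have "energy ((3/4) ^ k) u \<le> ennreal (chain_const DIM('a)) * energy (3/4 * (3/4) ^ k) u"
      by (rule energy_chain_step) (auto simp: u power_le_one)
    from order_trans[OF Suc mult_left_mono[OF this]] show ?case
      using chain_const_pos[of "DIM('a)"] by (simp add: ennreal_mult mult_ac)
  qed simp
  also have "ennreal (chain_const DIM('a) ^ chain_steps r) * energy ((3/4) ^ chain_steps r) u
    \<le> ennreal (chain_const DIM('a) ^ chain_steps r) * energy r u"
    by (intro mult_left_mono energy_mono chain_steps r) auto
  finally show ?thesis .
qed

section \<open>Interacting pairs and mean oscillation\<close>

lemma near_measurable[measurable (raw)]:
  assumes [measurable]: "p \<in> N \<rightarrow>\<^sub>M M" "q \<in> N \<rightarrow>\<^sub>M M"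
  shows "Measurable.pred N (\<lambda>w. near (p w) (q w))"
  unfolding near_def by measurable

lemma near_volume:
  assumes x: "x \<in> \<Omega>" and c: "c \<ge> 0"
  shows "(\<integral>\<^sup>+y. ennreal (if near x y then c else 0) \<partial>M) \<le> ennreal (c * (unit_ball_vol (real DIM('a)) * (3/2 * \<eta> x) ^ DIM('a)))"
proof -
  have "(\<integral>\<^sup>+y. ennreal (if near x y then c else 0) \<partial>M) \<le> (\<integral>\<^sup>+y. ennreal (if dist x y \<le> 3/2 * \<eta> x then c else 0) \<partial>M)"
  proof (rule nn_integral_mono)
    fix y assume "y \<in> space M"
    then have y: "y \<in> \<Omega>" by simp
    have "dist x y \<le> 3/2 * \<eta> x" if "near x y"
      using near_comparable[OF x y that] that eta_pos[OF x] by (auto simp: near_def)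
    then show "ennreal (if near x y then c else 0) \<le> ennreal (if dist x y \<le> 3/2 * \<eta> x then c else 0)" by auto
  qed
  also have "\<dots> \<le> ennreal (c * (unit_ball_vol (real DIM('a)) * (3/2 * \<eta> x) ^ DIM('a)))"
    using c eta_pos[OF x] by (intro nn_integral_ball_le) auto
  finally show ?thesis .
qed

text \<open>A related pair lies within \<open>\<eta> x\<close> or within \<open>\<eta> y\<close>.
  The second case becomes the first by exchanging the variables, and comparability of
  \<open>\<eta>\<close> at the two points costs a factor (3/2)^(d + 2).\<close>

lemma near_energy_le:
  assumes u[measurable]: "u \<in> borel_measurable M"
  shows "(\<integral>\<^sup>+x. \<integral>\<^sup>+y. ennreal (if near x y then (u x - u y)\<^sup>2 / \<eta> x ^ (DIM('a) + 2) else 0) \<partial>M \<partial>M)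
    \<le> ennreal (1 + (3/2) ^ (DIM('a) + 2)) * energy 1 u"
proof -
  let ?n = "DIM('a) + 2"
  define I where "I x y = ennreal (if dist x y \<le> \<eta> x then (u x - u y)\<^sup>2 / \<eta> x ^ ?n else 0)" for x y
  have Im[measurable]: "(\<lambda>w. I (p w) (q w)) \<in> borel_measurable N"
    if [measurable]: "p \<in> N \<rightarrow>\<^sub>M M" "q \<in> N \<rightarrow>\<^sub>M M" for p q and N :: "'n measure"
    unfolding I_def by measurable
  have "ennreal (if near x y then (u x - u y)\<^sup>2 / \<eta> x ^ ?n else 0) \<le> I x y + ennreal ((3/2) ^ ?n) * I y x"
    if x: "x \<in> \<Omega>" and y: "y \<in> \<Omega>" for x y
  proof -
    have ex: "\<eta> x > 0" and ey: "\<eta> y > 0" using eta_pos x y by auto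
    consider "dist x y \<le> \<eta> x" | "dist x y \<le> \<eta> y" "near x y" | "\<not> near x y" by (auto simp: near_def)
    then show ?thesis
    proof cases
      case 1
      then have "ennreal (if near x y then (u x - u y)\<^sup>2 / \<eta> x ^ ?n else 0) = I x y" by (auto simp: I_def near_def)
      then show ?thesis by simp
    next
      case 2
      have "\<eta> y ^ ?n \<le> (3/2 * \<eta> x) ^ ?n" using near_comparable(2)[OF x y 2(2)] ey by (intro power_mono) auto
      then have "1 / \<eta> x ^ ?n \<le> (3/2) ^ ?n / \<eta> y ^ ?n"
        using ex ey by (simp add: power_mult_distrib divide_simps mult.commute del: power_Suc)
      then have "(u x - u y)\<^sup>2 * (1 / \<eta> x ^ ?n) \<le> (u x - u y)\<^sup>2 * ((3/2) ^ ?n / \<eta> y ^ ?n)" by (rule mult_left_mono) simp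
      then have "(u x - u y)\<^sup>2 / \<eta> x ^ ?n \<le> (3/2) ^ ?n * ((u y - u x)\<^sup>2 / \<eta> y ^ ?n)"
        by (simp add: power2_commute[of "u x"] mult.commute)
      then have "ennreal ((u x - u y)\<^sup>2 / \<eta> x ^ ?n) \<le> ennreal ((3/2) ^ ?n) * ennreal ((u y - u x)\<^sup>2 / \<eta> y ^ ?n)"
        using ey by (subst ennreal_mult[symmetric]) (auto intro!: ennreal_leI)
      also have "ennreal ((u y - u x)\<^sup>2 / \<eta> y ^ ?n) = I y x" using 2 by (simp add: I_def dist_commute)
      finally show ?thesis using 2 by (simp add: add_increasing)
    qed simp
  qed
  then have "(\<integral>\<^sup>+x. \<integral>\<^sup>+y. ennreal (if near x y then (u x - u y)\<^sup>2 / \<eta> x ^ ?n else 0) \<partial>M \<partial>M) \<le>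
    (\<integral>\<^sup>+x. \<integral>\<^sup>+y. I x y + ennreal ((3/2) ^ ?n) * I y x \<partial>M \<partial>M)"
    by (intro nn_integral_mono) auto
  also have "\<dots> = (\<integral>\<^sup>+x. (\<integral>\<^sup>+y. I x y \<partial>M) + ennreal ((3/2) ^ ?n) * (\<integral>\<^sup>+y. I y x \<partial>M) \<partial>M)"
    by (intro nn_integral_cong) (simp add: nn_integral_add nn_integral_cmult)
  also have "\<dots> = (\<integral>\<^sup>+x. \<integral>\<^sup>+y. I x y \<partial>M \<partial>M) + ennreal ((3/2) ^ ?n) * (\<integral>\<^sup>+x. \<integral>\<^sup>+y. I y x \<partial>M \<partial>M)"
    by (simp add: nn_integral_add nn_integral_cmult)
  also have "(\<integral>\<^sup>+x. \<integral>\<^sup>+y. I y x \<partial>M \<partial>M) = (\<integral>\<^sup>+x. \<integral>\<^sup>+y. I x y \<partial>M \<partial>M)"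
    by (rule P.Fubini') (simp add: split_beta')
  also have "(\<integral>\<^sup>+x. \<integral>\<^sup>+y. I x y \<partial>M \<partial>M) = energy 1 u" by (simp add: energy_def I_def)
  finally show ?thesis by (simp add: distrib_right ennreal_plus)
qed

text \<open>The scaling \<open>\<eta> x ^ (d + 1)\<close> makes the squared \<open>L\<^sup>2\<close> norm of the mean oscillation
  comparable to the energy by the Cauchy--Schwarz inequality.\<close>

lemma mean_oscillation_le:
  assumes u[measurable]: "u \<in> borel_measurable M"
  shows "(\<integral>\<^sup>+x. (\<integral>\<^sup>+y. ennreal (if near x y then \<bar>u x - u y\<bar> / \<eta> x ^ (DIM('a) + 1) else 0) \<partial>M)\<^sup>2 \<partial>M)
    \<le> ennreal (unit_ball_vol (real DIM('a)) * (3/2) ^ DIM('a) * (1 + (3/2) ^ (DIM('a) + 2))) * energy 1 u"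
proof -
  let ?n = "DIM('a)" and ?V = "unit_ball_vol (real DIM('a))"
  have V: "?V > 0" "?V \<noteq> 0" using unit_ball_vol_pos[of "real DIM('a)"] by linarith+
  have "(\<integral>\<^sup>+y. ennreal (if near x y then \<bar>u x - u y\<bar> / \<eta> x ^ (?n + 1) else 0) \<partial>M)\<^sup>2 \<le>
    ennreal (?V * (3/2) ^ ?n) * (\<integral>\<^sup>+y. ennreal (if near x y then (u x - u y)\<^sup>2 / \<eta> x ^ (?n + 2) else 0) \<partial>M)"
    if x: "x \<in> \<Omega>" for x
  proof -
    have ex: "\<eta> x > 0" using eta_pos x by auto
    have [measurable]: "x \<in> space M" using x by simp
    \<comment> \<open>The square of the first factor integrates to a multiple of \<eta>^-d, which is
      just what the square of the second factor lacks to become the density of the energy.\<close>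
    let ?f = "\<lambda>y. ennreal (if near x y then 1 / \<eta> x ^ ?n else 0)"
    let ?h = "\<lambda>y. ennreal (if near x y then \<bar>u x - u y\<bar> / \<eta> x else 0)"
    let ?J = "\<integral>\<^sup>+y. ennreal (if near x y then (u x - u y)\<^sup>2 / (\<eta> x)\<^sup>2 else 0) \<partial>M"
    have fh: "(\<integral>\<^sup>+y. ennreal (if near x y then \<bar>u x - u y\<bar> / \<eta> x ^ (?n + 1) else 0) \<partial>M) = (\<integral>\<^sup>+y. ?f y * ?h y \<partial>M)"
      using ex by (intro nn_integral_cong) (auto simp: ennreal_mult[symmetric] mult.commute)
    have f2: "(\<integral>\<^sup>+y. (?f y)\<^sup>2 \<partial>M) \<le> ennreal (?V * (3/2) ^ ?n / \<eta> x ^ ?n)"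
    proof -
      have "(\<integral>\<^sup>+y. (?f y)\<^sup>2 \<partial>M) = (\<integral>\<^sup>+y. ennreal (if near x y then (1 / \<eta> x ^ ?n)\<^sup>2 else 0) \<partial>M)"
        using ex by (intro nn_integral_cong ennreal_if_power2) simp
      moreover have "(1 / \<eta> x ^ ?n)\<^sup>2 * (?V * (3/2 * \<eta> x) ^ ?n) = ?V * (3/2) ^ ?n / \<eta> x ^ ?n"
        using ex by (simp only: power_mult_distrib[of "3/2"]) (simp add: power2_eq_square)
      ultimately show ?thesis
        using near_volume[OF x, of "(1 / \<eta> x ^ ?n)\<^sup>2"] by simp
    qed
    have h2: "(\<integral>\<^sup>+y. (?h y)\<^sup>2 \<partial>M) = ?J"
    proof -
      have "(\<integral>\<^sup>+y. (?h y)\<^sup>2 \<partial>M) = (\<integral>\<^sup>+y. ennreal (if near x y then (\<bar>u x - u y\<bar> / \<eta> x)\<^sup>2 else 0) \<partial>M)"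
        using ex by (intro nn_integral_cong ennreal_if_power2) simp
      then show ?thesis unfolding power_divide power2_abs .
    qed
    have J: "ennreal (1 / \<eta> x ^ ?n) * ?J = (\<integral>\<^sup>+y. ennreal (if near x y then (u x - u y)\<^sup>2 / \<eta> x ^ (?n + 2) else 0) \<partial>M)"
    proof -
      have "ennreal (1 / \<eta> x ^ ?n) * ?J = (\<integral>\<^sup>+y. ennreal (1 / \<eta> x ^ ?n) * ennreal (if near x y then (u x - u y)\<^sup>2 / (\<eta> x)\<^sup>2 else 0) \<partial>M)"
        by (rule nn_integral_cmult[symmetric]) measurable
      moreover have "1 / \<eta> x ^ ?n * ((u x - u y)\<^sup>2 / (\<eta> x)\<^sup>2) = (u x - u y)\<^sup>2 / \<eta> x ^ (?n + 2)" for y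
        by (simp add: power_add power2_eq_square)
      moreover have "ennreal (1 / \<eta> x ^ ?n) * ennreal (if near x y then (u x - u y)\<^sup>2 / (\<eta> x)\<^sup>2 else 0) =
          ennreal (if near x y then 1 / \<eta> x ^ ?n * ((u x - u y)\<^sup>2 / (\<eta> x)\<^sup>2) else 0)" for y
        using ex by (intro ennreal_if_mult) auto
      ultimately show ?thesis by presburger
    qed
    have "(\<integral>\<^sup>+y. ?f y * ?h y \<partial>M)\<^sup>2 \<le> (\<integral>\<^sup>+y. (?f y)\<^sup>2 \<partial>M) * (\<integral>\<^sup>+y. (?h y)\<^sup>2 \<partial>M)"
      by (rule Cauchy_Schwarz_nn_integral) measurable
    then have "(\<integral>\<^sup>+y. ?f y * ?h y \<partial>M)\<^sup>2 \<le> ennreal (?V * (3/2) ^ ?n / \<eta> x ^ ?n) * ?J"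
      unfolding h2 by (rule order_trans) (rule mult_right_mono[OF f2], simp)
    also have "ennreal (?V * (3/2) ^ ?n / \<eta> x ^ ?n) = ennreal (?V * (3/2) ^ ?n) * ennreal (1 / \<eta> x ^ ?n)"
      using ex V by (subst ennreal_mult[symmetric]) auto
    finally show ?thesis unfolding fh J[symmetric] by (simp only: mult.assoc)
  qed
  then have "(\<integral>\<^sup>+x. (\<integral>\<^sup>+y. ennreal (if near x y then \<bar>u x - u y\<bar> / \<eta> x ^ (?n + 1) else 0) \<partial>M)\<^sup>2 \<partial>M) \<le>
     (\<integral>\<^sup>+x. ennreal (?V * (3/2) ^ ?n) * (\<integral>\<^sup>+y. ennreal (if near x y then (u x - u y)\<^sup>2 / \<eta> x ^ (?n + 2) else 0) \<partial>M) \<partial>M)"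
    by (intro nn_integral_mono) auto
  also have "\<dots> = ennreal (?V * (3/2) ^ ?n) * (\<integral>\<^sup>+x. \<integral>\<^sup>+y. ennreal (if near x y then (u x - u y)\<^sup>2 / \<eta> x ^ (?n + 2) else 0) \<partial>M \<partial>M)"
    by (rule nn_integral_cmult) measurable
  also have "\<dots> \<le> ennreal (?V * (3/2) ^ ?n) * (ennreal (1 + (3/2) ^ (DIM('a) + 2)) * energy 1 u)"
    by (intro mult_left_mono near_energy_le u) simp
  finally show ?thesis using V by (simp add: ennreal_mult mult.assoc)
qed

text \<open>For a Lipschitz function the squared difference supplies \<eta>^2 and the ball supplies
  \<eta>^d. Together they cancel the weight, however small \<open>\<eta>\<close> becomes near the
  boundary.\<close>

lemma energy_C1_finite:
  assumes \<phi>: "C1_grad UNIV \<phi> \<psi>" and L: "\<And>x. norm (\<psi> x) \<le> L"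
  shows "energy 1 \<phi> < \<infinity>"
proof -
  let ?V = "unit_ball_vol (real DIM('a))"
  have L0: "L \<ge> 0" using L[of 0] norm_ge_zero order_trans by blast
  have "(\<integral>\<^sup>+y. ennreal (if dist x y \<le> 1 * \<eta> x then (\<phi> x - \<phi> y)\<^sup>2 / \<eta> x ^ (DIM('a) + 2) else 0) \<partial>M) \<le> ennreal (L\<^sup>2 * ?V)"
    if x: "x \<in> \<Omega>" for x
  proof -
    have ex: "\<eta> x > 0" using eta_pos x by auto
    have "(\<integral>\<^sup>+y. ennreal (if dist x y \<le> 1 * \<eta> x then (\<phi> x - \<phi> y)\<^sup>2 / \<eta> x ^ (DIM('a) + 2) else 0) \<partial>M) \<le>
      (\<integral>\<^sup>+y. ennreal (if dist x y \<le> \<eta> x then L\<^sup>2 / \<eta> x ^ DIM('a) else 0) \<partial>M)"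
    proof (rule nn_integral_mono)
      fix y
      have "(\<phi> x - \<phi> y)\<^sup>2 / \<eta> x ^ (DIM('a) + 2) \<le> L\<^sup>2 / \<eta> x ^ DIM('a)" if "dist x y \<le> \<eta> x"
      proof -
        have "\<bar>\<phi> x - \<phi> y\<bar> \<le> L * norm (x - y)"
          by (rule inner_deriv_bound[of UNIV, OF convex_UNIV C1_gradD(1)[OF \<phi>] L]) auto
        also have "\<dots> \<le> L * \<eta> x" using that L0 by (intro mult_left_mono) (auto simp: dist_norm)
        finally have "(\<phi> x - \<phi> y)\<^sup>2 \<le> (L * \<eta> x)\<^sup>2" using abs_le_square_iff[of "\<phi> x - \<phi> y" "L * \<eta> x"] by simp
        then have "(\<phi> x - \<phi> y)\<^sup>2 / \<eta> x ^ (DIM('a) + 2) \<le> (L * \<eta> x)\<^sup>2 / \<eta> x ^ (DIM('a) + 2)"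
          using ex by (intro divide_right_mono) auto
        also have "\<dots> = L\<^sup>2 / \<eta> x ^ DIM('a)" using ex by (simp add: power_mult_distrib power_add power2_eq_square)
        finally show ?thesis .
      qed
      then show "ennreal (if dist x y \<le> 1 * \<eta> x then (\<phi> x - \<phi> y)\<^sup>2 / \<eta> x ^ (DIM('a) + 2) else 0) \<le>
         ennreal (if dist x y \<le> \<eta> x then L\<^sup>2 / \<eta> x ^ DIM('a) else 0)" by (auto intro: ennreal_leI)
    qed
    also have "\<dots> \<le> ennreal (L\<^sup>2 / \<eta> x ^ DIM('a) * (?V * \<eta> x ^ DIM('a)))"
      using ex by (intro nn_integral_ball_le) auto
    finally show ?thesis using ex by simp
  qed
  then have "energy 1 \<phi> \<le> (\<integral>\<^sup>+x. ennreal (L\<^sup>2 * ?V) \<partial>M)"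
    unfolding energy_def by (intro nn_integral_mono) auto
  also have "\<dots> < \<infinity>"
  proof -
    have "emeasure M \<Omega> < top" using emeasure_finite[of \<Omega>] by (metis infinity_ennreal_def less_top)
    then show ?thesis by (simp add: ennreal_mult_less_top)
  qed
  finally show ?thesis .
qed

section \<open>Algebra of the energy and of the nonlocal norm\<close>

lemma energy_cmult:
  assumes u[measurable]: "u \<in> borel_measurable M"
  shows "energy s (\<lambda>x. c * u x) = ennreal (c\<^sup>2) * energy s u"
proof -
  define I where "I x y = ennreal (if dist x y \<le> s * \<eta> x then (u x - u y)\<^sup>2 / \<eta> x ^ (DIM('a) + 2) else 0)" for x y
  have Im[measurable]: "(\<lambda>w. I (p w) (q w)) \<in> borel_measurable N"
    if [measurable]: "p \<in> N \<rightarrow>\<^sub>M M" "q \<in> N \<rightarrow>\<^sub>M M" for p q and N :: "'n measure"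
    unfolding I_def by measurable
  have "ennreal (if dist x y \<le> s * \<eta> x then (c * u x - c * u y)\<^sup>2 / \<eta> x ^ (DIM('a) + 2) else 0) = ennreal (c\<^sup>2) * I x y"
    if "x \<in> \<Omega>" for x y
  proof -
    have "(c * u x - c * u y)\<^sup>2 / \<eta> x ^ (DIM('a) + 2) = c\<^sup>2 * ((u x - u y)\<^sup>2 / \<eta> x ^ (DIM('a) + 2))"
      by (simp add: power_mult_distrib right_diff_distrib[symmetric])
    then show ?thesis
      unfolding I_def using eta_pos[OF that] by (subst ennreal_if_mult) auto
  qed
  then have "energy s (\<lambda>x. c * u x) = (\<integral>\<^sup>+x. \<integral>\<^sup>+y. ennreal (c\<^sup>2) * I x y \<partial>M \<partial>M)"
    unfolding energy_def by (intro nn_integral_cong) auto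
  also have "\<dots> = (\<integral>\<^sup>+x. ennreal (c\<^sup>2) * (\<integral>\<^sup>+y. I x y \<partial>M) \<partial>M)"
    by (intro nn_integral_cong nn_integral_cmult) measurable
  also have "\<dots> = ennreal (c\<^sup>2) * (\<integral>\<^sup>+x. \<integral>\<^sup>+y. I x y \<partial>M \<partial>M)"
    by (rule nn_integral_cmult) measurable
  finally show ?thesis unfolding I_def energy_def .
qed

lemma energy_add_le:
  assumes u[measurable]: "u \<in> borel_measurable M" and v[measurable]: "v \<in> borel_measurable M"
  shows "energy s (\<lambda>x. u x + v x) \<le> 2 * energy s u + 2 * energy s v"
proof -
  define I where "I w x y = ennreal (if dist x y \<le> s * \<eta> x then (w x - w y)\<^sup>2 / \<eta> x ^ (DIM('a) + 2) else 0)" for w x y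
  have Im[measurable]: "(\<lambda>w. I u (p w) (q w)) \<in> borel_measurable N" "(\<lambda>w. I v (p w) (q w)) \<in> borel_measurable N"
    if [measurable]: "p \<in> N \<rightarrow>\<^sub>M M" "q \<in> N \<rightarrow>\<^sub>M M" for p q and N :: "'n measure"
    unfolding I_def by measurable
  have "I (\<lambda>x. u x + v x) x y \<le> 2 * I u x y + 2 * I v x y" if "x \<in> \<Omega>" for x y
  proof (cases "dist x y \<le> s * \<eta> x")
    case True
    have ex: "\<eta> x > 0" by (rule eta_pos[OF that])
    have "0 \<le> ((u x - u y) - (v x - v y))\<^sup>2" by simp
    then have "(u x + v x - (u y + v y))\<^sup>2 \<le> 2 * (u x - u y)\<^sup>2 + 2 * (v x - v y)\<^sup>2"
      by (simp add: power2_eq_square algebra_simps)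
    then have "(u x + v x - (u y + v y))\<^sup>2 / \<eta> x ^ (DIM('a) + 2) \<le> (2 * (u x - u y)\<^sup>2 + 2 * (v x - v y)\<^sup>2) / \<eta> x ^ (DIM('a) + 2)"
      using ex by (intro divide_right_mono) auto
    also have "\<dots> = 2 * ((u x - u y)\<^sup>2 / \<eta> x ^ (DIM('a) + 2)) + 2 * ((v x - v y)\<^sup>2 / \<eta> x ^ (DIM('a) + 2))"
      by (simp add: add_divide_distrib)
    finally have "ennreal ((u x + v x - (u y + v y))\<^sup>2 / \<eta> x ^ (DIM('a) + 2)) \<le>
       ennreal (2 * ((u x - u y)\<^sup>2 / \<eta> x ^ (DIM('a) + 2)) + 2 * ((v x - v y)\<^sup>2 / \<eta> x ^ (DIM('a) + 2)))"
      by (rule ennreal_leI)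
    also have "\<dots> = 2 * ennreal ((u x - u y)\<^sup>2 / \<eta> x ^ (DIM('a) + 2)) + 2 * ennreal ((v x - v y)\<^sup>2 / \<eta> x ^ (DIM('a) + 2))"
      using ex by (intro ennreal_double_add) auto
    finally show ?thesis using True by (simp add: I_def)
  qed (simp add: I_def)
  then have "energy s (\<lambda>x. u x + v x) \<le> (\<integral>\<^sup>+x. \<integral>\<^sup>+y. 2 * I u x y + 2 * I v x y \<partial>M \<partial>M)"
    unfolding energy_def I_def by (intro nn_integral_mono) auto
  also have "\<dots> = (\<integral>\<^sup>+x. 2 * (\<integral>\<^sup>+y. I u x y \<partial>M) + 2 * (\<integral>\<^sup>+y. I v x y \<partial>M) \<partial>M)"
    by (intro nn_integral_cong) (simp add: nn_integral_add nn_integral_cmult)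
  also have "\<dots> = 2 * (\<integral>\<^sup>+x. \<integral>\<^sup>+y. I u x y \<partial>M \<partial>M) + 2 * (\<integral>\<^sup>+x. \<integral>\<^sup>+y. I v x y \<partial>M \<partial>M)"
    by (simp add: nn_integral_add nn_integral_cmult)
  finally show ?thesis unfolding I_def energy_def .
qed

lemma W_norm_sq_eq: "W_norm_sq \<Omega> R \<eta> u = (\<integral>\<^sup>+x. ennreal ((u x)\<^sup>2) \<partial>M) + energy R u"
proof -
  have "(\<integral>\<^sup>+y. ennreal (\<bar>u x - u y\<bar>\<^sup>2 / \<eta> x ^ (DIM('a) + 2)) \<partial>lebesgue_on (\<Omega> \<inter> {y. norm (y - x) \<le> R * \<eta> x}))
    = (\<integral>\<^sup>+y. ennreal (if dist x y \<le> R * \<eta> x then (u x - u y)\<^sup>2 / \<eta> x ^ (DIM('a) + 2) else 0) \<partial>M)" for x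
  proof -
    have "{y. norm (y - x) \<le> R * \<eta> x} = cball x (R * \<eta> x)" by (auto simp: dist_norm norm_minus_commute)
    then have "(\<integral>\<^sup>+y. ennreal (\<bar>u x - u y\<bar>\<^sup>2 / \<eta> x ^ (DIM('a) + 2)) \<partial>lebesgue_on (\<Omega> \<inter> {y. norm (y - x) \<le> R * \<eta> x}))
      = (\<integral>\<^sup>+y. ennreal (\<bar>u x - u y\<bar>\<^sup>2 / \<eta> x ^ (DIM('a) + 2)) * indicator (\<Omega> \<inter> cball x (R * \<eta> x)) y \<partial>lebesgue)"
      using open_domain by (subst nn_integral_restrict_space) auto
    also have "\<dots> = (\<integral>\<^sup>+y. ennreal (if dist x y \<le> R * \<eta> x then (u x - u y)\<^sup>2 / \<eta> x ^ (DIM('a) + 2) else 0) * indicator \<Omega> y \<partial>lebesgue)"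
      by (intro nn_integral_cong) (auto simp: indicator_def)
    also have "\<dots> = (\<integral>\<^sup>+y. ennreal (if dist x y \<le> R * \<eta> x then (u x - u y)\<^sup>2 / \<eta> x ^ (DIM('a) + 2) else 0) \<partial>M)"
      using open_domain by (subst nn_integral_restrict_space) auto
    finally show ?thesis .
  qed
  then show ?thesis unfolding W_norm_sq_def W_seminorm_sq_def energy_def by simp
qed

lemma W_norm_sq_cmult:
  assumes u[measurable]: "u \<in> borel_measurable M"
  shows "W_norm_sq \<Omega> R \<eta> (\<lambda>x. c * u x) = ennreal (c\<^sup>2) * W_norm_sq \<Omega> R \<eta> u"
proof -
  have "(\<integral>\<^sup>+x. ennreal ((c * u x)\<^sup>2) \<partial>M) = (\<integral>\<^sup>+x. ennreal (c\<^sup>2) * ennreal ((u x)\<^sup>2) \<partial>M)"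
    by (simp add: power_mult_distrib ennreal_mult)
  also have "\<dots> = ennreal (c\<^sup>2) * (\<integral>\<^sup>+x. ennreal ((u x)\<^sup>2) \<partial>M)"
    by (rule nn_integral_cmult) measurable
  finally show ?thesis by (simp add: W_norm_sq_eq energy_cmult[OF u] distrib_left)
qed

lemma Cc_infinity_measurable: "\<phi> \<in> Cc_infinity \<Omega> \<Longrightarrow> \<phi> \<in> borel_measurable M"
  by (rule Cc_infinity_bounds[OF open_domain]) auto

lemma W0_cmult:
  assumes u: "u \<in> W0 \<Omega> R \<eta>" and c: "c \<noteq> 0"
  shows "(\<lambda>x. c * u x) \<in> W0 \<Omega> R \<eta>"
  unfolding W0_def
proof (intro CollectI conjI allI impI)
  have um[measurable]: "u \<in> borel_measurable M" using u by (simp add: W0_def)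
  show "(\<lambda>x. c * u x) \<in> borel_measurable M" by measurable
  fix \<epsilon> :: real assume \<epsilon>: "\<epsilon> > 0"
  then have "\<epsilon> / \<bar>c\<bar> > 0" using c by simp
  then obtain \<phi> where \<phi>: "\<phi> \<in> Cc_infinity \<Omega>" "W_norm_sq \<Omega> R \<eta> (\<lambda>x. u x - \<phi> x) < ennreal ((\<epsilon> / \<bar>c\<bar>)\<^sup>2)"
    using u unfolding W0_def by blast
  have [measurable]: "\<phi> \<in> borel_measurable M" by (rule Cc_infinity_measurable[OF \<phi>(1)])
  have "W_norm_sq \<Omega> R \<eta> (\<lambda>x. c * u x - c * \<phi> x) = ennreal (c\<^sup>2) * W_norm_sq \<Omega> R \<eta> (\<lambda>x. u x - \<phi> x)"
    unfolding right_diff_distrib[symmetric] by (rule W_norm_sq_cmult) measurable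
  also have "\<dots> < ennreal (c\<^sup>2) * ennreal ((\<epsilon> / \<bar>c\<bar>)\<^sup>2)"
    using \<phi>(2) c by (intro ennreal_mult_strict_left_mono) auto
  also have "\<dots> = ennreal (\<epsilon>\<^sup>2)"
    using c by (simp add: ennreal_mult[symmetric] power_divide)
  finally show "\<exists>\<phi>\<in>Cc_infinity \<Omega>. W_norm_sq \<Omega> R \<eta> (\<lambda>x. c * u x - \<phi> x) < ennreal (\<epsilon>\<^sup>2)"
    by (rule bexI[OF _ Cc_infinity_cmult[OF \<phi>(1) c]])
qed

lemma L2_nn_integral:
  assumes u: "u \<in> borel_measurable M" and fin: "(\<integral>\<^sup>+x. ennreal ((norm (u x))\<^sup>2) \<partial>M) < \<infinity>"
  shows "u \<in> L2 \<Omega>" "(\<integral>\<^sup>+x. ennreal ((norm (u x))\<^sup>2) \<partial>M) = ennreal ((L2_nrm \<Omega> u)\<^sup>2)"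
proof -
  have i: "integrable M (\<lambda>x. (norm (u x))\<^sup>2)"
    by (rule integrableI_nonneg) (use u fin in auto)
  then show "u \<in> L2 \<Omega>" using u by (simp add: L2_def)
  show "(\<integral>\<^sup>+x. ennreal ((norm (u x))\<^sup>2) \<partial>M) = ennreal ((L2_nrm \<Omega> u)\<^sup>2)"
    unfolding L2_nrm_sq by (rule nn_integral_eq_integral[OF i]) simp
qed

end

section \<open>The kernel and the averaging operator\<close>

text \<open>The kernel is reduced to the three numbers \<open>\<rho>0\<close>, \<open>r0\<close> and
  \<open>B\<close>; the named constants of this locale are built from them and the
  dimension.\<close>

locale nonlocal_problem = localized_domain \<Omega> \<eta> g
  for \<Omega> :: "'a::euclidean_space set" and \<eta> :: "'a \<Rightarrow> real" and g :: "'a \<Rightarrow> 'a" +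
  fixes \<rho> \<rho>' :: "real \<Rightarrow> real" and \<rho>0 r0 B :: real
  assumes rho_deriv: "\<And>r. r \<ge> 0 \<Longrightarrow> (\<rho> has_real_derivative \<rho>' r) (at r within {0..})"
    and rho'_cont: "continuous_on {0..} \<rho>'" and rho'_0: "\<rho>' 0 = 0"
    and rho_measurable[measurable]: "\<rho> \<in> borel_measurable borel"
    and rho_nonneg: "\<And>r. r \<ge> 0 \<Longrightarrow> 0 \<le> \<rho> r"
    and rho_bound: "\<And>r. r \<ge> 0 \<Longrightarrow> \<rho> r \<le> B" "\<And>r. r \<ge> 0 \<Longrightarrow> \<bar>\<rho>' r\<bar> \<le> B"
    and rho_support: "\<And>r. r \<ge> 1 \<Longrightarrow> \<rho> r = 0" "\<And>r. r \<ge> 1 \<Longrightarrow> \<rho>' r = 0"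
    and rho_lower: "0 < \<rho>0" "0 < r0" "r0 \<le> 1" "\<And>r. 0 \<le> r \<Longrightarrow> r \<le> r0 \<Longrightarrow> \<rho>0 \<le> \<rho> r"
begin

section \<open>Size and gradient of the symmetrized kernel\<close>

definition rho_grad :: "'a \<Rightarrow> 'a" where "rho_grad v = \<rho>' (norm v) *\<^sub>R sgn v"

lemma rho_norm_C1: "C1_grad UNIV (\<lambda>v::'a. \<rho> (norm v)) rho_grad"
  unfolding rho_grad_def[abs_def] by (rule C1_grad_radial[OF rho_deriv rho'_cont rho'_0])

lemma B_nonneg: "0 \<le> B"
  using rho_bound(1)[of 0] rho_nonneg[of 0] by simp

lemma norm_rho_grad: "norm (rho_grad v) \<le> B" "norm v \<ge> 1 \<Longrightarrow> rho_grad v = 0"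
  using rho_bound(2)[of "norm v"] B_nonneg rho_support(2)[of "norm v"] by (auto simp: rho_grad_def norm_sgn)

text \<open>One of the two terms of \<open>scaled_kernel\<close> for \<alpha> = 2, localized at the
  first argument, with natural powers instead of \<open>powr\<close>.\<close>

definition ker_half :: "'a \<Rightarrow> 'a \<Rightarrow> real" where
  "ker_half x y = \<rho> (dist x y / \<eta> x) / \<eta> x ^ (DIM('a) + 2)"

definition ker :: "'a \<Rightarrow> 'a \<Rightarrow> real" where
  "ker x y = (ker_half x y + ker_half y x) / 2"

text \<open>Gradient in \<open>x\<close>. Since \<open>x\<close> also determines the radius
  \<open>\<eta> x\<close>, two terms with \<open>g x\<close> join the derivative of the profile, one
  from the rescaled argument and one from the prefactor. In \<open>ker_half_grad_swap\<close> the
  radius is \<open>\<eta> y\<close>, and only the profile is differentiated.\<close>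

definition ker_half_grad :: "'a \<Rightarrow> 'a \<Rightarrow> 'a" where
  "ker_half_grad x y = (1 / \<eta> x ^ (DIM('a) + 2)) *\<^sub>R ((1 / \<eta> x) *\<^sub>R rho_grad ((1 / \<eta> x) *\<^sub>R (x - y)) - ((rho_grad ((1 / \<eta> x) *\<^sub>R (x - y)) \<bullet> (x - y)) / (\<eta> x)\<^sup>2) *\<^sub>R g x)
     - (real (DIM('a) + 2) * \<rho> (norm ((1 / \<eta> x) *\<^sub>R (x - y))) / \<eta> x ^ (DIM('a) + 3)) *\<^sub>R g x"

definition ker_half_grad_swap :: "'a \<Rightarrow> 'a \<Rightarrow> 'a" where
  "ker_half_grad_swap x y = (1 / \<eta> y ^ (DIM('a) + 3)) *\<^sub>R rho_grad ((1 / \<eta> y) *\<^sub>R (x - y))"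

definition ker_grad :: "'a \<Rightarrow> 'a \<Rightarrow> 'a" where
  "ker_grad x y = (1/2) *\<^sub>R (ker_half_grad x y + ker_half_grad_swap x y)"

lemma ker_sym: "ker x y = ker y x"
  by (simp add: ker_def)

lemma ker_measurable[measurable (raw)]:
  assumes [measurable]: "p \<in> N \<rightarrow>\<^sub>M M" "q \<in> N \<rightarrow>\<^sub>M M"
  shows "(\<lambda>w. ker (p w) (q w)) \<in> borel_measurable N"
  unfolding ker_def ker_half_def by measurable

lemma ker_half_bounds:
  assumes "x \<in> \<Omega>"
  shows "0 \<le> ker_half x y" "ker_half x y \<le> B / \<eta> x ^ (DIM('a) + 2)" "dist x y \<ge> \<eta> x \<Longrightarrow> ker_half x y = 0"
  using eta_pos[OF assms] rho_nonneg[of "dist x y / \<eta> x"] rho_bound(1)[of "dist x y / \<eta> x"] rho_support(1)[of "dist x y / \<eta> x"]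
  by (auto simp: ker_half_def intro!: divide_right_mono)

lemma eta_power_near:
  assumes "x \<in> \<Omega>" "y \<in> \<Omega>" "near x y"
  shows "1 / \<eta> y ^ m \<le> (3/2) ^ m / \<eta> x ^ m"
proof -
  have e: "\<eta> x > 0" "\<eta> y > 0" using eta_pos assms by auto
  have "\<eta> x ^ m \<le> (3/2 * \<eta> y) ^ m" using near_comparable(1)[OF assms] e by (intro power_mono) auto
  then have "\<eta> x ^ m \<le> (3/2) ^ m * \<eta> y ^ m" by (simp only: power_mult_distrib)
  then show ?thesis using e by (simp add: divide_simps mult.commute)
qed

lemma ker_nonneg: "x \<in> \<Omega> \<Longrightarrow> y \<in> \<Omega> \<Longrightarrow> 0 \<le> ker x y"
  using ker_half_bounds(1)[of x y] ker_half_bounds(1)[of y x] by (simp add: ker_def)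

lemma ker_far: "x \<in> \<Omega> \<Longrightarrow> y \<in> \<Omega> \<Longrightarrow> \<not> near x y \<Longrightarrow> ker x y = 0"
  using ker_half_bounds(3)[of x y] ker_half_bounds(3)[of y x] by (simp add: ker_def near_def dist_commute)

lemma one_le_pow: "1 \<le> (3/2::real) ^ m"
  by simp

text \<open>The half localized at \<open>y\<close> has to be rewritten in powers of
  \<open>\<eta> x\<close>; this costs the factor (3/2)^(d + 2) and is possible because the kernel
  vanishes unless \<open>near x y\<close>.\<close>

lemma ker_bound:
  assumes "x \<in> \<Omega>" "y \<in> \<Omega>"
  shows "ker x y \<le> B * (3/2) ^ (DIM('a) + 2) / \<eta> x ^ (DIM('a) + 2)"
proof (cases "near x y")
  case False
  then show ?thesis using ker_far[OF assms] eta_pos[OF assms(1)] B_nonneg by simp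
next
  case True
  have ex: "\<eta> x > 0" using eta_pos assms by auto
  define c where "c = B * ((3/2) ^ (DIM('a) + 2) / \<eta> x ^ (DIM('a) + 2))"
  have "ker_half x y \<le> B * (1 / \<eta> x ^ (DIM('a) + 2))" using ker_half_bounds(2)[OF assms(1)] by simp
  also have "\<dots> \<le> c" unfolding c_def
    by (intro mult_left_mono divide_right_mono one_le_pow) (use ex B_nonneg in auto)
  finally have 1: "ker_half x y \<le> c" .
  have "ker_half y x \<le> B * (1 / \<eta> y ^ (DIM('a) + 2))" using ker_half_bounds(2)[OF assms(2)] by simp
  also have "\<dots> \<le> c" unfolding c_def
    by (intro mult_left_mono eta_power_near assms True B_nonneg)
  finally have 2: "ker_half y x \<le> c" .
  have "ker x y \<le> (c + c) / 2" unfolding ker_def by (intro divide_right_mono add_mono 1 2) simp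
  then have "ker x y \<le> c" by simp
  then show ?thesis unfolding c_def times_divide_eq_right .
qed

lemma ker_C1:
  assumes y: "y \<in> \<Omega>"
  shows "C1_grad \<Omega> (\<lambda>x. ker x y) (\<lambda>x. ker_grad x y)"
proof -
  note e = C1_gradD[OF eta_C1]
  note R = C1_gradD[OF rho_norm_C1]
  have ey: "\<eta> y > 0" by (rule eta_pos[OF y])
  have ne: "\<eta> x \<noteq> 0" if "x \<in> \<Omega>" for x using eta_pos[OF that] by simp
  have c\<eta>: "continuous_on \<Omega> (\<lambda>x. (1 / \<eta> x) *\<^sub>R (x - y))"
    by (intro continuous_intros e ballI ne)
  have crq: "continuous_on \<Omega> (\<lambda>x. rho_grad ((1 / \<eta> x) *\<^sub>R (x - y)))"
    by (rule continuous_on_compose2[OF R(2) c\<eta>]) simp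
  have c\<rho>: "continuous_on \<Omega> (\<lambda>x. \<rho> (norm ((1 / \<eta> x) *\<^sub>R (x - y))))"
    by (rule continuous_on_compose2[OF R(3) c\<eta>]) simp
  have cK: "continuous_on \<Omega> (\<lambda>x. ker_grad x y)"
    unfolding ker_grad_def ker_half_grad_def ker_half_grad_swap_def
    by (intro continuous_intros crq c\<rho> e continuous_on_compose2[OF R(2), of _ "\<lambda>x. (1 / \<eta> y) *\<^sub>R (x - y)"] ballI)
      (auto simp: ne ey)
  have "((\<lambda>x. ker x y) has_derivative (\<lambda>h. ker_grad x y \<bullet> h)) (at x)" if x: "x \<in> \<Omega>" for x
  proof -
    have ex: "\<eta> x > 0" by (rule eta_pos[OF x])
    let ?w = "(1 / \<eta> x) *\<^sub>R (x - y)"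
    have dw: "((\<lambda>x. (1 / \<eta> x) *\<^sub>R (x - y)) has_derivative (\<lambda>h. (1 / \<eta> x) *\<^sub>R h - ((g x \<bullet> h) / (\<eta> x)\<^sup>2) *\<^sub>R (x - y))) (at x)"
      using ex by (auto intro!: derivative_eq_intros e(1)[OF x] simp: power2_eq_square field_simps)
    have dr: "((\<lambda>x. \<rho> (norm ((1 / \<eta> x) *\<^sub>R (x - y)))) has_derivative (\<lambda>h. rho_grad ?w \<bullet> ((1 / \<eta> x) *\<^sub>R h - ((g x \<bullet> h) / (\<eta> x)\<^sup>2) *\<^sub>R (x - y)))) (at x)"
      by (rule has_derivative_compose[OF dw R(1)[OF UNIV_I]])
    have dp: "((\<lambda>x. 1 / \<eta> x ^ (DIM('a) + 2)) has_derivative (\<lambda>h. - (real (DIM('a) + 2) / \<eta> x ^ (DIM('a) + 3)) * (g x \<bullet> h))) (at x)"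
    proof -
      let ?m = "DIM('a) + 2"
      have "C1_grad \<Omega> (\<lambda>x. inverse (\<eta> x ^ ?m)) (\<lambda>x. - (inverse (\<eta> x ^ ?m))\<^sup>2 *\<^sub>R ((real ?m * \<eta> x ^ (?m - 1)) *\<^sub>R g x))"
        by (rule C1_grad_inverse[OF C1_grad_power[OF eta_C1]]) (use ne in simp)
      from C1_gradD(1)[OF this x]
      have "((\<lambda>x. 1 / \<eta> x ^ ?m) has_derivative (\<lambda>h. - (inverse (\<eta> x ^ ?m))\<^sup>2 *\<^sub>R ((real ?m * \<eta> x ^ (?m - 1)) *\<^sub>R g x) \<bullet> h)) (at x)"
        by (simp only: inverse_eq_divide)
      moreover have "(inverse (\<eta> x ^ ?m))\<^sup>2 * (real ?m * \<eta> x ^ (?m - 1)) = real ?m / \<eta> x ^ (DIM('a) + 3)"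
        using ex by (simp add: power2_eq_square field_simps eval_nat_numeral)
      ultimately show ?thesis by (simp add: mult.assoc[symmetric])
    qed
    have 1: "((\<lambda>x. ker_half x y) has_derivative (\<lambda>h. ker_half_grad x y \<bullet> h)) (at x)"
    proof -
      have "((\<lambda>x. \<rho> (norm ((1 / \<eta> x) *\<^sub>R (x - y))) * (1 / \<eta> x ^ (DIM('a) + 2))) has_derivative (\<lambda>h. ker_half_grad x y \<bullet> h)) (at x)"
      proof (rule has_derivative_eq_rhs[OF has_derivative_mult[OF dr dp]])
        have "p * (- (real (DIM('a) + 2) / \<eta> x ^ (DIM('a) + 3)) * (g x \<bullet> h)) +
            r \<bullet> ((1 / \<eta> x) *\<^sub>R h - (g x \<bullet> h / (\<eta> x)\<^sup>2) *\<^sub>R v) * (1 / \<eta> x ^ (DIM('a) + 2)) =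
          ((1 / \<eta> x ^ (DIM('a) + 2)) *\<^sub>R ((1 / \<eta> x) *\<^sub>R r - ((r \<bullet> v) / (\<eta> x)\<^sup>2) *\<^sub>R g x)
           - (real (DIM('a) + 2) * p / \<eta> x ^ (DIM('a) + 3)) *\<^sub>R g x) \<bullet> h" for p and r v h :: 'a
          by (simp add: inner_diff_left inner_diff_right algebra_simps diff_divide_distrib)
        then show "(\<lambda>h. \<rho> (norm ?w) * (- (real (DIM('a) + 2) / \<eta> x ^ (DIM('a) + 3)) * (g x \<bullet> h)) +
            rho_grad ?w \<bullet> ((1 / \<eta> x) *\<^sub>R h - (g x \<bullet> h / (\<eta> x)\<^sup>2) *\<^sub>R (x - y)) * (1 / \<eta> x ^ (DIM('a) + 2))) = (\<lambda>h. ker_half_grad x y \<bullet> h)"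
          unfolding ker_half_grad_def by blast
      qed
      then show ?thesis
      proof (rule has_derivative_transform_within_open[OF _ open_domain x])
        fix z assume "z \<in> \<Omega>"
        then have "\<eta> z > 0" by (rule eta_pos)
        then show "\<rho> (norm ((1 / \<eta> z) *\<^sub>R (z - y))) * (1 / \<eta> z ^ (DIM('a) + 2)) = ker_half z y"
          by (simp add: ker_half_def dist_norm)
      qed
    qed
    have 2: "((\<lambda>x. ker_half y x) has_derivative (\<lambda>h. ker_half_grad_swap x y \<bullet> h)) (at x)"
    proof -
      have "((\<lambda>x. (1 / \<eta> y) *\<^sub>R (x - y)) has_derivative (\<lambda>h. (1 / \<eta> y) *\<^sub>R h)) (at x)"
        by (auto intro!: derivative_eq_intros)
      from has_derivative_compose[OF this R(1)[OF UNIV_I]]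
      have "((\<lambda>x. \<rho> (norm ((1 / \<eta> y) *\<^sub>R (x - y)))) has_derivative (\<lambda>h. rho_grad ((1 / \<eta> y) *\<^sub>R (x - y)) \<bullet> ((1 / \<eta> y) *\<^sub>R h))) (at x)" .
      then have "((\<lambda>x. \<rho> (norm ((1 / \<eta> y) *\<^sub>R (x - y))) * (1 / \<eta> y ^ (DIM('a) + 2))) has_derivative
         (\<lambda>h. (rho_grad ((1 / \<eta> y) *\<^sub>R (x - y)) \<bullet> ((1 / \<eta> y) *\<^sub>R h)) * (1 / \<eta> y ^ (DIM('a) + 2)))) (at x)"
        by (rule has_derivative_mult_left)
      moreover have "\<rho> (norm ((1 / \<eta> y) *\<^sub>R (x - y))) * (1 / \<eta> y ^ (DIM('a) + 2)) = ker_half y x" for x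
        using ey by (simp add: ker_half_def dist_norm norm_minus_commute)
      moreover have "(rho_grad ((1 / \<eta> y) *\<^sub>R (x - y)) \<bullet> ((1 / \<eta> y) *\<^sub>R h)) * (1 / \<eta> y ^ (DIM('a) + 2)) = ker_half_grad_swap x y \<bullet> h" for h
        using ey by (simp add: ker_half_grad_swap_def field_simps eval_nat_numeral)
      ultimately show ?thesis by simp
    qed
    have "((\<lambda>x. 1 / 2 * (ker_half x y + ker_half y x)) has_derivative (\<lambda>h. 1 / 2 * (ker_half_grad x y \<bullet> h + ker_half_grad_swap x y \<bullet> h))) (at x)"
      by (intro has_derivative_mult_right has_derivative_add 1 2)
    then show ?thesis by (simp add: ker_def ker_grad_def inner_add_left)
  qed
  with cK show ?thesis by (simp add: C1_grad_def)
qed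

text \<open>The summand d + 4 consists of 2 from the profile with its moving argument and d + 2 from
  the prefactor. The power of 3/2 belongs to the half localized at \<open>y\<close>, whose powers of
  \<open>\<eta> y\<close> are rewritten in \<open>\<eta> x\<close>.\<close>

definition ker_grad_const :: real where
  "ker_grad_const = B * (real DIM('a) + 4 + (3/2) ^ (DIM('a) + 3))"

lemma ker_grad_const_nonneg: "ker_grad_const \<ge> 0"
  using B_nonneg by (simp add: ker_grad_const_def)

lemma ker_grad_far:
  assumes x: "x \<in> \<Omega>" and y: "y \<in> \<Omega>" and "\<not> near x y"
  shows "ker_grad x y = 0"
proof -
  have e: "\<eta> x > 0" "\<eta> y > 0" using eta_pos x y by auto
  have f: "norm (x - y) \<ge> \<eta> x" "norm (x - y) \<ge> \<eta> y" using assms(3) by (auto simp: near_def dist_norm)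
  then have n: "norm ((1 / \<eta> x) *\<^sub>R (x - y)) \<ge> 1" "norm ((1 / \<eta> y) *\<^sub>R (x - y)) \<ge> 1"
    using e by auto
  then have "rho_grad ((1 / \<eta> x) *\<^sub>R (x - y)) = 0" "rho_grad ((1 / \<eta> y) *\<^sub>R (x - y)) = 0" "\<rho> (norm ((1 / \<eta> x) *\<^sub>R (x - y))) = 0"
    using norm_rho_grad(2) rho_support(1) by blast+
  then show ?thesis unfolding ker_grad_def ker_half_grad_def ker_half_grad_swap_def by (simp only: scaleR_zero_right inner_zero_left mult_zero_right div_0 scaleR_zero_left diff_zero add_0_right)
qed

lemma ker_grad_bound:
  assumes x: "x \<in> \<Omega>" and y: "y \<in> \<Omega>"
  shows "norm (ker_grad x y) \<le> ker_grad_const / \<eta> x ^ (DIM('a) + 3)"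
proof (cases "near x y")
  case False
  then show ?thesis using ker_grad_far[OF x y] eta_pos[OF x] ker_grad_const_nonneg by simp
next
  case True
  have ex: "\<eta> x > 0" and ey: "\<eta> y > 0" using eta_pos x y by auto
  let ?n = "DIM('a)" and ?w = "(1 / \<eta> x) *\<^sub>R (x - y)"
  \<comment> \<open>The factor \<open>x - y\<close> costs at most \<open>\<eta> x\<close>, because
    \<open>rho_grad\<close> vanishes once the distance reaches that radius.\<close>
  have inner: "\<bar>rho_grad ?w \<bullet> (x - y)\<bar> \<le> B * \<eta> x"
  proof (cases "norm ?w \<ge> 1")
    case False
    moreover have "norm ?w = norm (x - y) / \<eta> x" using ex by simp
    ultimately have "norm (x - y) \<le> \<eta> x" using ex by (simp only:) (simp add: divide_simps)
    then have "norm (rho_grad ?w) * norm (x - y) \<le> B * \<eta> x"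
      using norm_rho_grad(1)[of ?w] B_nonneg by (intro mult_mono) auto
    then show ?thesis using Cauchy_Schwarz_ineq2 order_trans by blast
  next
    case True
    then show ?thesis using norm_rho_grad(2)[OF True] B_nonneg ex by simp
  qed
  have t1: "norm ((1 / \<eta> x) *\<^sub>R rho_grad ?w) \<le> B / \<eta> x"
    using norm_rho_grad(1)[of ?w] ex by (simp add: divide_right_mono)
  have t2: "norm (((rho_grad ?w \<bullet> (x - y)) / (\<eta> x)\<^sup>2) *\<^sub>R g x) \<le> B / \<eta> x"
  proof -
    have "\<bar>rho_grad ?w \<bullet> (x - y)\<bar> / (\<eta> x)\<^sup>2 * norm (g x) \<le> (B * \<eta> x) / (\<eta> x)\<^sup>2 * 1"
      using inner ex B_nonneg grad_eta[OF x] by (intro mult_mono divide_right_mono) auto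
    then show ?thesis using ex by (simp add: power2_eq_square)
  qed
  have "norm ((1 / \<eta> x) *\<^sub>R rho_grad ?w - ((rho_grad ?w \<bullet> (x - y)) / (\<eta> x)\<^sup>2) *\<^sub>R g x) \<le> 2 * B / \<eta> x"
    using norm_triangle_ineq4[of "(1 / \<eta> x) *\<^sub>R rho_grad ?w" "((rho_grad ?w \<bullet> (x - y)) / (\<eta> x)\<^sup>2) *\<^sub>R g x"] t1 t2
    by linarith
  then have "1 / \<eta> x ^ (?n + 2) * norm ((1 / \<eta> x) *\<^sub>R rho_grad ?w - ((rho_grad ?w \<bullet> (x - y)) / (\<eta> x)\<^sup>2) *\<^sub>R g x) \<le> 1 / \<eta> x ^ (?n + 2) * (2 * B / \<eta> x)"
    using ex by (intro mult_left_mono) auto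
  also have "\<dots> = 2 * B / \<eta> x ^ (?n + 3)" by (simp add: eval_nat_numeral)
  finally have s1: "norm ((1 / \<eta> x ^ (?n + 2)) *\<^sub>R ((1 / \<eta> x) *\<^sub>R rho_grad ?w - ((rho_grad ?w \<bullet> (x - y)) / (\<eta> x)\<^sup>2) *\<^sub>R g x)) \<le> 2 * B / \<eta> x ^ (?n + 3)"
    using ex by simp
  have s2: "norm ((real (?n + 2) * \<rho> (norm ?w) / \<eta> x ^ (?n + 3)) *\<^sub>R g x) \<le> real (?n + 2) * B / \<eta> x ^ (?n + 3)"
  proof -
    have "\<bar>real (?n + 2) * \<rho> (norm ?w) / \<eta> x ^ (?n + 3)\<bar> * norm (g x) \<le> (real (?n + 2) * B / \<eta> x ^ (?n + 3)) * 1"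
    proof (intro mult_mono)
      have "real (?n + 2) * \<rho> (norm ?w) / \<eta> x ^ (?n + 3) \<le> real (?n + 2) * B / \<eta> x ^ (?n + 3)"
        using ex rho_bound(1)[of "norm ?w"] by (intro divide_right_mono mult_left_mono) auto
      moreover have "real (?n + 2) * \<rho> (norm ?w) / \<eta> x ^ (?n + 3) \<ge> 0"
        using ex rho_nonneg[of "norm ?w"] by (intro divide_nonneg_nonneg mult_nonneg_nonneg) auto
      ultimately show "\<bar>real (?n + 2) * \<rho> (norm ?w) / \<eta> x ^ (?n + 3)\<bar> \<le> real (?n + 2) * B / \<eta> x ^ (?n + 3)"
        by linarith
    qed (use grad_eta[OF x] ex B_nonneg in auto)
    then show ?thesis by simp
  qed
  have s3: "norm (ker_half_grad_swap x y) \<le> B * (3/2) ^ (?n + 3) / \<eta> x ^ (?n + 3)"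
  proof -
    have "norm (ker_half_grad_swap x y) = 1 / \<eta> y ^ (?n + 3) * norm (rho_grad ((1 / \<eta> y) *\<^sub>R (x - y)))"
      using ey by (simp add: ker_half_grad_swap_def)
    also have "\<dots> \<le> ((3/2) ^ (?n + 3) / \<eta> x ^ (?n + 3)) * B"
      using eta_power_near[OF x y True, of "?n + 3"] norm_rho_grad(1) ex by (intro mult_mono) auto
    finally show ?thesis by (simp add: mult.commute)
  qed
  have "norm (ker_half_grad x y) \<le> 2 * B / \<eta> x ^ (?n + 3) + real (?n + 2) * B / \<eta> x ^ (?n + 3)"
    unfolding ker_half_grad_def using norm_triangle_ineq4 s1 s2 by (smt (verit))
  then have "norm (ker_half_grad x y + ker_half_grad_swap x y) \<le> 2 * B / \<eta> x ^ (?n + 3) + real (?n + 2) * B / \<eta> x ^ (?n + 3) + B * (3/2) ^ (?n + 3) / \<eta> x ^ (?n + 3)"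
    using norm_triangle_ineq[of "ker_half_grad x y" "ker_half_grad_swap x y"] s3 by linarith
  also have "\<dots> = ker_grad_const / \<eta> x ^ (?n + 3)"
    by (simp add: ker_grad_const_def add_divide_distrib algebra_simps)
  finally have "norm (ker_half_grad x y + ker_half_grad_swap x y) \<le> ker_grad_const / \<eta> x ^ (?n + 3)" .
  moreover have "0 \<le> ker_grad_const / \<eta> x ^ (?n + 3)" using ker_grad_const_nonneg ex by simp
  moreover have "norm (ker_grad x y) = norm (ker_half_grad x y + ker_half_grad_swap x y) / 2" by (simp add: ker_grad_def)
  ultimately show ?thesis by linarith
qed

lemma ker_grad_measurable:
  assumes x: "x \<in> \<Omega>"
  shows "(\<lambda>y. ker_grad x y) \<in> borel_measurable M"
proof (rule borel_measurable_lebesgue_on_continuous[OF open_domain])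
  note e = C1_gradD[OF eta_C1]
  note R = C1_gradD[OF rho_norm_C1]
  have ne: "\<eta> x \<noteq> 0" if "x \<in> \<Omega>" for x using eta_pos[OF that] by simp
  show "continuous_on \<Omega> (\<lambda>y. ker_grad x y)"
    unfolding ker_grad_def ker_half_grad_def ker_half_grad_swap_def
    by (intro continuous_intros e continuous_on_compose2[OF R(2)] continuous_on_compose2[OF R(3), of _ "\<lambda>y. (1 / \<eta> x) *\<^sub>R (x - y)"] ballI)
      (auto simp: ne x)
qed

section \<open>The integral operator and the mass of the kernel\<close>

lemma eta_ball:
  assumes "x0 \<in> \<Omega>" "x \<in> ball x0 (\<eta> x0)"
  shows "x \<in> \<Omega>" "\<eta> x0 \<le> 3/2 * \<eta> x"
  using eta_lipschitz[OF assms(1), of x] assms(2) by (auto simp: abs_if split: if_splits)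

definition ker_op :: "('a \<Rightarrow> real) \<Rightarrow> 'a \<Rightarrow> real" where
  "ker_op w x = (LINT y|M. ker x y * w y)"

definition ker_op_grad :: "('a \<Rightarrow> real) \<Rightarrow> 'a \<Rightarrow> 'a" where
  "ker_op_grad w x = (LINT y|M. w y *\<^sub>R ker_grad x y)"

lemma ker_section_measurable:
  assumes "x \<in> \<Omega>"
  shows "(\<lambda>y. ker x y) \<in> borel_measurable M"
proof -
  have [measurable]: "x \<in> space M" using assms by simp
  show ?thesis by measurable
qed

lemma ker_mult_integrable:
  assumes x: "x \<in> \<Omega>" and w: "integrable M w"
  shows "integrable M (\<lambda>y. ker x y * w y)"
proof -
  have "\<bar>ker x y\<bar> \<le> B * (3/2) ^ (DIM('a) + 2) / \<eta> x ^ (DIM('a) + 2)" if "y \<in> space M" for y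
    using ker_bound[OF x, of y] ker_nonneg[OF x, of y] that by simp
  from integrable_mult_bounded[OF w ker_section_measurable[OF x] this]
  show ?thesis by (simp add: mult.commute)
qed

lemma ker_grad_scaleR_integrable:
  assumes x: "x \<in> \<Omega>" and w: "integrable M w"
  shows "integrable M (\<lambda>y. w y *\<^sub>R ker_grad x y)"
proof (rule Bochner_Integration.integrable_bound)
  show "integrable M (\<lambda>y. ker_grad_const / \<eta> x ^ (DIM('a) + 3) * w y)" using w by simp
  show "AE y in M. norm (w y *\<^sub>R ker_grad x y) \<le> norm (ker_grad_const / \<eta> x ^ (DIM('a) + 3) * w y)"
  proof (rule AE_I2)
    fix y assume "y \<in> space M"
    then have "norm (ker_grad x y) \<le> ker_grad_const / \<eta> x ^ (DIM('a) + 3)" using ker_grad_bound[OF x, of y] by simp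
    then have "norm (ker_grad x y) \<le> \<bar>ker_grad_const / \<eta> x ^ (DIM('a) + 3)\<bar>" by linarith
    then have "\<bar>w y\<bar> * norm (ker_grad x y) \<le> \<bar>w y\<bar> * \<bar>ker_grad_const / \<eta> x ^ (DIM('a) + 3)\<bar>"
      by (rule mult_left_mono) simp
    then show "norm (w y *\<^sub>R ker_grad x y) \<le> norm (ker_grad_const / \<eta> x ^ (DIM('a) + 3) * w y)"
      by (simp only: norm_scaleR real_norm_def abs_mult mult.commute)
  qed
qed (use w ker_grad_measurable[OF x] in auto)

text \<open>The function \<open>w\<close> is only integrable and is never differentiated. The bounds
  on the kernel deteriorate at the boundary, so differentiability and continuity are checked on
  balls \<open>ball x0 (\<eta> x0)\<close>, where \<open>\<eta>\<close> is bounded below by a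
  multiple of its value at the centre.\<close>

lemma ker_op_C1:
  assumes w: "integrable M w"
  shows "C1_grad \<Omega> (ker_op w) (ker_op_grad w)"
proof -
  have bd: "norm (ker_grad x y) \<le> ker_grad_const * (3/2) ^ (DIM('a) + 3) / \<eta> x0 ^ (DIM('a) + 3)"
    if x0: "x0 \<in> \<Omega>" and x: "x \<in> ball x0 (\<eta> x0)" and y: "y \<in> space M" for x0 x y
  proof -
    have e: "\<eta> x0 > 0" "\<eta> x > 0" using eta_pos x0 eta_ball(1)[OF x0 x] by auto
    have "norm (ker_grad x y) \<le> ker_grad_const * (1 / \<eta> x ^ (DIM('a) + 3))" using ker_grad_bound[OF eta_ball(1)[OF x0 x], of y] y by simp
    also have "1 / \<eta> x ^ (DIM('a) + 3) \<le> (3/2) ^ (DIM('a) + 3) / \<eta> x0 ^ (DIM('a) + 3)"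
    proof -
      have "\<eta> x0 ^ (DIM('a) + 3) \<le> (3/2 * \<eta> x) ^ (DIM('a) + 3)" using eta_ball(2)[OF x0 x] e by (intro power_mono) auto
      then have "\<eta> x0 ^ (DIM('a) + 3) \<le> (3/2) ^ (DIM('a) + 3) * \<eta> x ^ (DIM('a) + 3)" by (simp only: power_mult_distrib)
      then show ?thesis using e by (simp add: divide_simps mult.commute)
    qed
    finally show ?thesis using ker_grad_const_nonneg by (simp add: mult_left_mono)
  qed
  have "(ker_op w has_derivative (\<lambda>h. ker_op_grad w x0 \<bullet> h)) (at x0)" if x0: "x0 \<in> \<Omega>" for x0
    unfolding ker_op_def[abs_def] ker_op_grad_def
  proof (rule has_derivative_param_integral[OF eta_pos[OF x0]])
    show "((\<lambda>x. ker x y) has_derivative (\<lambda>h. ker_grad x y \<bullet> h)) (at x)" if "x \<in> ball x0 (\<eta> x0)" "y \<in> space M" for x y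
      using C1_gradD(1)[OF ker_C1] eta_ball(1)[OF x0 that(1)] that(2) by simp
  qed (use bd[OF x0] w ker_mult_integrable[OF eta_ball(1)[OF x0] w] ker_grad_measurable[OF x0] in \<open>auto\<close>)
  moreover have "isCont (ker_op_grad w) x0" if x0: "x0 \<in> \<Omega>" for x0
    unfolding ker_op_grad_def[abs_def]
  proof (rule isCont_param_integral[OF eta_pos[OF x0]])
    show "isCont (\<lambda>x. ker_grad x y) x0" if "y \<in> space M" for y
      using C1_gradD(2)[OF ker_C1, of y] that x0 open_domain by (simp add: continuous_on_eq_continuous_at)
  qed (use bd[OF x0] w ker_grad_measurable[OF eta_ball(1)[OF x0]] in \<open>auto\<close>)
  ultimately show ?thesis
    unfolding C1_grad_def by (simp add: continuous_at_imp_continuous_on)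
qed

definition phi :: "'a \<Rightarrow> real" where "phi = ker_op (\<lambda>y. 1)"
definition phi_grad :: "'a \<Rightarrow> 'a" where "phi_grad = ker_op_grad (\<lambda>y. 1)"

definition phi_const :: real where "phi_const = \<rho>0 * unit_ball_vol (real DIM('a)) * r0 ^ DIM('a) / 2"
definition ker_const :: real where "ker_const = B * (3/2) ^ (DIM('a) + 2)"
definition phi_grad_const :: real where "phi_grad_const = ker_grad_const * unit_ball_vol (real DIM('a)) * (3/2) ^ DIM('a)"

lemma vol_pos: "unit_ball_vol (real DIM('a)) > 0" "unit_ball_vol (real DIM('a)) \<noteq> 0"
  using unit_ball_vol_pos[of "real DIM('a)"] by linarith+

lemma const_pos: "phi_const > 0" "ker_const \<ge> 0" "phi_grad_const \<ge> 0"
  using rho_lower vol_pos B_nonneg ker_grad_const_nonneg by (auto simp: phi_const_def ker_const_def phi_grad_const_def)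

text \<open>The half of the kernel localized at \<open>x\<close> already has this mass: it is
  bounded below on a ball of radius \<open>r0 * \<eta> x\<close>, and this ball lies in
  \<open>\<Omega>\<close> even near the boundary. The two powers of \<open>\<eta>\<close> gained in
  \<open>inverse (phi x)\<close> pay for differentiating the kernel.\<close>

lemma phi_lower:
  assumes x: "x \<in> \<Omega>"
  shows "phi_const / (\<eta> x)\<^sup>2 \<le> phi x"
proof -
  let ?V = "unit_ball_vol (real DIM('a))"
  have ex: "\<eta> x > 0" by (rule eta_pos[OF x])
  have [measurable]: "x \<in> space M" using x by simp
  define c where "c = \<rho>0 / (2 * \<eta> x ^ (DIM('a) + 2))"
  have c: "c > 0" using ex rho_lower by (simp add: c_def)
  have r0\<eta>: "r0 * \<eta> x \<le> \<eta> x" "r0 * \<eta> x > 0" using rho_lower ex by auto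
  have sub: "cball x (r0 * \<eta> x) \<subseteq> \<Omega>" using cball_eta_subset[OF x] r0\<eta> by auto
  have i: "integrable M (\<lambda>y. ker x y)" using ker_mult_integrable[OF x, of "\<lambda>y. 1"] by simp
  have "ennreal (phi_const / (\<eta> x)\<^sup>2) = ennreal (c * (?V * (r0 * \<eta> x) ^ DIM('a)))"
    using ex by (intro arg_cong[where f = ennreal]) (simp add: c_def phi_const_def power_mult_distrib power_add power2_eq_square)
  also have "\<dots> = (\<integral>\<^sup>+y. ennreal (if dist x y \<le> r0 * \<eta> x then c else 0) \<partial>M)"
    using c r0\<eta> sub by (intro nn_integral_ball_eq[symmetric]) auto
  also have "\<dots> \<le> (\<integral>\<^sup>+y. ennreal (ker x y) \<partial>M)"
  proof (rule nn_integral_mono)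
    fix y assume "y \<in> space M"
    then have y: "y \<in> \<Omega>" by simp
    have "c \<le> ker x y" if "dist x y \<le> r0 * \<eta> x"
    proof -
      have "dist x y / \<eta> x \<le> r0" using that ex by (simp add: divide_simps mult.commute)
      then have "\<rho>0 \<le> \<rho> (dist x y / \<eta> x)" using ex by (intro rho_lower(4)) auto
      then have "\<rho>0 / \<eta> x ^ (DIM('a) + 2) \<le> ker_half x y" unfolding ker_half_def using ex by (intro divide_right_mono) auto
      then have "\<rho>0 / \<eta> x ^ (DIM('a) + 2) / 2 \<le> (ker_half x y + ker_half y x) / 2" using ker_half_bounds(1)[OF y, of x] by (intro divide_right_mono) auto
      then show ?thesis by (simp add: c_def ker_def mult.commute)
    qed
    then show "ennreal (if dist x y \<le> r0 * \<eta> x then c else 0) \<le> ennreal (ker x y)" by (auto intro: ennreal_leI)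
  qed
  also have "\<dots> = ennreal (phi x)"
  proof -
    have "(\<integral>\<^sup>+y. ennreal (ker x y) \<partial>M) = ennreal (LINT y|M. ker x y)"
      by (rule nn_integral_eq_integral[OF i]) (auto intro!: AE_I2 ker_nonneg[OF x])
    then show ?thesis by (simp add: phi_def ker_op_def)
  qed
  finally show ?thesis
  proof (subst (asm) ennreal_le_iff)
    show "0 \<le> phi x" unfolding phi_def ker_op_def using ker_nonneg[OF x] by (intro integral_nonneg_AE AE_I2) auto
  qed
qed

lemma phi_pos: "x \<in> \<Omega> \<Longrightarrow> phi x > 0"
  using phi_lower[of x] const_pos(1) eta_pos[of x] by (smt (verit) divide_pos_pos zero_less_power)

lemma inverse_phi:
  assumes "x \<in> \<Omega>"
  shows "0 < inverse (phi x)" "inverse (phi x) \<le> (\<eta> x)\<^sup>2 / phi_const"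
proof -
  have "inverse (phi x) \<le> inverse (phi_const / (\<eta> x)\<^sup>2)"
    using phi_lower[OF assms] const_pos(1) eta_pos[OF assms] by (intro le_imp_inverse_le) auto
  then show "inverse (phi x) \<le> (\<eta> x)\<^sup>2 / phi_const" by simp
qed (use phi_pos[OF assms] in simp)

lemma phi_C1: "C1_grad \<Omega> phi phi_grad"
  unfolding phi_def phi_grad_def by (rule ker_op_C1) simp

text \<open>The volume \<eta>^d of the interaction region meets the size \<eta>^-(d + 3) of the
  gradient, so differentiation costs one power beyond the \<eta>^-2 of \<open>phi\<close>.\<close>

lemma phi_grad_bound:
  assumes x: "x \<in> \<Omega>"
  shows "norm (phi_grad x) \<le> phi_grad_const / \<eta> x ^ 3"
proof -
  let ?V = "unit_ball_vol (real DIM('a))" and ?c = "ker_grad_const / \<eta> x ^ (DIM('a) + 3)"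
  have ex: "\<eta> x > 0" by (rule eta_pos[OF x])
  have c: "?c \<ge> 0" using ex ker_grad_const_nonneg by simp
  have "integrable M (\<lambda>y. 1 *\<^sub>R ker_grad x y)" by (rule ker_grad_scaleR_integrable[OF x]) simp
  then have i: "integrable M (\<lambda>y. ker_grad x y)" by simp
  have "ennreal (norm (phi_grad x)) \<le> (\<integral>\<^sup>+y. ennreal (norm (ker_grad x y)) \<partial>M)"
    unfolding phi_grad_def ker_op_grad_def using integral_norm_bound_ennreal[OF i] by simp
  also have "\<dots> \<le> (\<integral>\<^sup>+y. ennreal (if near x y then ?c else 0) \<partial>M)"
    using ker_grad_bound[OF x] ker_grad_far[OF x] by (intro nn_integral_mono) (auto intro!: ennreal_leI)
  also have "\<dots> \<le> ennreal (?c * (?V * (3/2 * \<eta> x) ^ DIM('a)))" by (rule near_volume[OF x c])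
  also have "?c * (?V * (3/2 * \<eta> x) ^ DIM('a)) = phi_grad_const / \<eta> x ^ 3"
    unfolding power_mult_distrib[of "3/2"] phi_grad_const_def power_add using ex by simp
  finally show ?thesis using const_pos ex by (simp add: ennreal_le_iff)
qed

lemma inverse_phi_C1: "C1_grad \<Omega> (\<lambda>x. inverse (phi x)) (\<lambda>x. - (inverse (phi x))\<^sup>2 *\<^sub>R phi_grad x)"
  by (rule C1_grad_inverse[OF phi_C1]) (use phi_pos in fastforce)

text \<open>The square of \<open>inverse (phi x)\<close> contributes \<eta>^4 against the \<eta>^-3
  of the gradient of \<open>phi\<close>. One power remains, so multiplication by
  \<open>inverse (phi x)\<close> preserves H1.\<close>

lemma grad_inverse_phi_bound:
  assumes x: "x \<in> \<Omega>"
  shows "norm (- (inverse (phi x))\<^sup>2 *\<^sub>R phi_grad x) \<le> phi_grad_const / phi_const\<^sup>2 * \<eta> x"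
proof -
  have ex: "\<eta> x > 0" by (rule eta_pos[OF x])
  have "(inverse (phi x))\<^sup>2 * norm (phi_grad x) \<le> ((\<eta> x)\<^sup>2 / phi_const)\<^sup>2 * (phi_grad_const / \<eta> x ^ 3)"
    using inverse_phi[OF x] phi_grad_bound[OF x] by (intro mult_mono power_mono) auto
  also have "\<dots> = phi_grad_const / phi_const\<^sup>2 * \<eta> x"
    using ex by (simp add: power_divide power2_eq_square power3_eq_cube)
  finally show ?thesis by simp
qed

section \<open>Averaging with the normalized kernel\<close>

definition average :: "('a \<Rightarrow> real) \<Rightarrow> 'a \<Rightarrow> real" where
  "average w x = ker_op w x * inverse (phi x)"

definition average_grad :: "('a \<Rightarrow> real) \<Rightarrow> 'a \<Rightarrow> 'a" where
  "average_grad w x = ker_op w x *\<^sub>R (- (inverse (phi x))\<^sup>2 *\<^sub>R phi_grad x) + inverse (phi x) *\<^sub>R ker_op_grad w x"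

lemma average_C1: "integrable M w \<Longrightarrow> C1_grad \<Omega> (average w) (average_grad w)"
  unfolding average_def[abs_def] average_grad_def[abs_def] by (rule C1_grad_mult[OF ker_op_C1 inverse_phi_C1])

definition mean_osc :: "('a \<Rightarrow> real) \<Rightarrow> 'a \<Rightarrow> ennreal" where
  "mean_osc w x = (\<integral>\<^sup>+y. ennreal (if near x y then \<bar>w x - w y\<bar> / \<eta> x ^ (DIM('a) + 1) else 0) \<partial>M)"

text \<open>As \<open>q\<close> integrates to zero, \<open>w x\<close> may be subtracted from
  \<open>w y\<close> under the integral without changing it. Only differences over related pairs
  remain.\<close>

lemma mean_osc_bound:
  fixes q :: "'a \<Rightarrow> 'b::euclidean_space"
  assumes x: "x \<in> \<Omega>" and w: "integrable M w"
    and q: "integrable M q" "integrable M (\<lambda>y. w y *\<^sub>R q y)" "(LINT y|M. q y) = 0"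
    and far: "\<And>y. y \<in> \<Omega> \<Longrightarrow> \<not> near x y \<Longrightarrow> q y = 0"
    and bd: "\<And>y. y \<in> \<Omega> \<Longrightarrow> norm (q y) \<le> A / \<eta> x ^ (DIM('a) + 1)" and A: "A \<ge> 0"
  shows "ennreal (norm (LINT y|M. w y *\<^sub>R q y)) \<le> ennreal A * mean_osc w x"
proof -
  have [measurable]: "x \<in> space M" using x by simp
  have [measurable]: "w \<in> borel_measurable M" using w by auto
  have ex: "\<eta> x > 0" by (rule eta_pos[OF x])
  have i: "integrable M (\<lambda>y. w y *\<^sub>R q y - w x *\<^sub>R q y)"
    using q by (intro Bochner_Integration.integrable_diff) auto
  have "(LINT y|M. w y *\<^sub>R q y - w x *\<^sub>R q y) = (LINT y|M. w y *\<^sub>R q y) - w x *\<^sub>R (LINT y|M. q y)"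
    using q by simp
  then have "(LINT y|M. w y *\<^sub>R q y) = (LINT y|M. w y *\<^sub>R q y - w x *\<^sub>R q y)" using q(3) by simp
  then have "ennreal (norm (LINT y|M. w y *\<^sub>R q y)) \<le> (\<integral>\<^sup>+y. ennreal (norm (w y *\<^sub>R q y - w x *\<^sub>R q y)) \<partial>M)"
    using integral_norm_bound_ennreal[OF i] by simp
  also have "\<dots> \<le> (\<integral>\<^sup>+y. ennreal A * ennreal (if near x y then \<bar>w x - w y\<bar> / \<eta> x ^ (DIM('a) + 1) else 0) \<partial>M)"
  proof (rule nn_integral_mono)
    fix y assume "y \<in> space M"
    then have y: "y \<in> \<Omega>" by simp
    show "ennreal (norm (w y *\<^sub>R q y - w x *\<^sub>R q y)) \<le> ennreal A * ennreal (if near x y then \<bar>w x - w y\<bar> / \<eta> x ^ (DIM('a) + 1) else 0)"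
    proof (cases "near x y")
      case True
      have "norm (w y *\<^sub>R q y - w x *\<^sub>R q y) = \<bar>w x - w y\<bar> * norm (q y)"
        by (simp add: scaleR_diff_left[symmetric] abs_minus_commute)
      also have "\<dots> \<le> \<bar>w x - w y\<bar> * (A / \<eta> x ^ (DIM('a) + 1))" by (intro mult_left_mono bd y) simp
      also have "\<dots> = A * (\<bar>w x - w y\<bar> / \<eta> x ^ (DIM('a) + 1))" by simp
      finally have "ennreal (norm (w y *\<^sub>R q y - w x *\<^sub>R q y)) \<le> ennreal (A * (\<bar>w x - w y\<bar> / \<eta> x ^ (DIM('a) + 1)))" by (rule ennreal_leI)
      also have "\<dots> = ennreal A * ennreal (\<bar>w x - w y\<bar> / \<eta> x ^ (DIM('a) + 1))" using A ex by (intro ennreal_mult) auto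
      finally show ?thesis using True by simp
    next
      case False
      then show ?thesis using far[OF y] by simp
    qed
  qed
  also have "\<dots> = ennreal A * mean_osc w x"
    unfolding mean_osc_def by (rule nn_integral_cmult) measurable
  finally show ?thesis .
qed

definition osc_const :: real where
  "osc_const = unit_ball_vol (real DIM('a)) * (3/2) ^ DIM('a) * (1 + (3/2) ^ (DIM('a) + 2))"

lemma osc_const_nonneg: "osc_const \<ge> 0"
  using vol_pos by (simp add: osc_const_def)

lemma square_mean_osc_bound:
  fixes F :: "'a \<Rightarrow> real"
  assumes w: "w \<in> borel_measurable M" and F: "\<And>x. x \<in> \<Omega> \<Longrightarrow> ennreal (F x) \<le> ennreal A * mean_osc w x"
    and F0: "\<And>x. x \<in> \<Omega> \<Longrightarrow> F x \<ge> 0" and A: "A \<ge> 0"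
  shows "(\<integral>\<^sup>+x. ennreal ((F x)\<^sup>2) \<partial>M) \<le> ennreal (A\<^sup>2 * osc_const) * energy 1 w"
proof -
  have [measurable]: "w \<in> borel_measurable M" by (rule w)
  have "(\<integral>\<^sup>+x. ennreal ((F x)\<^sup>2) \<partial>M) \<le> (\<integral>\<^sup>+x. ennreal (A\<^sup>2) * (mean_osc w x)\<^sup>2 \<partial>M)"
  proof (rule nn_integral_mono)
    fix x assume "x \<in> space M"
    then have x: "x \<in> \<Omega>" by simp
    have "ennreal ((F x)\<^sup>2) = (ennreal (F x))\<^sup>2" using F0[OF x] by (simp add: ennreal_power)
    also have "\<dots> \<le> (ennreal A * mean_osc w x)\<^sup>2" by (intro power_mono F x) simp
    also have "\<dots> = ennreal (A\<^sup>2) * (mean_osc w x)\<^sup>2" using A by (simp add: power_mult_distrib ennreal_power)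
    finally show "ennreal ((F x)\<^sup>2) \<le> ennreal (A\<^sup>2) * (mean_osc w x)\<^sup>2" .
  qed
  also have "\<dots> = ennreal (A\<^sup>2) * (\<integral>\<^sup>+x. (mean_osc w x)\<^sup>2 \<partial>M)"
    unfolding mean_osc_def by (rule nn_integral_cmult) measurable
  also have "\<dots> \<le> ennreal (A\<^sup>2) * (ennreal osc_const * energy 1 w)"
    unfolding mean_osc_def osc_const_def by (intro mult_left_mono mean_oscillation_le w) simp
  finally show ?thesis using osc_const_nonneg by (simp add: ennreal_mult mult.assoc)
qed

text \<open>The first term comes from differentiating the kernel, the second from differentiating
  its normalization \<open>inverse (phi x)\<close>.\<close>

definition average_const :: real where "average_const = ker_grad_const / phi_const + ker_const * phi_grad_const / phi_const\<^sup>2"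

lemma average_const_nonneg: "average_const \<ge> 0"
  using const_pos ker_grad_const_nonneg by (simp add: average_const_def)

text \<open>The weights have mass 1 for every \<open>x\<close>, so their gradient \<open>q\<close>
  has integral 0 and \<open>mean_osc_bound\<close> applies. Both parts of \<open>q\<close> have size
  \<eta>^-(d + 1): it is \<eta>^2 times \<eta>^-(d + 3) in the first, and \<eta>^-(d + 2) times
  \<eta>^4 times \<eta>^-3 in the second.\<close>

lemma average_grad_square_le:
  assumes w: "integrable M w"
  shows "(\<integral>\<^sup>+x. ennreal ((norm (average_grad w x))\<^sup>2) \<partial>M) \<le> ennreal (average_const\<^sup>2 * osc_const) * energy 1 w"
proof (rule square_mean_osc_bound)
  show "w \<in> borel_measurable M" using w by auto
  fix x assume x: "x \<in> \<Omega>"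
  have ex: "\<eta> x > 0" by (rule eta_pos[OF x])
  define i where "i = inverse (phi x)"
  have ib: "0 < i" "i \<le> (\<eta> x)\<^sup>2 / phi_const" using inverse_phi[OF x] by (auto simp: i_def)
  have iphi: "i * phi x = 1" using phi_pos[OF x] by (simp add: i_def)
  \<comment> \<open>Gradient at \<open>x\<close> of the weight
    \<open>ker x y * inverse (phi x)\<close>.\<close>
  define q where "q y = i *\<^sub>R ker_grad x y - (ker x y * i\<^sup>2) *\<^sub>R phi_grad x" for y
  have "integrable M (\<lambda>y. 1 *\<^sub>R ker_grad x y)" by (rule ker_grad_scaleR_integrable[OF x]) simp
  then have iK: "integrable M (\<lambda>y. ker_grad x y)" by simp
  have ik: "integrable M (\<lambda>y. ker x y)" using ker_mult_integrable[OF x, of "\<lambda>y. 1"] by simp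
  have iq: "integrable M q"
    unfolding q_def[abs_def] using iK ik by (intro Bochner_Integration.integrable_diff integrable_scaleR_right integrable_scaleR_left integrable_mult_left) auto
  have wq: "w y *\<^sub>R q y = i *\<^sub>R (w y *\<^sub>R ker_grad x y) - (ker x y * w y * i\<^sup>2) *\<^sub>R phi_grad x" for y
    by (simp add: q_def scaleR_diff_right mult_ac)
  have i1: "integrable M (\<lambda>y. i *\<^sub>R (w y *\<^sub>R ker_grad x y))"
    by (intro integrable_scaleR_right ker_grad_scaleR_integrable x w)
  have i2: "integrable M (\<lambda>y. (ker x y * w y * i\<^sup>2) *\<^sub>R phi_grad x)"
    by (intro integrable_scaleR_left integrable_mult_left ker_mult_integrable x w)
  have iwq: "integrable M (\<lambda>y. w y *\<^sub>R q y)"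
    unfolding wq by (rule Bochner_Integration.integrable_diff[OF i1 i2])
  have "(LINT y|M. w y *\<^sub>R q y) = i *\<^sub>R ker_op_grad w x - (ker_op w x * i\<^sup>2) *\<^sub>R phi_grad x"
  proof -
    have "(LINT y|M. i *\<^sub>R (w y *\<^sub>R ker_grad x y)) = i *\<^sub>R ker_op_grad w x"
      unfolding ker_op_grad_def by (rule integral_scaleR_right)
    moreover have "(LINT y|M. (ker x y * w y * i\<^sup>2) *\<^sub>R phi_grad x) = (ker_op w x * i\<^sup>2) *\<^sub>R phi_grad x"
      unfolding ker_op_def using ker_mult_integrable[OF x w] by (subst integral_scaleR_left) auto
    ultimately show ?thesis unfolding wq Bochner_Integration.integral_diff[OF i1 i2] by (simp only:)
  qed
  also have "\<dots> = average_grad w x" by (simp add: average_grad_def i_def)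
  finally have average_grad: "average_grad w x = (LINT y|M. w y *\<^sub>R q y)" by simp
  have "(LINT y|M. q y) = i *\<^sub>R phi_grad x - (phi x * i\<^sup>2) *\<^sub>R phi_grad x"
    unfolding q_def phi_grad_def ker_op_grad_def phi_def ker_op_def using iK ik
    by (subst Bochner_Integration.integral_diff) (auto intro!: integrable_scaleR_left integrable_mult_left simp: integral_scaleR_left)
  also have "phi x * i\<^sup>2 = i" using iphi by (simp add: power2_eq_square mult.assoc[symmetric] mult.commute)
  finally have q0: "(LINT y|M. q y) = 0" by simp
  show "ennreal (norm (average_grad w x)) \<le> ennreal average_const * mean_osc w x"
    unfolding average_grad
  proof (rule mean_osc_bound[OF x w iq iwq q0 _ _ average_const_nonneg])
    show "q y = 0" if "y \<in> \<Omega>" "\<not> near x y" for y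
      using ker_grad_far[OF x that] ker_far[OF x that] by (simp add: q_def)
    fix y assume y: "y \<in> \<Omega>"
    have "norm (i *\<^sub>R ker_grad x y) = i * norm (ker_grad x y)" using ib by simp
    also have "\<dots> \<le> ((\<eta> x)\<^sup>2 / phi_const) * (ker_grad_const / \<eta> x ^ (DIM('a) + 3))"
      using ib ker_grad_bound[OF x y] const_pos by (intro mult_mono) auto
    also have "\<dots> = (ker_grad_const / phi_const) / \<eta> x ^ (DIM('a) + 1)"
      using ex by (simp add: power_add power2_eq_square power3_eq_cube)
    finally have 1: "norm (i *\<^sub>R ker_grad x y) \<le> (ker_grad_const / phi_const) / \<eta> x ^ (DIM('a) + 1)" .
    have "norm ((ker x y * i\<^sup>2) *\<^sub>R phi_grad x) = ker x y * i\<^sup>2 * norm (phi_grad x)" using ker_nonneg[OF x y] by simp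
    also have "\<dots> \<le> (ker_const / \<eta> x ^ (DIM('a) + 2)) * ((\<eta> x)\<^sup>2 / phi_const)\<^sup>2 * (phi_grad_const / \<eta> x ^ 3)"
      using ker_bound[OF x y] ker_nonneg[OF x y] ib phi_grad_bound[OF x] const_pos ex
      by (intro mult_mono power_mono) (auto simp: ker_const_def)
    also have "\<dots> = (ker_const * phi_grad_const / phi_const\<^sup>2) / \<eta> x ^ (DIM('a) + 1)"
      using ex by (simp add: power_add power_divide power2_eq_square power3_eq_cube)
    finally have 2: "norm ((ker x y * i\<^sup>2) *\<^sub>R phi_grad x) \<le> (ker_const * phi_grad_const / phi_const\<^sup>2) / \<eta> x ^ (DIM('a) + 1)" .
    have "norm (q y) \<le> norm (i *\<^sub>R ker_grad x y) + norm ((ker x y * i\<^sup>2) *\<^sub>R phi_grad x)"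
      unfolding q_def by (rule norm_triangle_ineq4)
    also have "\<dots> \<le> (ker_grad_const / phi_const) / \<eta> x ^ (DIM('a) + 1) + (ker_const * phi_grad_const / phi_const\<^sup>2) / \<eta> x ^ (DIM('a) + 1)"
      by (rule add_mono[OF 1 2])
    also have "\<dots> = average_const / \<eta> x ^ (DIM('a) + 1)" by (simp only: average_const_def add_divide_distrib)
    finally show "norm (q y) \<le> average_const / \<eta> x ^ (DIM('a) + 1)" .
  qed
qed (use average_const_nonneg in auto)

text \<open>The weight itself is of size \<eta>^-d, one power better than its gradient; the surplus
  factor \<open>\<eta> x\<close> is estimated by \<open>m\<close>.\<close>

lemma average_diff_square_le:
  assumes w: "integrable M w" and m: "\<And>x. x \<in> \<Omega> \<Longrightarrow> \<eta> x \<le> m" "m \<ge> 0"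
  shows "(\<integral>\<^sup>+x. ennreal ((w x - average w x)\<^sup>2) \<partial>M) \<le> ennreal ((ker_const * m / phi_const)\<^sup>2 * osc_const) * energy 1 w"
proof -
  have A: "ker_const * m / phi_const \<ge> 0" using const_pos m(2) by simp
  have "(\<integral>\<^sup>+x. ennreal (\<bar>w x - average w x\<bar>\<^sup>2) \<partial>M) \<le> ennreal ((ker_const * m / phi_const)\<^sup>2 * osc_const) * energy 1 w"
  proof (rule square_mean_osc_bound[OF _ _ _ A])
    show "w \<in> borel_measurable M" using w by auto
    fix x assume x: "x \<in> \<Omega>"
    have ex: "\<eta> x > 0" by (rule eta_pos[OF x])
    define i where "i = inverse (phi x)"
    have ib: "0 < i" "i \<le> (\<eta> x)\<^sup>2 / phi_const" using inverse_phi[OF x] by (auto simp: i_def)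
    have iphi: "phi x * i = 1" using phi_pos[OF x] by (simp add: i_def)
    have i1: "integrable M (\<lambda>y. w x * (ker x y * i))" "integrable M (\<lambda>y. w y * (ker x y * i))"
      using ker_mult_integrable[OF x, of "\<lambda>y. 1"] ker_mult_integrable[OF x w]
      by (auto simp: mult.assoc[symmetric] mult.commute[of "w _"])
    have a: "0 \<le> ker x y * i" "ker x y * i \<le> (ker_const * m / phi_const) / \<eta> x ^ (DIM('a) + 1)" if y: "y \<in> \<Omega>" for y
    proof -
      show "0 \<le> ker x y * i" using ker_nonneg[OF x y] ib by simp
      have "ker x y * i \<le> (ker_const / \<eta> x ^ (DIM('a) + 2)) * ((\<eta> x)\<^sup>2 / phi_const)"
        using ker_bound[OF x y] ker_nonneg[OF x y] ib const_pos ex by (intro mult_mono) (auto simp: ker_const_def)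
      also have "\<dots> = (ker_const * \<eta> x / phi_const) / \<eta> x ^ (DIM('a) + 1)"
        using ex by (simp add: power_add power2_eq_square)
      also have "\<dots> \<le> (ker_const * m / phi_const) / \<eta> x ^ (DIM('a) + 1)"
        using m(1)[OF x] const_pos ex by (intro divide_right_mono mult_left_mono) auto
      finally show "ker x y * i \<le> (ker_const * m / phi_const) / \<eta> x ^ (DIM('a) + 1)" .
    qed
    have "w x = (LINT y|M. w x * (ker x y * i))"
      using iphi by (simp add: phi_def ker_op_def)
    moreover have "average w x = (LINT y|M. w y * (ker x y * i))"
      by (simp add: average_def ker_op_def i_def mult_ac flip: integral_mult_right_zero)
    ultimately have "w x - average w x = (LINT y|M. w x * (ker x y * i) - w y * (ker x y * i))"
      using i1 by simp
    then have "ennreal \<bar>w x - average w x\<bar> \<le> (\<integral>\<^sup>+y. ennreal (norm (w x * (ker x y * i) - w y * (ker x y * i))) \<partial>M)"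
      using integral_norm_bound_ennreal[OF Bochner_Integration.integrable_diff[OF i1]] by simp
    also have "\<dots> \<le> (\<integral>\<^sup>+y. ennreal (ker_const * m / phi_const) * ennreal (if near x y then \<bar>w x - w y\<bar> / \<eta> x ^ (DIM('a) + 1) else 0) \<partial>M)"
    proof (rule nn_integral_mono)
      fix y assume "y \<in> space M"
      then have y: "y \<in> \<Omega>" by simp
      show "ennreal (norm (w x * (ker x y * i) - w y * (ker x y * i))) \<le> ennreal (ker_const * m / phi_const) * ennreal (if near x y then \<bar>w x - w y\<bar> / \<eta> x ^ (DIM('a) + 1) else 0)"
      proof (cases "near x y")
        case True
        have "norm (w x * (ker x y * i) - w y * (ker x y * i)) = \<bar>w x - w y\<bar> * (ker x y * i)"
          by (simp only: left_diff_distrib[symmetric] real_norm_def abs_mult[of "w x - w y"] abs_of_nonneg[OF a(1)[OF y]])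
        also have "\<dots> \<le> \<bar>w x - w y\<bar> * ((ker_const * m / phi_const) / \<eta> x ^ (DIM('a) + 1))"
          by (intro mult_left_mono a(2) y) simp
        also have "\<dots> = (ker_const * m / phi_const) * (\<bar>w x - w y\<bar> / \<eta> x ^ (DIM('a) + 1))" by simp
        finally have "ennreal (norm (w x * (ker x y * i) - w y * (ker x y * i))) \<le> ennreal ((ker_const * m / phi_const) * (\<bar>w x - w y\<bar> / \<eta> x ^ (DIM('a) + 1)))"
          by (rule ennreal_leI)
        also have "\<dots> = ennreal (ker_const * m / phi_const) * ennreal (\<bar>w x - w y\<bar> / \<eta> x ^ (DIM('a) + 1))"
          using ex by (intro ennreal_mult A) auto
        finally show ?thesis using True by simp
      next
        case False
        then show ?thesis using ker_far[OF x y] by simp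
      qed
    qed
    also have "\<dots> = ennreal (ker_const * m / phi_const) * mean_osc w x"
    proof -
      have [measurable]: "x \<in> space M" "w \<in> borel_measurable M" using x w by auto
      show ?thesis unfolding mean_osc_def by (rule nn_integral_cmult) measurable
    qed
    finally show "ennreal \<bar>w x - average w x\<bar> \<le> ennreal (ker_const * m / phi_const) * mean_osc w x" .
  qed simp
  then show ?thesis by simp
qed

text \<open>Averaging enlarges the support but keeps it away from the boundary. The distance of two
  interacting points is at most 3/4 of the boundary distance of one of them, so \<open>x\<close>
  retains at least a quarter of the boundary distance of \<open>y\<close>.\<close>

lemma near_compact:
  assumes S: "compact S" "S \<subseteq> \<Omega>"
  obtains S' where "compact S'" "S' \<subseteq> \<Omega>" "\<And>x y. x \<in> \<Omega> \<Longrightarrow> y \<in> S \<Longrightarrow> near x y \<Longrightarrow> x \<in> S'"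
proof (cases "S = {}")
  case True
  then show ?thesis using that[of "{}"] by auto
next
  case False
  let ?d = "\<lambda>x. infdist x (frontier \<Omega>)"
  obtain y0 where y0: "y0 \<in> S" "\<And>y. y \<in> S \<Longrightarrow> ?d y0 \<le> ?d y"
    using continuous_attains_inf[OF S(1) False continuous_on_infdist[OF continuous_on_id, of S "frontier \<Omega>"]] by auto
  define S' where "S' = closure \<Omega> \<inter> {x. ?d y0 / 4 \<le> ?d x}"
  have d0: "?d y0 > 0" using eta_le_infdist[of y0] eta_pos[of y0] y0(1) S(2) by fastforce
  have "closed {x. ?d y0 / 4 \<le> ?d x}"
    by (intro closed_Collect_le continuous_intros)
  then have "compact S'"
    unfolding S'_def using bounded_domain by (intro compact_Int_closed) auto
  moreover have "S' \<subseteq> \<Omega>"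
  proof
    fix x assume x: "x \<in> S'"
    show "x \<in> \<Omega>"
    proof (rule ccontr)
      assume "x \<notin> \<Omega>"
      then have "x \<in> frontier \<Omega>" using x open_domain by (auto simp: S'_def frontier_def interior_open)
      then show False using x d0 by (simp add: S'_def)
    qed
  qed
  moreover have "x \<in> S'" if x: "x \<in> \<Omega>" and y: "y \<in> S" and n: "near x y" for x y
  proof -
    have y\<Omega>: "y \<in> \<Omega>" using y S(2) by auto
    have "?d y \<le> ?d x + dist x y" using infdist_triangle[of y "frontier \<Omega>" x] by (simp add: dist_commute)
    moreover have "dist x y \<le> 3/4 * ?d x \<or> dist x y \<le> 3/4 * ?d y"
      using n eta_le_infdist[OF x] eta_le_infdist[OF y\<Omega>] by (auto simp: near_def)
    \<comment> \<open>If the range is bounded by the boundary distance of \<open>x\<close>, the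
      factor is even 4/7; if by that of \<open>y\<close>, it is 1/4.\<close>
    ultimately have "?d y / 4 \<le> ?d x" using infdist_nonneg[of x "frontier \<Omega>"] by linarith
    then have "?d y0 / 4 \<le> ?d x" using y0(2)[OF y] by linarith
    then show ?thesis using x closure_subset by (auto simp: S'_def)
  qed
  ultimately show ?thesis by (rule that)
qed

text \<open>\<open>near_compact\<close> makes the average vanish outside a compact subset of
  \<open>\<Omega>\<close>, as the Friedrichs inequality demands. The coefficient
  \<open>8 * D\<^sup>2\<close> is the \<open>4 * D\<^sup>2\<close> from there, doubled when the
  square of a sum of two terms is split.\<close>

lemma poincare_test_function:
  assumes \<phi>: "C1_grad UNIV \<phi> \<psi>" and S: "compact S" "S \<subseteq> \<Omega>" "\<And>x. x \<notin> S \<Longrightarrow> \<phi> x = 0"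
    and m: "\<And>x. x \<in> \<Omega> \<Longrightarrow> \<eta> x \<le> m" "m \<ge> 0" and D: "\<And>x. x \<in> \<Omega> \<Longrightarrow> norm x \<le> D"
  shows "(\<integral>\<^sup>+x. ennreal ((\<phi> x)\<^sup>2) \<partial>M) \<le> ennreal (8 * D\<^sup>2 * (average_const\<^sup>2 * osc_const) + 2 * ((ker_const * m / phi_const)\<^sup>2 * osc_const)) * energy 1 \<phi>"
proof -
  have w: "integrable M \<phi>"
    by (rule integral_compact_support(1)[OF open_domain S(1,2) continuous_on_subset[OF C1_gradD(3)[OF \<phi>]]])
      (use S(3) in auto)
  obtain S' where S': "compact S'" "S' \<subseteq> \<Omega>" "\<And>x y. x \<in> \<Omega> \<Longrightarrow> y \<in> S \<Longrightarrow> near x y \<Longrightarrow> x \<in> S'"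
    using near_compact[OF S(1,2)] by blast
  have T0: "average \<phi> x = 0" if x: "x \<in> \<Omega> - S'" for x
  proof -
    have "ker_op \<phi> x = (LINT y|M. 0)"
      unfolding ker_op_def
    proof (rule Bochner_Integration.integral_cong)
      fix y assume "y \<in> space M"
      then show "ker x y * \<phi> y = 0" using ker_far[of x y] S(3)[of y] S'(3)[of x y] x by (cases "y \<in> S") auto
    qed simp
    then show ?thesis by (simp add: average_def)
  qed
  note fr = friedrichs_inequality[OF open_domain D average_C1[OF w] S'(1,2) T0]
  have 1: "(\<integral>\<^sup>+x. ennreal ((average \<phi> x)\<^sup>2) \<partial>M) \<le> ennreal (4 * D\<^sup>2) * (ennreal (average_const\<^sup>2 * osc_const) * energy 1 \<phi>)"
  proof -
    have "(\<integral>\<^sup>+x. ennreal ((average \<phi> x)\<^sup>2) \<partial>M) = ennreal (LINT x|M. (average \<phi> x)\<^sup>2)"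
      by (rule nn_integral_eq_integral[OF fr(3)]) (assumption | intro AE_I2 zero_le_power2)+
    also have "\<dots> \<le> ennreal (4 * D\<^sup>2 * (LINT x|M. (norm (average_grad \<phi> x))\<^sup>2))" by (rule ennreal_leI[OF fr(1)])
    also have "\<dots> = ennreal (4 * D\<^sup>2) * ennreal (LINT x|M. (norm (average_grad \<phi> x))\<^sup>2)"
      by (intro ennreal_mult integral_nonneg_AE) auto
    also have "ennreal (LINT x|M. (norm (average_grad \<phi> x))\<^sup>2) = (\<integral>\<^sup>+x. ennreal ((norm (average_grad \<phi> x))\<^sup>2) \<partial>M)"
      by (rule nn_integral_eq_integral[OF fr(2), symmetric]) (assumption | intro AE_I2 zero_le_power2)+
    finally show ?thesis
      by (rule order_trans) (intro mult_left_mono average_grad_square_le[OF w], simp)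
  qed
  have 2: "(\<integral>\<^sup>+x. ennreal ((\<phi> x - average \<phi> x)\<^sup>2) \<partial>M) \<le> ennreal ((ker_const * m / phi_const)\<^sup>2 * osc_const) * energy 1 \<phi>"
    by (rule average_diff_square_le[OF w m])
  have [measurable]: "average \<phi> \<in> borel_measurable M" "\<phi> \<in> borel_measurable M"
    using w borel_measurable_lebesgue_on_continuous[OF open_domain C1_gradD(3)[OF average_C1[OF w]]] by auto
  have "(\<integral>\<^sup>+x. ennreal ((\<phi> x)\<^sup>2) \<partial>M) \<le> (\<integral>\<^sup>+x. 2 * ennreal ((average \<phi> x)\<^sup>2) + 2 * ennreal ((\<phi> x - average \<phi> x)\<^sup>2) \<partial>M)"
  proof (rule nn_integral_mono)
    fix x
    have "0 \<le> (\<phi> x - 2 * average \<phi> x)\<^sup>2" by simp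
    then have "(\<phi> x)\<^sup>2 \<le> 2 * (average \<phi> x)\<^sup>2 + 2 * (\<phi> x - average \<phi> x)\<^sup>2" by (simp add: power2_eq_square algebra_simps)
    then have "ennreal ((\<phi> x)\<^sup>2) \<le> ennreal (2 * (average \<phi> x)\<^sup>2 + 2 * (\<phi> x - average \<phi> x)\<^sup>2)" by (rule ennreal_leI)
    also have "\<dots> = 2 * ennreal ((average \<phi> x)\<^sup>2) + 2 * ennreal ((\<phi> x - average \<phi> x)\<^sup>2)" by (rule ennreal_double_add) auto
    finally show "ennreal ((\<phi> x)\<^sup>2) \<le> 2 * ennreal ((average \<phi> x)\<^sup>2) + 2 * ennreal ((\<phi> x - average \<phi> x)\<^sup>2)" .
  qed
  also have "\<dots> = 2 * (\<integral>\<^sup>+x. ennreal ((average \<phi> x)\<^sup>2) \<partial>M) + 2 * (\<integral>\<^sup>+x. ennreal ((\<phi> x - average \<phi> x)\<^sup>2) \<partial>M)"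
    by (simp add: nn_integral_add nn_integral_cmult)
  also have "\<dots> \<le> 2 * (ennreal (4 * D\<^sup>2) * (ennreal (average_const\<^sup>2 * osc_const) * energy 1 \<phi>)) + 2 * (ennreal ((ker_const * m / phi_const)\<^sup>2 * osc_const) * energy 1 \<phi>)"
    by (intro add_mono mult_left_mono 1 2) auto
  also have "\<dots> = (2 * ennreal (4 * D\<^sup>2 * (average_const\<^sup>2 * osc_const)) + 2 * ennreal ((ker_const * m / phi_const)\<^sup>2 * osc_const)) * energy 1 \<phi>"
    using osc_const_nonneg by (simp add: ennreal_mult distrib_right mult.assoc)
  also have "2 * ennreal (4 * D\<^sup>2 * (average_const\<^sup>2 * osc_const)) + 2 * ennreal ((ker_const * m / phi_const)\<^sup>2 * osc_const) =
     ennreal (2 * (4 * D\<^sup>2 * (average_const\<^sup>2 * osc_const)) + 2 * ((ker_const * m / phi_const)\<^sup>2 * osc_const))"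
    using osc_const_nonneg by (intro ennreal_double_add[symmetric]) auto
  finally show ?thesis by (simp add: mult.assoc)
qed

text \<open>The quadratic form as an extended integral: it can be estimated before integrability is
  known, whereas a Bochner integral that does not exist would have the value 0.\<close>

definition ker_energy :: "('a \<Rightarrow> real) \<Rightarrow> ennreal" where
  "ker_energy u = (\<integral>\<^sup>+x. \<integral>\<^sup>+y. ennreal (ker x y * (u x - u y)\<^sup>2) \<partial>M \<partial>M)"

lemma ker_energy_le:
  assumes u[measurable]: "u \<in> borel_measurable M"
  shows "ker_energy u \<le> ennreal (ker_const * (1 + (3/2) ^ (DIM('a) + 2))) * energy 1 u"
proof -
  define I where "I x y = ennreal (if near x y then (u x - u y)\<^sup>2 / \<eta> x ^ (DIM('a) + 2) else 0)" for x y
  have Im[measurable]: "(\<lambda>w. I (p w) (q w)) \<in> borel_measurable N"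
    if [measurable]: "p \<in> N \<rightarrow>\<^sub>M M" "q \<in> N \<rightarrow>\<^sub>M M" for p q and N :: "'n measure"
    unfolding I_def by measurable
  have "ker_energy u \<le> (\<integral>\<^sup>+x. \<integral>\<^sup>+y. ennreal ker_const * I x y \<partial>M \<partial>M)"
    unfolding ker_energy_def
  proof (intro nn_integral_mono)
    fix x y assume "x \<in> space M" "y \<in> space M"
    then have x: "x \<in> \<Omega>" and y: "y \<in> \<Omega>" by auto
    have ex: "\<eta> x > 0" by (rule eta_pos[OF x])
    show "ennreal (ker x y * (u x - u y)\<^sup>2) \<le> ennreal ker_const * I x y"
    proof (cases "near x y")
      case True
      have "ker x y * (u x - u y)\<^sup>2 \<le> (ker_const / \<eta> x ^ (DIM('a) + 2)) * (u x - u y)\<^sup>2"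
        using ker_bound[OF x y] by (intro mult_right_mono) (auto simp: ker_const_def)
      then have "ennreal (ker x y * (u x - u y)\<^sup>2) \<le> ennreal (ker_const * ((u x - u y)\<^sup>2 / \<eta> x ^ (DIM('a) + 2)))"
        by (intro ennreal_leI) simp
      also have "\<dots> = ennreal ker_const * ennreal ((u x - u y)\<^sup>2 / \<eta> x ^ (DIM('a) + 2))"
        using const_pos ex by (intro ennreal_mult) auto
      finally show ?thesis using True by (simp add: I_def)
    qed (use ker_far[OF x y] in simp)
  qed
  also have "\<dots> = (\<integral>\<^sup>+x. ennreal ker_const * (\<integral>\<^sup>+y. I x y \<partial>M) \<partial>M)"
    by (intro nn_integral_cong nn_integral_cmult) measurable
  also have "\<dots> = ennreal ker_const * (\<integral>\<^sup>+x. \<integral>\<^sup>+y. I x y \<partial>M \<partial>M)"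
    by (rule nn_integral_cmult) measurable
  also have "\<dots> \<le> ennreal ker_const * (ennreal (1 + (3/2) ^ (DIM('a) + 2)) * energy 1 u)"
    unfolding I_def by (intro mult_left_mono near_energy_le u) simp
  finally show ?thesis using const_pos by (simp add: ennreal_mult mult.assoc)
qed

text \<open>Only the half of the kernel localized at \<open>x\<close> is used; the factor 1/2 of the
  symmetrization is the reason for the 2 in \<open>2 / \<rho>0\<close>.\<close>

lemma energy_le_ker_energy:
  assumes u[measurable]: "u \<in> borel_measurable M"
  shows "energy r0 u \<le> ennreal (2 / \<rho>0) * ker_energy u"
proof -
  have "energy r0 u \<le> (\<integral>\<^sup>+x. \<integral>\<^sup>+y. ennreal (2 / \<rho>0) * ennreal (ker x y * (u x - u y)\<^sup>2) \<partial>M \<partial>M)"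
    unfolding energy_def
  proof (intro nn_integral_mono)
    fix x y assume "x \<in> space M" "y \<in> space M"
    then have x: "x \<in> \<Omega>" and y: "y \<in> \<Omega>" by auto
    have ex: "\<eta> x > 0" by (rule eta_pos[OF x])
    show "ennreal (if dist x y \<le> r0 * \<eta> x then (u x - u y)\<^sup>2 / \<eta> x ^ (DIM('a) + 2) else 0) \<le> ennreal (2 / \<rho>0) * ennreal (ker x y * (u x - u y)\<^sup>2)"
    proof (cases "dist x y \<le> r0 * \<eta> x")
      case True
      then have "dist x y / \<eta> x \<le> r0" using ex by (simp add: divide_simps mult.commute)
      then have "\<rho>0 \<le> \<rho> (dist x y / \<eta> x)" using ex by (intro rho_lower(4)) auto
      then have "\<rho>0 / \<eta> x ^ (DIM('a) + 2) \<le> ker_half x y" unfolding ker_half_def using ex by (intro divide_right_mono) auto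
      then have "\<rho>0 / \<eta> x ^ (DIM('a) + 2) / 2 \<le> (ker_half x y + ker_half y x) / 2" using ker_half_bounds(1)[OF y, of x] by (intro divide_right_mono) auto
      then have "2 / \<rho>0 * (\<rho>0 / \<eta> x ^ (DIM('a) + 2) / 2) \<le> 2 / \<rho>0 * ker x y"
        unfolding ker_def using rho_lower(1) by (intro mult_left_mono) auto
      then have "1 / \<eta> x ^ (DIM('a) + 2) \<le> 2 / \<rho>0 * ker x y" using rho_lower(1) by simp
      then have "1 / \<eta> x ^ (DIM('a) + 2) * (u x - u y)\<^sup>2 \<le> 2 / \<rho>0 * ker x y * (u x - u y)\<^sup>2" by (rule mult_right_mono) simp
      then have "ennreal ((u x - u y)\<^sup>2 / \<eta> x ^ (DIM('a) + 2)) \<le> ennreal (2 / \<rho>0 * (ker x y * (u x - u y)\<^sup>2))"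
        by (intro ennreal_leI) (simp add: mult.assoc)
      also have "\<dots> = ennreal (2 / \<rho>0) * ennreal (ker x y * (u x - u y)\<^sup>2)"
        using rho_lower(1) ker_nonneg[OF x y] by (intro ennreal_mult) auto
      finally show ?thesis using True by simp
    qed simp
  qed
  also have "\<dots> = (\<integral>\<^sup>+x. ennreal (2 / \<rho>0) * (\<integral>\<^sup>+y. ennreal (ker x y * (u x - u y)\<^sup>2) \<partial>M) \<partial>M)"
    by (intro nn_integral_cong nn_integral_cmult) measurable
  also have "\<dots> = ennreal (2 / \<rho>0) * ker_energy u"
    unfolding ker_energy_def by (rule nn_integral_cmult) measurable
  finally show ?thesis .
qed

end

section \<open>The nonlocal spaces and the weak equation\<close>



locale nonlocal_estimate = nonlocal_problem \<Omega> \<eta> g \<rho> \<rho>' \<rho>0 r0 B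
  for \<Omega> :: "'a::euclidean_space set" and \<eta> :: "'a \<Rightarrow> real" and g :: "'a \<Rightarrow> 'a"
    and \<rho> \<rho>' :: "real \<Rightarrow> real" and \<rho>0 r0 B :: real +
  fixes R D m :: real
  assumes R: "0 < R" "R < 1"
    and domain_radius: "\<And>x. x \<in> \<Omega> \<Longrightarrow> norm x \<le> D"
    and eta_le: "\<And>x. x \<in> \<Omega> \<Longrightarrow> \<eta> x \<le> m" and m_nonneg: "m \<ge> 0"
begin

section \<open>Passage from test functions to their closure\<close>

definition radius_const :: real where "radius_const = chain_const DIM('a) ^ chain_steps R"
definition poincare_const :: real where "poincare_const = 8 * D\<^sup>2 * (average_const\<^sup>2 * osc_const) + 2 * ((ker_const * m / phi_const)\<^sup>2 * osc_const)"

lemma radius_poincare_const_nonneg: "0 \<le> radius_const" "0 \<le> poincare_const"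
  using chain_const_pos[of "DIM('a)"] osc_const_nonneg by (auto simp: radius_const_def poincare_const_def)

lemma test_function_energy:
  assumes \<phi>: "\<phi> \<in> Cc_infinity \<Omega>"
  shows "energy 1 \<phi> < \<infinity>" "(\<integral>\<^sup>+x. ennreal ((\<phi> x)\<^sup>2) \<partial>M) \<le> ennreal poincare_const * energy 1 \<phi>"
proof -
  obtain \<psi> S where *: "C1_grad UNIV \<phi> \<psi>" "compact S" "S \<subseteq> \<Omega>" "\<And>x. x \<notin> S \<Longrightarrow> \<phi> x = 0"
    using Cc_infinity_C1_grad[OF \<phi>] by metis
  have \<psi>0: "\<psi> x = 0" if "x \<notin> S" for x
    by (rule C1_grad_zero_outside[OF *(1) *(2) *(4) that])
  obtain L where L: "\<And>x. norm (\<psi> x) \<le> L"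
    using continuous_compact_support_bounded[OF continuous_on_subset[OF C1_gradD(2)[OF *(1)] subset_UNIV] *(2) \<psi>0] by blast
  show "energy 1 \<phi> < \<infinity>" by (rule energy_C1_finite[OF *(1) L])
  show "(\<integral>\<^sup>+x. ennreal ((\<phi> x)\<^sup>2) \<partial>M) \<le> ennreal poincare_const * energy 1 \<phi>"
    unfolding poincare_const_def by (rule poincare_test_function[OF * eta_le m_nonneg domain_radius])
qed

text \<open>Membership in \<open>W0\<close> only provides nearby test functions. These have finite
  energy and satisfy the Poincare inequality, and both facts survive the limit. The 4 consists of
  one factor 2 for splitting the square of \<open>u\<close> and another for splitting the energy.
  Nearness is measured with radius \<open>R\<close> and transferred to radius 1 by
  \<open>energy_chain\<close>.\<close>

lemma W0_properties:
  assumes u: "u \<in> W0 \<Omega> R \<eta>"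
  shows "u \<in> borel_measurable M" "energy 1 u < \<infinity>" "(\<integral>\<^sup>+x. ennreal ((u x)\<^sup>2) \<partial>M) \<le> ennreal (4 * poincare_const) * energy 1 u"
proof -
  show um[measurable]: "u \<in> borel_measurable M" using u by (simp add: W0_def)
  define E where "E = energy 1 u"
  have approx: "\<exists>\<phi>. \<phi> \<in> Cc_infinity \<Omega> \<and> (\<integral>\<^sup>+x. ennreal ((u x - \<phi> x)\<^sup>2) \<partial>M) \<le> ennreal (\<epsilon>\<^sup>2) \<and> energy 1 (\<lambda>x. u x - \<phi> x) \<le> ennreal (radius_const * \<epsilon>\<^sup>2)"
    if \<epsilon>: "\<epsilon> > 0" for \<epsilon>
  proof -
    obtain \<phi> where \<phi>: "\<phi> \<in> Cc_infinity \<Omega>" "W_norm_sq \<Omega> R \<eta> (\<lambda>x. u x - \<phi> x) < ennreal (\<epsilon>\<^sup>2)"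
      using u \<epsilon> unfolding W0_def by blast
    have [measurable]: "\<phi> \<in> borel_measurable M" by (rule Cc_infinity_measurable[OF \<phi>(1)])
    have W: "(\<integral>\<^sup>+x. ennreal ((u x - \<phi> x)\<^sup>2) \<partial>M) + energy R (\<lambda>x. u x - \<phi> x) \<le> ennreal (\<epsilon>\<^sup>2)"
      using less_imp_le[OF \<phi>(2)] unfolding W_norm_sq_eq .
    have 1: "(\<integral>\<^sup>+x. ennreal ((u x - \<phi> x)\<^sup>2) \<partial>M) \<le> ennreal (\<epsilon>\<^sup>2)"
      by (rule order_trans[OF _ W]) simp
    have 2: "energy R (\<lambda>x. u x - \<phi> x) \<le> ennreal (\<epsilon>\<^sup>2)"
      by (rule order_trans[OF _ W]) simp
    have "energy 1 (\<lambda>x. u x - \<phi> x) \<le> ennreal radius_const * energy R (\<lambda>x. u x - \<phi> x)"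
      unfolding radius_const_def by (rule energy_chain[OF _ R(1)]) measurable
    also have "\<dots> \<le> ennreal radius_const * ennreal (\<epsilon>\<^sup>2)" by (rule mult_left_mono[OF 2]) simp
    also have "\<dots> = ennreal (radius_const * \<epsilon>\<^sup>2)" using radius_poincare_const_nonneg by (simp add: ennreal_mult)
    finally show ?thesis using \<phi>(1) 1 by blast
  qed
  show fin: "energy 1 u < \<infinity>"
  proof -
    obtain \<phi> where \<phi>: "\<phi> \<in> Cc_infinity \<Omega>" "energy 1 (\<lambda>x. u x - \<phi> x) \<le> ennreal (radius_const * 1\<^sup>2)"
      using approx[of 1] by auto
    have [measurable]: "\<phi> \<in> borel_measurable M" by (rule Cc_infinity_measurable[OF \<phi>(1)])
    have "energy 1 (\<lambda>x. (u x - \<phi> x) + \<phi> x) \<le> 2 * energy 1 (\<lambda>x. u x - \<phi> x) + 2 * energy 1 \<phi>"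
      by (rule energy_add_le) measurable
    also have "\<dots> \<le> 2 * ennreal (radius_const * 1\<^sup>2) + 2 * energy 1 \<phi>" by (intro add_right_mono mult_left_mono \<phi>(2)) simp
    also have "\<dots> < \<infinity>" using test_function_energy(1)[OF \<phi>(1)] by (simp add: ennreal_mult_eq_top_iff ennreal_add_eq_top less_top[symmetric])
    finally show ?thesis by simp
  qed
  show "(\<integral>\<^sup>+x. ennreal ((u x)\<^sup>2) \<partial>M) \<le> ennreal (4 * poincare_const) * energy 1 u"
  proof (rule ennreal_le_epsilon)
    fix e :: real assume e: "e > 0"
    \<comment> \<open>Collects the coefficients of the error \<epsilon>^2 in the final sum, so that
      \<epsilon> can be chosen to make this error equal to \<open>e\<close>.\<close>
    define c where "c = 2 + 4 * poincare_const * radius_const"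
    have c: "c > 0" using radius_poincare_const_nonneg by (simp add: c_def add_pos_nonneg)
    define \<epsilon> where "\<epsilon> = sqrt (e / c)"
    have \<epsilon>: "\<epsilon> > 0" "c * \<epsilon>\<^sup>2 = e" using e c by (auto simp: \<epsilon>_def)
    obtain \<phi> where \<phi>: "\<phi> \<in> Cc_infinity \<Omega>" "(\<integral>\<^sup>+x. ennreal ((u x - \<phi> x)\<^sup>2) \<partial>M) \<le> ennreal (\<epsilon>\<^sup>2)"
        "energy 1 (\<lambda>x. u x - \<phi> x) \<le> ennreal (radius_const * \<epsilon>\<^sup>2)"
      using approx[OF \<epsilon>(1)] by blast
    have [measurable]: "\<phi> \<in> borel_measurable M" by (rule Cc_infinity_measurable[OF \<phi>(1)])
    have "energy 1 (\<lambda>x. (-1) * (u x - \<phi> x) + u x) \<le> 2 * energy 1 (\<lambda>x. (-1) * (u x - \<phi> x)) + 2 * energy 1 u"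
      by (rule energy_add_le) measurable
    also have "energy 1 (\<lambda>x. (-1) * (u x - \<phi> x)) = ennreal ((-1)\<^sup>2) * energy 1 (\<lambda>x. u x - \<phi> x)"
      by (rule energy_cmult) measurable
    finally have "energy 1 \<phi> \<le> 2 * energy 1 (\<lambda>x. u x - \<phi> x) + 2 * energy 1 u" by simp
    then have e\<phi>: "energy 1 \<phi> \<le> 2 * ennreal (radius_const * \<epsilon>\<^sup>2) + 2 * energy 1 u"
      by (rule order_trans) (intro add_right_mono mult_left_mono \<phi>(3), simp)
    have "(\<integral>\<^sup>+x. ennreal ((u x)\<^sup>2) \<partial>M) \<le> (\<integral>\<^sup>+x. 2 * ennreal ((u x - \<phi> x)\<^sup>2) + 2 * ennreal ((\<phi> x)\<^sup>2) \<partial>M)"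
    proof (rule nn_integral_mono)
      fix x
      have "0 \<le> (u x - 2 * \<phi> x)\<^sup>2" by simp
      then have "(u x)\<^sup>2 \<le> 2 * (u x - \<phi> x)\<^sup>2 + 2 * (\<phi> x)\<^sup>2" by (simp add: power2_eq_square algebra_simps)
      then have "ennreal ((u x)\<^sup>2) \<le> ennreal (2 * (u x - \<phi> x)\<^sup>2 + 2 * (\<phi> x)\<^sup>2)" by (rule ennreal_leI)
      also have "\<dots> = 2 * ennreal ((u x - \<phi> x)\<^sup>2) + 2 * ennreal ((\<phi> x)\<^sup>2)" by (rule ennreal_double_add) auto
      finally show "ennreal ((u x)\<^sup>2) \<le> 2 * ennreal ((u x - \<phi> x)\<^sup>2) + 2 * ennreal ((\<phi> x)\<^sup>2)" .
    qed
    also have "\<dots> = 2 * (\<integral>\<^sup>+x. ennreal ((u x - \<phi> x)\<^sup>2) \<partial>M) + 2 * (\<integral>\<^sup>+x. ennreal ((\<phi> x)\<^sup>2) \<partial>M)"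
      by (simp add: nn_integral_add nn_integral_cmult)
    also have "\<dots> \<le> 2 * ennreal (\<epsilon>\<^sup>2) + 2 * (ennreal poincare_const * (2 * ennreal (radius_const * \<epsilon>\<^sup>2) + 2 * energy 1 u))"
      by (intro add_mono mult_left_mono \<phi>(2) order_trans[OF test_function_energy(2)[OF \<phi>(1)]] e\<phi>) auto
    also have "\<dots> = ennreal (4 * poincare_const) * energy 1 u + ennreal e"
    proof -
      \<comment> \<open>The energy is already known to be finite, so the sum can be rearranged among
        real numbers.\<close>
      obtain a where a: "a \<ge> 0" "energy 1 u = ennreal a"
        using fin by (cases "energy 1 u" rule: ennreal_cases) auto
      have "2 * ennreal (\<epsilon>\<^sup>2) + 2 * (ennreal poincare_const * (2 * ennreal (radius_const * \<epsilon>\<^sup>2) + 2 * ennreal a)) =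
        ennreal (2 * \<epsilon>\<^sup>2 + 2 * (poincare_const * (2 * (radius_const * \<epsilon>\<^sup>2) + 2 * a)))"
        using a(1) radius_poincare_const_nonneg by (simp only: ennreal_double_add[symmetric] ennreal_mult[symmetric] zero_le_power2 mult_nonneg_nonneg add_nonneg_nonneg zero_le_numeral)
      also have "2 * \<epsilon>\<^sup>2 + 2 * (poincare_const * (2 * (radius_const * \<epsilon>\<^sup>2) + 2 * a)) = 4 * poincare_const * a + c * \<epsilon>\<^sup>2"
        by (simp add: c_def algebra_simps)
      also have "ennreal \<dots> = ennreal (4 * poincare_const) * ennreal a + ennreal e"
        using a(1) radius_poincare_const_nonneg e by (simp add: \<epsilon>(2) ennreal_plus ennreal_mult)
      finally show ?thesis by (simp only: a(2))
    qed
    finally show "(\<integral>\<^sup>+x. ennreal ((u x)\<^sup>2) \<partial>M) \<le> ennreal (4 * poincare_const) * energy 1 u + ennreal e" .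
  qed
qed

lemma W0_L2:
  assumes u: "u \<in> W0 \<Omega> R \<eta>"
  shows "u \<in> L2 \<Omega>" "(\<integral>\<^sup>+x. ennreal ((u x)\<^sup>2) \<partial>M) = ennreal ((L2_nrm \<Omega> u)\<^sup>2)"
proof -
  have "(\<integral>\<^sup>+x. ennreal ((norm (u x))\<^sup>2) \<partial>M) < \<infinity>"
    using W0_properties(2,3)[OF u] by (simp add: ennreal_mult_less_top order.strict_trans1)
  from L2_nn_integral[OF W0_properties(1)[OF u] this]
  show "u \<in> L2 \<Omega>" "(\<integral>\<^sup>+x. ennreal ((u x)\<^sup>2) \<partial>M) = ennreal ((L2_nrm \<Omega> u)\<^sup>2)" by simp_all
qed

text \<open>The norm is available only through its square in \<open>ennreal\<close>, so any positive
  \<open>N\<close> whose square bounds it stands in for the norm. Dividing \<open>u\<close> by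
  \<open>N\<close> gives a competitor in the supremum.\<close>

lemma pairing_le_dual:
  assumes f: "f \<in> L2 \<Omega>" and u: "u \<in> W0 \<Omega> R \<eta>" and N: "N > 0" "W_norm_sq \<Omega> R \<eta> u \<le> ennreal (N\<^sup>2)"
  shows "\<bar>pairing \<Omega> f u\<bar> \<le> N * W0_dual_nrm \<Omega> R \<eta> f" "0 \<le> W0_dual_nrm \<Omega> R \<eta> f"
proof -
  let ?U = "{v \<in> W0 \<Omega> R \<eta>. W_norm_sq \<Omega> R \<eta> v \<le> 1}"
  \<comment> \<open>A real supremum is informative only over a set that is bounded above; here the
    L2 part of the norm bounds the pairing.\<close>
  have bdd: "bdd_above ((\<lambda>v. \<bar>pairing \<Omega> f v\<bar>) ` ?U)"
  proof (rule bdd_aboveI2)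
    fix v assume v: "v \<in> ?U"
    then have v2: "v \<in> L2 \<Omega>" using W0_L2(1) by blast
    have "(\<integral>\<^sup>+x. ennreal ((v x)\<^sup>2) \<partial>M) \<le> W_norm_sq \<Omega> R \<eta> v" by (simp add: W_norm_sq_eq)
    also have "\<dots> \<le> 1" using v by simp
    finally have "ennreal ((L2_nrm \<Omega> v)\<^sup>2) \<le> ennreal 1" using W0_L2(2)[of v] v by simp
    then have nv: "(LINT x|M. (norm (v x))\<^sup>2) \<le> 1" unfolding L2_nrm_sq by (subst (asm) ennreal_le_iff) auto
    have "\<bar>pairing \<Omega> f v\<bar> \<le> (LINT x|M. \<bar>f x * v x\<bar>)" unfolding pairing_def by (rule integral_abs_bound)
    also have "\<dots> \<le> (LINT x|M. (norm (f x))\<^sup>2 + (norm (v x))\<^sup>2)"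
    proof (rule integral_mono)
      fix x
      have "2 * \<bar>f x\<bar> * \<bar>v x\<bar> \<le> \<bar>f x\<bar>\<^sup>2 + \<bar>v x\<bar>\<^sup>2" by (rule sum_squares_bound)
      moreover have "0 \<le> \<bar>f x\<bar> * \<bar>v x\<bar>" by simp
      ultimately show "\<bar>f x * v x\<bar> \<le> (norm (f x))\<^sup>2 + (norm (v x))\<^sup>2" unfolding abs_mult real_norm_def by linarith
    qed (use L2_mult_integrable[OF f v2] L2D(2)[OF f] L2D(2)[OF v2] in auto)
    also have "\<dots> = (LINT x|M. (norm (f x))\<^sup>2) + (LINT x|M. (norm (v x))\<^sup>2)"
      by (rule Bochner_Integration.integral_add[OF L2D(2)[OF f] L2D(2)[OF v2]])
    finally show "\<bar>pairing \<Omega> f v\<bar> \<le> (LINT x|M. (norm (f x))\<^sup>2) + 1" using nv by linarith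
  qed
  define v where "v x = (1 / N) * u x" for x
  have vW: "v \<in> W0 \<Omega> R \<eta>" unfolding v_def[abs_def] using N by (intro W0_cmult[OF u]) auto
  have "W_norm_sq \<Omega> R \<eta> v = ennreal ((1 / N)\<^sup>2) * W_norm_sq \<Omega> R \<eta> u"
    unfolding v_def[abs_def] by (rule W_norm_sq_cmult[OF W0_properties(1)[OF u]])
  also have "\<dots> \<le> ennreal ((1 / N)\<^sup>2) * ennreal (N\<^sup>2)" by (rule mult_left_mono[OF N(2)]) simp
  also have "\<dots> = 1" using N by (simp add: ennreal_mult[symmetric] power_divide)
  finally have "v \<in> ?U" using vW by simp
  then have 1: "\<bar>pairing \<Omega> f v\<bar> \<le> W0_dual_nrm \<Omega> R \<eta> f"
    unfolding W0_dual_nrm_def by (rule cSUP_upper[OF _ bdd])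
  then show "0 \<le> W0_dual_nrm \<Omega> R \<eta> f" using abs_ge_zero order_trans by blast
  have "pairing \<Omega> f v = (1 / N) * pairing \<Omega> f u"
    unfolding pairing_def v_def by (simp add: mult.left_commute[of _ "1 / N"] flip: integral_mult_right_zero)
  then have "\<bar>pairing \<Omega> f u\<bar> = N * \<bar>pairing \<Omega> f v\<bar>" using N by (simp add: abs_mult)
  then show "\<bar>pairing \<Omega> f u\<bar> \<le> N * W0_dual_nrm \<Omega> R \<eta> f" using 1 N by simp
qed

section \<open>The weak equation and the regularity estimate\<close>

context
  fixes \<sigma> :: "real \<Rightarrow> real"
  assumes sigma: "\<And>r. r \<ge> 0 \<Longrightarrow> \<sigma> r = \<rho> r"
begin

text \<open>\<open>\<sigma>\<close> stands for the kernel as given and \<open>\<rho>\<close> for a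
  Borel function that agrees with it on the half-line. The kernel is evaluated only at nonnegative
  arguments, where the two coincide.\<close>

lemma scaled_kernel_eq:
  assumes "x \<in> \<Omega>" "y \<in> \<Omega>"
  shows "scaled_kernel \<sigma> \<eta> 2 x y = ker x y"
proof -
  have e: "\<eta> x > 0" "\<eta> y > 0" using eta_pos assms by auto
  have p: "t powr (real DIM('a) + 2) = t ^ (DIM('a) + 2)" if "t > 0" for t :: real
    using powr_realpow[OF that, of "DIM('a) + 2"] by (simp add: add.commute)
  have "\<sigma> (norm (y - x) / \<eta> x) = \<rho> (norm (y - x) / \<eta> x)" "\<sigma> (norm (y - x) / \<eta> y) = \<rho> (norm (y - x) / \<eta> y)"
    using e by (intro sigma; simp)+
  then show ?thesis
    unfolding scaled_kernel_def p[OF e(1)] p[OF e(2)] ker_def ker_half_def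
    by (simp add: dist_norm norm_minus_commute)
qed

lemma Phi_eq: "x \<in> \<Omega> \<Longrightarrow> Phi \<Omega> \<sigma> \<eta> 2 x = phi x"
  unfolding Phi_def phi_def ker_op_def by (intro Bochner_Integration.integral_cong) (auto simp: scaled_kernel_eq)

lemma B_form_eq: "B_form \<Omega> \<sigma> \<eta> u v = (LINT x|M. LINT y|M. ker x y * (u x - u y) * (v x - v y))"
  unfolding B_form_def by (intro Bochner_Integration.integral_cong refl) (auto simp: scaled_kernel_eq)

text \<open>Finite energy makes the integrand integrable on the product space, where Tonelli and
  Fubini identify the extended with the Bochner double integral.\<close>

lemma ker_energy_eq_B_form:
  assumes u[measurable]: "u \<in> borel_measurable M" and fin: "energy 1 u < \<infinity>"
  shows "ker_energy u = ennreal (B_form \<Omega> \<sigma> \<eta> u u)"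
proof -
  let ?F = "\<lambda>p. ker (fst p) (snd p) * (u (fst p) - u (snd p)) * (u (fst p) - u (snd p))"
  have Fm: "?F \<in> borel_measurable (M \<Otimes>\<^sub>M M)" by measurable
  have F0: "0 \<le> ?F p" if "p \<in> space (M \<Otimes>\<^sub>M M)" for p
  proof -
    have "0 \<le> ker (fst p) (snd p) * (u (fst p) - u (snd p))\<^sup>2"
      using that by (intro mult_nonneg_nonneg ker_nonneg) (auto simp: space_pair_measure)
    then show ?thesis by (simp add: power2_eq_square mult.assoc)
  qed
  have "ker_energy u = (\<integral>\<^sup>+x. \<integral>\<^sup>+y. ennreal (?F (x, y)) \<partial>M \<partial>M)"
    by (simp add: ker_energy_def power2_eq_square mult.assoc)
  also have "\<dots> = (\<integral>\<^sup>+p. ennreal (?F p) \<partial>(M \<Otimes>\<^sub>M M))"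
    by (rule nn_integral_fst) (use Fm in measurable)
  finally have 1: "ker_energy u = (\<integral>\<^sup>+p. ennreal (?F p) \<partial>(M \<Otimes>\<^sub>M M))" .
  have "ker_energy u < \<infinity>"
    by (rule order.strict_trans1[OF ker_energy_le[OF u]]) (use fin in \<open>simp add: ennreal_mult_less_top\<close>)
  then have i: "integrable (M \<Otimes>\<^sub>M M) ?F"
    using 1 by (intro integrableI_nonneg Fm AE_I2 F0) auto
  have "(\<integral>\<^sup>+p. ennreal (?F p) \<partial>(M \<Otimes>\<^sub>M M)) = ennreal (integral\<^sup>L (M \<Otimes>\<^sub>M M) ?F)"
    by (intro nn_integral_eq_integral[OF i] AE_I2 F0)
  also have "integral\<^sup>L (M \<Otimes>\<^sub>M M) ?F = (LINT x|M. LINT y|M. ?F (x, y))"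
    by (rule P.integral_fst'[OF i, symmetric])
  finally show ?thesis unfolding 1 B_form_eq by simp
qed

text \<open>By symmetry of the kernel the two terms of \<open>\<phi> x - \<phi> y\<close> contribute
  equally. They can be separated because each is integrable: the compact support of
  \<open>\<phi>\<close> cuts off the region near the boundary where the kernel is unbounded.\<close>

lemma B_form_test_function:
  assumes u: "integrable M u" and \<phi>: "\<phi> \<in> Cc_infinity \<Omega>"
  shows "B_form \<Omega> \<sigma> \<eta> u \<phi> = (LINT x|M. 2 * (phi x * u x - ker_op u x) * \<phi> x)"
    "integrable M (\<lambda>x. 2 * (phi x * u x - ker_op u x) * \<phi> x)"
proof -
  have um[measurable]: "u \<in> borel_measurable M" using u by auto
  have [measurable]: "\<phi> \<in> borel_measurable M" by (rule Cc_infinity_measurable[OF \<phi>])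
  obtain \<psi> S where *: "C1_grad UNIV \<phi> \<psi>" "compact S" "S \<subseteq> \<Omega>" "\<And>x. x \<notin> S \<Longrightarrow> \<phi> x = 0"
    using Cc_infinity_C1_grad[OF \<phi>] by metis
  obtain L where L: "L > 0" "\<And>x. norm (\<phi> x) \<le> L"
    using continuous_compact_support_bounded[OF continuous_on_subset[OF C1_gradD(3)[OF *(1)] subset_UNIV] *(2,4)] by blast
  obtain c where c: "c > 0" "\<And>x. x \<in> S \<Longrightarrow> c \<le> \<eta> x"
  proof (cases "S = {}")
    case True
    then show ?thesis using that[of 1] by auto
  next
    case False
    obtain x0 where "x0 \<in> S" "\<And>x. x \<in> S \<Longrightarrow> \<eta> x0 \<le> \<eta> x"
      using continuous_attains_inf[OF *(2) False continuous_on_subset[OF C1_gradD(3)[OF eta_C1] *(3)]] by auto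
    then show ?thesis using that[of "\<eta> x0"] eta_pos *(3) by auto
  qed
  \<comment> \<open>On the support of \<open>\<phi>\<close> the function \<open>\<eta>\<close> is at
    least \<open>c\<close>, hence this bound on \<open>ker x y * \<phi> x\<close>.\<close>
  define Q where "Q = ker_const / c ^ (DIM('a) + 2) * L"
  have Q0: "Q \<ge> 0" using const_pos c(1) L(1) by (simp add: Q_def)
  have kQ: "\<bar>ker x y * \<phi> x\<bar> \<le> Q" if x: "x \<in> \<Omega>" and y: "y \<in> \<Omega>" for x y
  proof (cases "x \<in> S")
    case True
    have "c ^ (DIM('a) + 2) \<le> \<eta> x ^ (DIM('a) + 2)" using c(1) c(2)[OF True] by (intro power_mono) auto
    then have "ker_const / \<eta> x ^ (DIM('a) + 2) \<le> ker_const / c ^ (DIM('a) + 2)"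
      using c(1) const_pos eta_pos[OF x] by (intro divide_left_mono) auto
    then have "ker x y \<le> ker_const / c ^ (DIM('a) + 2)" using ker_bound[OF x y] unfolding ker_const_def by linarith
    then have "ker x y * \<bar>\<phi> x\<bar> \<le> Q"
      unfolding Q_def using L(2)[of x] ker_nonneg[OF x y] const_pos c(1) by (intro mult_mono) auto
    then show ?thesis using ker_nonneg[OF x y] by (simp add: abs_mult)
  next
    case False
    then show ?thesis using *(4) Q0 by simp
  qed
  let ?F = "\<lambda>p. ker (fst p) (snd p) * (u (fst p) - u (snd p)) * \<phi> (fst p)"
  have Fm: "?F \<in> borel_measurable (M \<Otimes>\<^sub>M M)" by measurable
  have iu: "integrable (M \<Otimes>\<^sub>M M) (\<lambda>p. u (fst p))"
  proof (rule integrableI_bounded)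
    show "(\<lambda>p. u (fst p)) \<in> borel_measurable (M \<Otimes>\<^sub>M M)" by measurable
    have "(\<integral>\<^sup>+p. ennreal (norm (u (fst p))) \<partial>(M \<Otimes>\<^sub>M M)) = (\<integral>\<^sup>+x. \<integral>\<^sup>+y. ennreal (norm (u (fst (x, y)))) \<partial>M \<partial>M)"
      by (rule nn_integral_fst[symmetric]) measurable
    also have "\<dots> = (\<integral>\<^sup>+x. ennreal (norm (u x)) * emeasure M \<Omega> \<partial>M)" by simp
    also have "\<dots> = (\<integral>\<^sup>+x. ennreal (norm (u x)) \<partial>M) * emeasure M \<Omega>" by (rule nn_integral_multc) measurable
    also have "\<dots> < \<infinity>"
    proof -
      have "emeasure M \<Omega> < top" using emeasure_finite[of \<Omega>] by (metis infinity_ennreal_def less_top)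
      moreover have "(\<integral>\<^sup>+x. ennreal (norm (u x)) \<partial>M) < \<infinity>" using u by (simp add: integrable_iff_bounded)
      ultimately show ?thesis by (simp add: ennreal_mult_less_top)
    qed
    finally show "(\<integral>\<^sup>+p. ennreal (norm (u (fst p))) \<partial>(M \<Otimes>\<^sub>M M)) < \<infinity>" .
  qed
  have iu': "integrable (M \<Otimes>\<^sub>M M) (\<lambda>p. u (snd p))"
    using P.integrable_product_swap[OF iu] by (simp add: split_beta')
  have iF: "integrable (M \<Otimes>\<^sub>M M) ?F"
  proof (rule Bochner_Integration.integrable_bound)
    show "integrable (M \<Otimes>\<^sub>M M) (\<lambda>p. Q * (\<bar>u (fst p)\<bar> + \<bar>u (snd p)\<bar>))"
      using iu iu' by (intro integrable_mult_right Bochner_Integration.integrable_add integrable_abs)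
    show "AE p in M \<Otimes>\<^sub>M M. norm (?F p) \<le> norm (Q * (\<bar>u (fst p)\<bar> + \<bar>u (snd p)\<bar>))"
    proof (rule AE_I2)
      fix p assume "p \<in> space (M \<Otimes>\<^sub>M M)"
      then have p: "fst p \<in> \<Omega>" "snd p \<in> \<Omega>" by (auto simp: space_pair_measure)
      have "norm (?F p) = \<bar>ker (fst p) (snd p) * \<phi> (fst p)\<bar> * \<bar>u (fst p) - u (snd p)\<bar>"
        by (simp add: abs_mult)
      also have "\<dots> \<le> Q * (\<bar>u (fst p)\<bar> + \<bar>u (snd p)\<bar>)"
        using Q0 by (intro mult_mono kQ p abs_triangle_ineq4) auto
      also have "\<dots> \<le> norm \<dots>" by simp
      finally show "norm (?F p) \<le> norm (Q * (\<bar>u (fst p)\<bar> + \<bar>u (snd p)\<bar>))" .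
    qed
  qed (rule Fm)
  have iF': "integrable (M \<Otimes>\<^sub>M M) (\<lambda>p. ?F (snd p, fst p))"
    using P.integrable_product_swap[OF iF] by (simp add: split_beta')
  have swap: "integral\<^sup>L (M \<Otimes>\<^sub>M M) (\<lambda>p. ?F (snd p, fst p)) = integral\<^sup>L (M \<Otimes>\<^sub>M M) ?F"
    using P.integral_product_swap[OF Fm] by (simp add: split_beta')
  have inner: "(LINT y|M. ?F (x, y)) = (phi x * u x - ker_op u x) * \<phi> x" if x: "x \<in> \<Omega>" for x
  proof -
    have i1: "integrable M (\<lambda>y. ker x y * 1 * (u x * \<phi> x))"
      by (rule integrable_mult_left[OF ker_mult_integrable[OF x integrable_const]])
    have i2: "integrable M (\<lambda>y. ker x y * u y * \<phi> x)"
      by (rule integrable_mult_left[OF ker_mult_integrable[OF x u]])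
    have "(LINT y|M. ?F (x, y)) = (LINT y|M. ker x y * 1 * (u x * \<phi> x) - ker x y * u y * \<phi> x)"
      by (intro Bochner_Integration.integral_cong) (auto simp: algebra_simps)
    also have "\<dots> = (LINT y|M. ker x y * 1 * (u x * \<phi> x)) - (LINT y|M. ker x y * u y * \<phi> x)"
      by (rule Bochner_Integration.integral_diff[OF i1 i2])
    also have "(LINT y|M. ker x y * 1 * (u x * \<phi> x)) = phi x * (u x * \<phi> x)"
      unfolding phi_def ker_op_def by (rule integral_mult_left_zero)
    also have "(LINT y|M. ker x y * u y * \<phi> x) = ker_op u x * \<phi> x"
      unfolding ker_op_def by (rule integral_mult_left_zero)
    finally show ?thesis by (simp add: algebra_simps)
  qed
  have iI: "integrable M (\<lambda>x. LINT y|M. ?F (x, y))"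
    using P.integrable_fst'[OF iF] .
  have "integrable M (\<lambda>x. LINT y|M. ?F (x, y)) \<longleftrightarrow> integrable M (\<lambda>x. (phi x * u x - ker_op u x) * \<phi> x)"
    by (rule Bochner_Integration.integrable_cong[OF refl]) (rule inner, simp)
  from integrable_mult_right[OF iffD1[OF this iI], of 2]
  show "integrable M (\<lambda>x. 2 * (phi x * u x - ker_op u x) * \<phi> x)" by (simp only: mult.assoc)
  \<comment> \<open>The integrand of the form is \<open>?F\<close> plus \<open>?F\<close> with its
    two arguments exchanged.\<close>
  have "B_form \<Omega> \<sigma> \<eta> u \<phi> = (LINT x|M. LINT y|M. ?F (x, y) + ?F (snd (x, y), fst (x, y)))"
    unfolding B_form_eq by (intro Bochner_Integration.integral_cong refl) (simp add: ker_sym algebra_simps)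
  also have "\<dots> = integral\<^sup>L (M \<Otimes>\<^sub>M M) (\<lambda>p. ?F p + ?F (snd p, fst p))"
    by (rule P.integral_fst'[OF Bochner_Integration.integrable_add[OF iF iF']])
  also have "\<dots> = 2 * integral\<^sup>L (M \<Otimes>\<^sub>M M) ?F"
    unfolding Bochner_Integration.integral_add[OF iF iF'] swap by simp
  also have "integral\<^sup>L (M \<Otimes>\<^sub>M M) ?F = (LINT x|M. LINT y|M. ?F (x, y))"
    by (rule P.integral_fst'[OF iF, symmetric])
  also have "\<dots> = (LINT x|M. (phi x * u x - ker_op u x) * \<phi> x)"
    by (intro Bochner_Integration.integral_cong refl) (rule inner, simp)
  finally show "B_form \<Omega> \<sigma> \<eta> u \<phi> = (LINT x|M. 2 * (phi x * u x - ker_op u x) * \<phi> x)"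
    by (simp only: mult.assoc integral_mult_right_zero)
qed

lemma Cc_infinity_subset_W0: "Cc_infinity \<Omega> \<subseteq> W0 \<Omega> R \<eta>"
proof
  fix \<phi> assume \<phi>: "\<phi> \<in> Cc_infinity \<Omega>"
  have "W_norm_sq \<Omega> R \<eta> (\<lambda>x. \<phi> x - \<phi> x) = 0" by (simp add: W_norm_sq_eq energy_def cong: if_cong)
  then show "\<phi> \<in> W0 \<Omega> R \<eta>"
    unfolding W0_def using \<phi> Cc_infinity_measurable[OF \<phi>] by (auto intro!: bexI[of _ \<phi>])
qed

text \<open>\<open>phi\<close> blows up at the boundary like \<eta>^-2 at least, so the residual of
  the equation is only locally integrable. Therefore the fundamental lemma is used in its form for
  functions integrable over closed boxes in \<open>\<Omega>\<close>.\<close>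

lemma weak_solution_AE:
  assumes f: "f \<in> L2 \<Omega>" and w: "weak_solution \<Omega> R \<sigma> \<eta> f u"
  shows "AE x in M. u x = average u x + 1 / 2 * (inverse (Phi \<Omega> \<sigma> \<eta> 2 x) * f x)"
proof -
  have u: "u \<in> W0 \<Omega> R \<eta>" using w by (simp add: weak_solution_def)
  have iu: "integrable M u" by (rule L2_integrable[OF open_domain bounded_domain W0_L2(1)[OF u]])
  have if': "integrable M f" by (rule L2_integrable[OF open_domain bounded_domain f])
  have "AE x in M. 2 * (phi x * u x - ker_op u x) - f x = 0"
  proof (rule fundamental_lemma_variations[OF open_domain])
    fix a c :: 'a assume ac: "cbox a c \<subseteq> \<Omega>"
    have sub: "integrable (lebesgue_on (cbox a c)) v" if "integrable M v" for v :: "'a \<Rightarrow> real"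
      by (rule integrable_lebesgue_on_subset[OF that ac]) (use open_domain in auto)
    have one: "integrable (lebesgue_on (cbox a c)) (\<lambda>x. 1 :: real)"
      by (rule sub) simp
    have i1: "integrable (lebesgue_on (cbox a c)) (\<lambda>x. u x * phi x)"
      by (rule integrable_continuous_mult_cbox[OF sub[OF iu] continuous_on_subset[OF C1_gradD(3)[OF phi_C1] ac]])
    have i2: "integrable (lebesgue_on (cbox a c)) (\<lambda>x. 1 * ker_op u x)"
      by (rule integrable_continuous_mult_cbox[OF one continuous_on_subset[OF C1_gradD(3)[OF ker_op_C1[OF iu]] ac]])
    show "integrable (lebesgue_on (cbox a c)) (\<lambda>x. 2 * (phi x * u x - ker_op u x) - f x)"
      using i1 i2 sub[OF if'] by (intro Bochner_Integration.integrable_diff integrable_mult_right) (auto simp: mult.commute)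
  next
    fix \<phi> assume \<phi>: "\<phi> \<in> Cc_infinity \<Omega>"
    have if\<phi>: "integrable M (\<lambda>x. f x * \<phi> x)"
      using L2_mult_integrable[OF f W0_L2(1)] Cc_infinity_subset_W0 \<phi> by blast
    have "(LINT x|M. (2 * (phi x * u x - ker_op u x) - f x) * \<phi> x) =
        (LINT x|M. 2 * (phi x * u x - ker_op u x) * \<phi> x - f x * \<phi> x)"
      by (simp add: left_diff_distrib)
    also have "\<dots> = B_form \<Omega> \<sigma> \<eta> u \<phi> - pairing \<Omega> f \<phi>"
      unfolding B_form_test_function(1)[OF iu \<phi>] pairing_def
      by (rule Bochner_Integration.integral_diff[OF B_form_test_function(2)[OF iu \<phi>] if\<phi>])
    also have "\<dots> = 0"
      using w Cc_infinity_subset_W0 \<phi> unfolding weak_solution_def by auto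
    finally show "(LINT x|M. (2 * (phi x * u x - ker_op u x) - f x) * \<phi> x) = 0" .
  qed
  moreover have "AE x in M. x \<in> \<Omega>" by (rule AE_I2) simp
  ultimately show ?thesis
  proof eventually_elim
    case (elim x)
    have "phi x > 0" by (rule phi_pos[OF elim(2)])
    then show ?case using elim(1) by (simp add: Phi_eq[OF elim(2)] average_def field_simps)
  qed
qed

text \<open>The chain from radius 1 down to \<open>r0\<close>, followed by the lower bound of the
  kernel.\<close>

definition coercivity_const :: real where "coercivity_const = chain_const DIM('a) ^ chain_steps r0 * (2 / \<rho>0)"

lemma coercivity_const_nonneg: "coercivity_const \<ge> 0"
  using chain_const_pos[of "DIM('a)"] rho_lower by (simp add: coercivity_const_def)

text \<open>Coercivity bounds the energy by a multiple of the pairing of \<open>f\<close> with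
  \<open>u\<close>. The dual norm bounds this pairing by the norm of \<open>u\<close>, which the
  Poincare inequality reduces to the square root of the energy. One such root cancels.\<close>

lemma weak_solution_energy:
  assumes f: "f \<in> L2 \<Omega>" and w: "weak_solution \<Omega> R \<sigma> \<eta> f u"
  shows "energy 1 u \<le> ennreal (coercivity_const\<^sup>2 * (4 * poincare_const + 1) * (W0_dual_nrm \<Omega> R \<eta> f)\<^sup>2)"
    "0 \<le> W0_dual_nrm \<Omega> R \<eta> f"
proof -
  have u: "u \<in> W0 \<Omega> R \<eta>" using w by (simp add: weak_solution_def)
  note um = W0_properties(1)[OF u]
  obtain e where e: "e \<ge> 0" "energy 1 u = ennreal e"
    using W0_properties(2)[OF u] by (cases "energy 1 u" rule: ennreal_cases) auto
  let ?d = "W0_dual_nrm \<Omega> R \<eta> f" and ?b = "B_form \<Omega> \<sigma> \<eta> u u"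
  have cp: "4 * poincare_const + 1 > 0" using radius_poincare_const_nonneg by linarith
  have W: "W_norm_sq \<Omega> R \<eta> u \<le> ennreal ((4 * poincare_const + 1) * e)"
  proof -
    have "W_norm_sq \<Omega> R \<eta> u \<le> ennreal (4 * poincare_const) * energy 1 u + energy 1 u"
      unfolding W_norm_sq_eq using R by (intro add_mono W0_properties(3)[OF u] energy_mono) auto
    also have "\<dots> = ennreal (4 * poincare_const * e + e)" using e radius_poincare_const_nonneg by (simp add: ennreal_plus ennreal_mult)
    finally show ?thesis by (simp add: algebra_simps)
  qed
  \<comment> \<open>The added 1 keeps the bound positive even for zero energy; it is used only to
    obtain the sign of the dual norm.\<close>
  have "W_norm_sq \<Omega> R \<eta> u \<le> ennreal ((sqrt ((4 * poincare_const + 1) * e) + 1)\<^sup>2)"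
  proof (rule order_trans[OF W ennreal_leI])
    have "(4 * poincare_const + 1) * e = (sqrt ((4 * poincare_const + 1) * e))\<^sup>2" using e cp by simp
    also have "\<dots> \<le> (sqrt ((4 * poincare_const + 1) * e) + 1)\<^sup>2" using e cp by (intro power_mono) auto
    finally show "(4 * poincare_const + 1) * e \<le> (sqrt ((4 * poincare_const + 1) * e) + 1)\<^sup>2" .
  qed
  moreover have "sqrt ((4 * poincare_const + 1) * e) + 1 > 0" using e cp by (simp add: add_nonneg_pos)
  ultimately show d0: "0 \<le> ?d" by (intro pairing_le_dual(2)[OF f u])
  have eb: "e \<le> coercivity_const * \<bar>?b\<bar>"
  proof -
    have "energy 1 u \<le> ennreal (chain_const DIM('a) ^ chain_steps r0) * energy r0 u"
      by (rule energy_chain[OF um rho_lower(2)])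
    also have "\<dots> \<le> ennreal (chain_const DIM('a) ^ chain_steps r0) * (ennreal (2 / \<rho>0) * ker_energy u)"
      by (intro mult_left_mono energy_le_ker_energy um) simp
    also have "\<dots> \<le> ennreal (chain_const DIM('a) ^ chain_steps r0) * (ennreal (2 / \<rho>0) * ennreal \<bar>?b\<bar>)"
      unfolding ker_energy_eq_B_form[OF um W0_properties(2)[OF u]] by (intro mult_left_mono ennreal_leI) auto
    also have "\<dots> = ennreal (coercivity_const * \<bar>?b\<bar>)"
      using chain_const_pos[of "DIM('a)"] rho_lower(1) by (simp add: coercivity_const_def ennreal_mult[symmetric] mult.assoc)
    finally show ?thesis unfolding e(2) using coercivity_const_nonneg by (subst (asm) ennreal_le_iff) auto
  qed
  have "e \<le> coercivity_const\<^sup>2 * (4 * poincare_const + 1) * ?d\<^sup>2"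
  \<comment> \<open>Zero energy is treated separately because the inequality for e^2 is divided by
    \<open>e\<close>.\<close>
  proof (cases "e = 0")
    case True
    then show ?thesis using cp by simp
  next
    case False
    then have ep: "e > 0" using e by simp
    define N where "N = sqrt ((4 * poincare_const + 1) * e)"
    have N: "N > 0" "N\<^sup>2 = (4 * poincare_const + 1) * e" using ep cp by (auto simp: N_def)
    have "?b = pairing \<Omega> f u" using w u unfolding weak_solution_def by blast
    then have "\<bar>?b\<bar> \<le> N * ?d" using pairing_le_dual(1)[OF f u N(1)] W N(2) by simp
    then have "e \<le> coercivity_const * (N * ?d)" using eb coercivity_const_nonneg mult_left_mono order_trans by blast
    then have "e\<^sup>2 \<le> (coercivity_const * (N * ?d))\<^sup>2" using ep by (intro power_mono) auto
    also have "\<dots> = e * (coercivity_const\<^sup>2 * (4 * poincare_const + 1) * ?d\<^sup>2)" by (simp add: power_mult_distrib N(2))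
    finally show ?thesis using ep by (simp add: power2_eq_square)
  qed
  then show "energy 1 u \<le> ennreal (coercivity_const\<^sup>2 * (4 * poincare_const + 1) * ?d\<^sup>2)" unfolding e(2) by (rule ennreal_leI)
qed

text \<open>The square root is the coefficient that multiplies the dual norm; the 1 covers the other
  norm.\<close>

definition regularity_const :: real where
  "regularity_const = 1 + sqrt ((4 * poincare_const + 2 * (average_const\<^sup>2 * osc_const)) * (coercivity_const\<^sup>2 * (4 * poincare_const + 1)))"

text \<open>Both memberships in H1 belong to the conclusion because \<open>H1_nrm\<close> has a
  meaning only there.\<close>

lemma regularity_estimate:
  assumes f: "f \<in> H1 \<Omega>" and w: "weak_solution \<Omega> R \<sigma> \<eta> f u"
  shows "u \<in> H1 \<Omega>" "(\<lambda>x. inverse (Phi \<Omega> \<sigma> \<eta> 2 x) * f x) \<in> H1 \<Omega>"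
    "H1_nrm \<Omega> u \<le> regularity_const * (W0_dual_nrm \<Omega> R \<eta> f + H1_nrm \<Omega> (\<lambda>x. inverse (Phi \<Omega> \<sigma> \<eta> 2 x) * f x))"
proof -
  obtain F where f2: "f \<in> L2 \<Omega>" and F: "F \<in> L2 \<Omega>" "weak_gradient \<Omega> f F"
    using f by (auto simp: H1_def)
  note int = L2_integrable[OF open_domain bounded_domain]
  have u: "u \<in> W0 \<Omega> R \<eta>" using w by (simp add: weak_solution_def)
  note um = W0_properties(1)[OF u]
  have u2: "u \<in> L2 \<Omega>" by (rule W0_L2(1)[OF u])
  define i where "i x = inverse (Phi \<Omega> \<sigma> \<eta> 2 x)" for x
  define \<mu> where "\<mu> x = - (inverse (phi x))\<^sup>2 *\<^sub>R phi_grad x" for x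
  have i: "C1_grad \<Omega> i \<mu>"
    unfolding i_def[abs_def] \<mu>_def[abs_def]
    by (rule C1_grad_cong[OF inverse_phi_C1 open_domain]) (simp add: Phi_eq)
  \<comment> \<open>One bound for both \<open>i\<close> and its gradient, as
    \<open>weak_gradient_mult\<close> works with a single constant.\<close>
  define L where "L = m\<^sup>2 / phi_const + phi_grad_const / phi_const\<^sup>2 * m"
  have iL: "\<bar>i x\<bar> \<le> L" and \<mu>L: "norm (\<mu> x) \<le> L" if x: "x \<in> \<Omega>" for x
  proof -
    have ex: "\<eta> x > 0" by (rule eta_pos[OF x])
    have nn: "0 \<le> m\<^sup>2 / phi_const" "0 \<le> phi_grad_const / phi_const\<^sup>2 * m" using const_pos m_nonneg by auto
    have "\<bar>i x\<bar> \<le> (\<eta> x)\<^sup>2 / phi_const" using inverse_phi[OF x] by (simp add: i_def Phi_eq[OF x])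
    also have "\<dots> \<le> m\<^sup>2 / phi_const" using eta_le[OF x] ex const_pos by (intro divide_right_mono power_mono) auto
    finally show "\<bar>i x\<bar> \<le> L" using nn by (simp add: L_def)
    have "norm (\<mu> x) \<le> phi_grad_const / phi_const\<^sup>2 * \<eta> x" unfolding \<mu>_def by (rule grad_inverse_phi_bound[OF x])
    also have "\<dots> \<le> phi_grad_const / phi_const\<^sup>2 * m" using eta_le[OF x] const_pos by (intro mult_left_mono) auto
    finally show "norm (\<mu> x) \<le> L" using nn by (simp add: L_def)
  qed
  define p where "p x = i x * f x" for x
  define pg where "pg x = i x *\<^sub>R F x + f x *\<^sub>R \<mu> x" for x
  have im: "i \<in> borel_measurable M" "\<mu> \<in> borel_measurable M"
    using C1_gradD(2,3)[OF i] by (auto intro: borel_measurable_lebesgue_on_continuous[OF open_domain])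
  have p2: "p \<in> L2 \<Omega>"
    using L2_scaleR_bounded[OF im(1) iL f2] by (simp add: p_def[abs_def])
  have pg2: "pg \<in> L2 \<Omega>"
    unfolding pg_def[abs_def]
    by (rule L2_add[OF L2_scaleR_bounded[OF im(1) iL F(1)] L2_scaleR_bounded'[OF im(2) \<mu>L f2]])
  have pw: "weak_gradient \<Omega> p pg"
    unfolding p_def[abs_def] pg_def[abs_def]
    by (rule weak_gradient_mult[OF open_domain int[OF f2] int[OF F(1)] F(2) i iL \<mu>L])
  obtain e where e: "e \<ge> 0" "energy 1 u = ennreal e"
    using W0_properties(2)[OF u] by (cases "energy 1 u" rule: ennreal_cases) auto
  let ?d = "W0_dual_nrm \<Omega> R \<eta> f"
  have eb: "e \<le> coercivity_const\<^sup>2 * (4 * poincare_const + 1) * ?d\<^sup>2" and d0: "?d \<ge> 0"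
    using weak_solution_energy[OF f2 w] radius_poincare_const_nonneg by (auto simp: e(2) ennreal_le_iff)
  have nu: "(L2_nrm \<Omega> u)\<^sup>2 \<le> 4 * poincare_const * e"
  proof -
    have "ennreal ((L2_nrm \<Omega> u)\<^sup>2) \<le> ennreal (4 * poincare_const * e)"
      using W0_properties(3)[OF u] radius_poincare_const_nonneg e(1) unfolding W0_L2(2)[OF u] e(2) by (simp add: ennreal_mult)
    then show ?thesis using radius_poincare_const_nonneg e(1) by (simp add: ennreal_le_iff)
  qed
  have TC: "C1_grad \<Omega> (average u) (average_grad u)" by (rule average_C1[OF int[OF u2]])
  have Tm: "average u \<in> borel_measurable M" "average_grad u \<in> borel_measurable M"
    using C1_gradD(2,3)[OF TC] by (auto intro: borel_measurable_lebesgue_on_continuous[OF open_domain])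
  have DTb: "(\<integral>\<^sup>+x. ennreal ((norm (average_grad u x))\<^sup>2) \<partial>M) \<le> ennreal (average_const\<^sup>2 * osc_const * e)"
    using average_grad_square_le[OF int[OF u2]] e osc_const_nonneg by (simp add: ennreal_mult)
  then have DTf: "(\<integral>\<^sup>+x. ennreal ((norm (average_grad u x))\<^sup>2) \<partial>M) < \<infinity>"
    by (simp add: order.strict_trans1)
  note DT2 = L2_nn_integral[OF Tm(2) DTf]
  have nDT: "(L2_nrm \<Omega> (average_grad u))\<^sup>2 \<le> average_const\<^sup>2 * osc_const * e"
    using DTb osc_const_nonneg e(1) unfolding DT2(2) by (simp add: ennreal_le_iff)
  \<comment> \<open>The average is square integrable because \<open>u\<close> and the difference
    between \<open>u\<close> and the average are.\<close>
  have T2: "average u \<in> L2 \<Omega>"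
  proof -
    have "(\<integral>\<^sup>+x. ennreal ((u x - average u x)\<^sup>2) \<partial>M) < \<infinity>"
      by (rule order.strict_trans1[OF average_diff_square_le[OF int[OF u2] eta_le m_nonneg]])
        (simp_all add: e(2) ennreal_mult_less_top)
    then have "(\<lambda>x. u x - average u x) \<in> L2 \<Omega>"
      using um Tm(1) by (intro L2_nn_integral(1)) auto
    from L2_add[OF u2 L2_scaleR[OF this, of "-1"]] show ?thesis by simp
  qed
  define G where "G x = average_grad u x + (1/2) *\<^sub>R pg x" for x
  have G2: "G \<in> L2 \<Omega>" unfolding G_def[abs_def] by (rule L2_add[OF DT2(1) L2_scaleR[OF pg2]])
  have uw: "weak_gradient \<Omega> u G"
    unfolding G_def[abs_def]
  proof (rule weak_gradient_add[OF open_domain int[OF T2] int[OF DT2(1)] weak_gradient_C1[OF open_domain TC]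
        int[OF p2] int[OF pg2] pw um])
    show "AE x in M. u x = average u x + 1 / 2 * p x"
      using weak_solution_AE[OF f2 w] by (simp add: p_def i_def)
  qed
  show "u \<in> H1 \<Omega>" by (rule H1I[OF u2 G2 uw])
  have peq: "(\<lambda>x. inverse (Phi \<Omega> \<sigma> \<eta> 2 x) * f x) = p" by (simp add: p_def i_def fun_eq_iff)
  show "(\<lambda>x. inverse (Phi \<Omega> \<sigma> \<eta> 2 x) * f x) \<in> H1 \<Omega>"
    unfolding peq by (rule H1I[OF p2 pg2 pw])
  define h where "h = H1_nrm \<Omega> p"
  have h: "h = sqrt ((L2_nrm \<Omega> p)\<^sup>2 + (L2_nrm \<Omega> pg)\<^sup>2)"
    unfolding h_def by (rule H1_nrm_eq[OF open_domain bounded_domain pg2 pw])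
  have h0: "h \<ge> 0" "(L2_nrm \<Omega> pg)\<^sup>2 \<le> h\<^sup>2" by (auto simp: h)
  have nG: "(L2_nrm \<Omega> G)\<^sup>2 \<le> 2 * (L2_nrm \<Omega> (average_grad u))\<^sup>2 + (L2_nrm \<Omega> pg)\<^sup>2"
  proof -
    have "(LINT x|M. (norm (G x))\<^sup>2) \<le> (LINT x|M. 2 * (norm (average_grad u x))\<^sup>2 + (norm (pg x))\<^sup>2)"
    proof (rule integral_mono)
      fix x
      have "(norm (G x))\<^sup>2 \<le> (norm (average_grad u x) + norm (pg x) / 2)\<^sup>2"
        unfolding G_def using norm_triangle_ineq[of "average_grad u x" "(1/2) *\<^sub>R pg x"] by (intro power_mono) auto
      also have "\<dots> \<le> 2 * (norm (average_grad u x))\<^sup>2 + (norm (pg x))\<^sup>2"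
      proof -
        have "0 \<le> (norm (average_grad u x) - norm (pg x) / 2)\<^sup>2" by simp
        then have "(norm (average_grad u x) + norm (pg x) / 2)\<^sup>2 \<le> 2 * (norm (average_grad u x))\<^sup>2 + (norm (pg x))\<^sup>2 / 2"
          by (simp add: power2_eq_square algebra_simps)
        also have "\<dots> \<le> 2 * (norm (average_grad u x))\<^sup>2 + (norm (pg x))\<^sup>2" by simp
        finally show ?thesis .
      qed
      finally show "(norm (G x))\<^sup>2 \<le> 2 * (norm (average_grad u x))\<^sup>2 + (norm (pg x))\<^sup>2" .
    qed (use L2D(2)[OF G2] L2D(2)[OF DT2(1)] L2D(2)[OF pg2] in auto)
    then show ?thesis
      unfolding L2_nrm_sq using L2D(2)[OF DT2(1)] L2D(2)[OF pg2] by simp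
  qed
  define c where "c = (4 * poincare_const + 2 * (average_const\<^sup>2 * osc_const)) * (coercivity_const\<^sup>2 * (4 * poincare_const + 1))"
  have c0: "c \<ge> 0" using radius_poincare_const_nonneg osc_const_nonneg by (simp add: c_def)
  have "(H1_nrm \<Omega> u)\<^sup>2 = (L2_nrm \<Omega> u)\<^sup>2 + (L2_nrm \<Omega> G)\<^sup>2"
    unfolding H1_nrm_eq[OF open_domain bounded_domain G2 uw] by simp
  also have "\<dots> \<le> (4 * poincare_const + 2 * (average_const\<^sup>2 * osc_const)) * e + h\<^sup>2"
    using nu nG nDT h0(2) by (simp add: algebra_simps)
  also have "\<dots> \<le> (4 * poincare_const + 2 * (average_const\<^sup>2 * osc_const)) * (coercivity_const\<^sup>2 * (4 * poincare_const + 1) * ?d\<^sup>2) + h\<^sup>2"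
    using radius_poincare_const_nonneg osc_const_nonneg by (intro add_right_mono mult_left_mono eb) auto
  also have "\<dots> = (sqrt c * ?d)\<^sup>2 + h\<^sup>2" using c0 by (simp add: power_mult_distrib c_def)
  also have "\<dots> \<le> (sqrt c * ?d + h)\<^sup>2" using c0 d0 h0 by (simp add: power2_sum)
  finally have "H1_nrm \<Omega> u \<le> sqrt c * ?d + h" by (rule power2_le_imp_le) (use c0 d0 h0 in auto)
  also have "\<dots> \<le> regularity_const * (?d + h)"
    unfolding regularity_const_def c_def[symmetric] using c0 d0 h0 by (simp add: algebra_simps)
  finally show "H1_nrm \<Omega> u \<le> regularity_const * (?d + H1_nrm \<Omega> (\<lambda>x. inverse (Phi \<Omega> \<sigma> \<eta> 2 x) * f x))"
    unfolding peq h_def .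
qed

end

end

text \<open>Nothing is known about \<open>\<rho>\<close> on negative numbers, hence the detour through \<open>\<rho> (max 0 r)\<close>, which
  is Borel measurable.\<close>

lemma admissible_kernel_extension:
  assumes "admissible_kernel \<rho>"
  obtains \<rho>' \<rho>0 r0 B where
    "\<And>r. r \<ge> 0 \<Longrightarrow> ((\<lambda>r. \<rho> (max 0 r)) has_real_derivative \<rho>' r) (at r within {0..})"
    "continuous_on {0..} \<rho>'" "\<rho>' 0 = 0" "(\<lambda>r. \<rho> (max 0 r)) \<in> borel_measurable borel"
    "\<And>r. r \<ge> 0 \<Longrightarrow> 0 \<le> \<rho> r" "\<And>r. r \<ge> 0 \<Longrightarrow> \<rho> r \<le> B" "\<And>r. r \<ge> 0 \<Longrightarrow> \<bar>\<rho>' r\<bar> \<le> B"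
    "\<And>r. r \<ge> 1 \<Longrightarrow> \<rho> r = 0" "\<And>r. r \<ge> 1 \<Longrightarrow> \<rho>' r = 0"
    "0 < \<rho>0" "0 < r0" "r0 \<le> 1" "\<And>r. 0 \<le> r \<Longrightarrow> r \<le> r0 \<Longrightarrow> \<rho>0 \<le> \<rho> r"
proof -
  obtain \<rho>0 r0 R0 \<rho>' l where 0: "0 < \<rho>0" "0 < r0" "r0 < R0" "R0 < 1"
    and d: "\<And>r. r \<ge> 0 \<Longrightarrow> (\<rho> has_real_derivative \<rho>' r) (at r within {0..})"
    and c: "continuous_on {0..} \<rho>'" and l: "((\<lambda>r. \<rho>' r / r) \<longlongrightarrow> l) (at_right 0)"
    and nn: "\<And>r. r \<ge> 0 \<Longrightarrow> \<rho> r \<ge> 0" and s: "closure {r \<in> {0..}. \<rho> r \<noteq> 0} \<subseteq> {0..<R0}"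
    and low: "\<And>r. r \<in> {0..r0} \<Longrightarrow> \<rho> r \<ge> \<rho>0"
    using assms unfolding admissible_kernel_def by blast
  have cr: "continuous_on {0..} \<rho>"
    by (rule DERIV_continuous_on[of "{0..}" \<rho> \<rho>']) (use d in auto)
  have z: "\<rho> r = 0" if "r \<ge> R0" for r
  proof (rule ccontr)
    assume "\<rho> r \<noteq> 0"
    then have "r \<in> {r \<in> {0..}. \<rho> r \<noteq> 0}" using that 0 by auto
    then have "r \<in> {0..<R0}" by (rule subsetD[OF s, OF subsetD[OF closure_subset]])
    then show False using that by simp
  qed
  \<comment> \<open>As \<open>R0 < 1\<close>, the kernel vanishes in a neighbourhood of
    \<open>r\<close>.\<close>
  have z': "\<rho>' r = 0" if "r \<ge> 1" for r
  proof -
    have r: "r > R0" "r > 0" using that 0 by auto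
    have "(\<rho> has_real_derivative \<rho>' r) (at r)"
      using d[of r] r at_within_interior[of r "{0..}"] by (simp add: interior_real_atLeast)
    moreover have "((\<lambda>_. 0) has_real_derivative 0) (at r)" by simp
    then have "(\<rho> has_real_derivative 0) (at r)"
      by (rule has_field_derivative_transform_within_open[of _ _ _ "{R0<..}"]) (use r z in auto)
    ultimately show ?thesis by (rule DERIV_unique)
  qed
  \<comment> \<open>\<open>\<rho>' r\<close> is \<open>r\<close> times a quotient with a finite
    limit. This is what makes the radial kernel differentiable at its centre.\<close>
  have "\<rho>' 0 = 0"
  proof -
    have "((\<lambda>r. r * (\<rho>' r / r)) \<longlongrightarrow> 0 * l) (at_right 0)"
      by (intro tendsto_mult l tendsto_ident_at)
    then have "(\<rho>' \<longlongrightarrow> 0 * l) (at_right 0)"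
      by (rule Lim_transform_eventually) (auto simp: eventually_at_filter)
    moreover have "(\<rho>' \<longlongrightarrow> \<rho>' 0) (at 0 within {0..})"
      using c by (simp add: continuous_on_def)
    then have "(\<rho>' \<longlongrightarrow> \<rho>' 0) (at_right 0)"
      by (rule tendsto_within_subset) auto
    ultimately have "\<rho>' 0 = 0 * l" by (intro tendsto_unique[OF trivial_limit_at_right_real])
    then show ?thesis by simp
  qed
  note z0 = this
  have ext: "((\<lambda>r. \<rho> (max 0 r)) has_real_derivative \<rho>' r) (at r within {0..})" if "r \<ge> 0" for r
    by (rule has_field_derivative_transform_within[OF d[OF that], of 1]) (use that in \<open>auto simp: max_def\<close>)
  have meas: "(\<lambda>r. \<rho> (max 0 r)) \<in> borel_measurable borel"
    by (intro borel_measurable_continuous_onI continuous_on_compose2[OF cr]) (auto intro!: continuous_intros)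
  have "bounded (\<rho> ` {0..1})" "bounded (\<rho>' ` {0..1})"
    by (intro compact_imp_bounded compact_continuous_image continuous_on_subset[OF cr] continuous_on_subset[OF c]; simp)+
  then obtain B1 B2 where B: "\<And>r. r \<in> {0..1} \<Longrightarrow> norm (\<rho> r) \<le> B1" "\<And>r. r \<in> {0..1} \<Longrightarrow> norm (\<rho>' r) \<le> B2"
    unfolding bounded_iff by blast
  have bd: "\<rho> r \<le> max 0 (max B1 B2) \<and> \<bar>\<rho>' r\<bar> \<le> max 0 (max B1 B2)" if "r \<ge> 0" for r
  proof (cases "r \<le> 1")
    case True
    then show ?thesis using B[of r] that by auto
  next
    case False
    then show ?thesis using z[of r] z'[of r] 0 by simp
  qed
  show ?thesis
  proof (rule that[of \<rho>' "max 0 (max B1 B2)" \<rho>0 r0])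
    show "\<rho> r = 0" if "r \<ge> 1" for r using z[of r] that 0 by simp
    show "\<rho>0 \<le> \<rho> r" if "0 \<le> r" "r \<le> r0" for r using low that by simp
    show "r0 \<le> 1" using 0 by simp
  qed (fact ext c z0 meas nn z' 0 | (use bd in blast))+
qed

text \<open>The three entries of \<open>delta0\<close> are matched to three bounds: \<delta> < 1
  gives \<open>\<eta> x \<le> \<kappa>b\<close>, the 9 gives the gradient bound 1/3, and the 2 gives
  \<open>\<kappa>b * sqrt \<delta>\<close> at most 1 / sqrt 2, which is rounded up to 3/4.\<close>

lemma localized_domain_localization_function:
  fixes \<Omega> :: "'a::euclidean_space set"
  assumes \<Omega>: "open \<Omega>" "bounded \<Omega>" and \<kappa>: "0 < \<kappa>1" "0 < \<kappa>b"
    and \<delta>: "0 < \<delta>" "\<delta> < delta0 \<kappa>1 \<kappa>b" and \<eta>: "localization_function \<Omega> \<kappa>0 \<kappa>1 \<kappa>2 \<kappa>b \<delta> \<eta>"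
  shows "\<exists>g. localized_domain \<Omega> \<eta> g" "\<And>x. x \<in> \<Omega> \<Longrightarrow> \<eta> x \<le> \<kappa>b"
proof -
  have d: "\<delta> < 1" "\<delta> < 1 / (9 * \<kappa>1\<^sup>2)" "\<delta> < 1 / (2 * \<kappa>b\<^sup>2)"
    using \<delta>(2) by (auto simp: delta0_def)
  obtain g H where g: "C2_closure \<Omega> \<eta> g H" "\<And>x. x \<in> \<Omega> \<Longrightarrow> norm (g x) \<le> \<kappa>1 * sqrt \<delta>"
    using \<eta> unfolding localization_function_def by blast
  have up: "\<eta> x \<le> \<kappa>b * min \<delta> ((infdist x (frontier \<Omega>))\<^sup>2)" if "x \<in> \<Omega>" for x
    using \<eta> that unfolding localization_function_def by blast
  show "\<eta> x \<le> \<kappa>b" if "x \<in> \<Omega>" for x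
  proof -
    have "\<kappa>b * min \<delta> ((infdist x (frontier \<Omega>))\<^sup>2) \<le> \<kappa>b * 1" using d(1) \<kappa> by (intro mult_left_mono) auto
    then show ?thesis using up[OF that] by simp
  qed
  have "localized_domain \<Omega> \<eta> g"
  proof
    show "open \<Omega>" "bounded \<Omega>" by fact+
    show "C1_grad \<Omega> \<eta> g"
      using g(1) closure_subset[of \<Omega>] unfolding C2_closure_def C1_grad_def by (auto intro: continuous_on_subset)
    fix x assume x: "x \<in> \<Omega>"
    show "0 < \<eta> x" using \<eta> x unfolding localization_function_def by blast
    have "(\<kappa>1 * sqrt \<delta>)\<^sup>2 \<le> (1/3)\<^sup>2"
      using d(2) \<delta>(1) \<kappa> by (simp add: power_mult_distrib field_simps power2_eq_square)
    then have "\<kappa>1 * sqrt \<delta> \<le> 1/3" by (rule power2_le_imp_le) simp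
    then show "norm (g x) \<le> 1/3" using g(2)[OF x] by linarith
    let ?d = "infdist x (frontier \<Omega>)"
    have d0: "?d \<ge> 0" by (rule infdist_nonneg)
    \<comment> \<open>The minimum of two numbers is at most their geometric mean; one factor
      \<open>?d\<close> survives while the other is exchanged for the small
      \<open>sqrt \<delta>\<close>.\<close>
    have "min \<delta> (?d\<^sup>2) \<le> sqrt \<delta> * ?d"
    proof (cases "sqrt \<delta> \<le> ?d")
      case True
      have "\<delta> = sqrt \<delta> * sqrt \<delta>" using \<delta>(1) by simp
      also have "\<dots> \<le> sqrt \<delta> * ?d" using True \<delta>(1) by (intro mult_left_mono) auto
      finally show ?thesis by simp
    next
      case False
      then have "?d\<^sup>2 \<le> sqrt \<delta> * ?d" using d0 unfolding power2_eq_square by (intro mult_right_mono) auto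
      then show ?thesis by simp
    qed
    then have "\<eta> x \<le> \<kappa>b * (sqrt \<delta> * ?d)" using up[OF x] \<kappa>(2) by (meson mult_left_mono less_imp_le order_trans)
    moreover have "\<kappa>b * sqrt \<delta> \<le> 3/4"
    proof (rule power2_le_imp_le)
      have "\<kappa>b\<^sup>2 * \<delta> \<le> 1/2" using d(3) \<kappa> by (simp add: field_simps)
      then show "(\<kappa>b * sqrt \<delta>)\<^sup>2 \<le> (3/4)\<^sup>2" using \<delta>(1) by (simp add: power_mult_distrib power_divide)
    qed simp
    then have "\<kappa>b * sqrt \<delta> * ?d \<le> 3/4 * ?d" using d0 by (rule mult_right_mono)
    ultimately show "\<eta> x \<le> 3/4 * infdist x (frontier \<Omega>)" by (simp add: mult.assoc)
  qed
  then show "\<exists>g. localized_domain \<Omega> \<eta> g" by (rule exI[of "localized_domain \<Omega> \<eta>"])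
qed

theorem theorem1p3:
  fixes \<Omega> :: "'a::euclidean_space set"
    and \<kappa>0 \<kappa>1 \<kappa>2 \<kappa>b R :: real
    and \<rho> :: "real \<Rightarrow> real"
  assumes "bounded_C2_domain \<Omega>"
    and "0 < \<kappa>0" "\<kappa>0 < 1" "0 < \<kappa>1" "0 < \<kappa>2" "0 < \<kappa>b"
    and "0 < R" "R < 1"
    and "admissible_kernel \<rho>"
  shows "\<exists>C>0. \<forall>\<eta>. localization_family \<Omega> \<kappa>0 \<kappa>1 \<kappa>2 \<kappa>b \<eta> \<longrightarrow>
    (\<forall>\<delta> f u. 0 < \<delta> \<and> \<delta> < delta0 \<kappa>1 \<kappa>b \<and> f \<in> H1 \<Omega> \<and> weak_solution \<Omega> R \<rho> (\<eta> \<delta>) f u \<longrightarrow>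
       u \<in> H1 \<Omega> \<and> (\<lambda>x. inverse (Phi \<Omega> \<rho> (\<eta> \<delta>) 2 x) * f x) \<in> H1 \<Omega> \<and>
       H1_nrm \<Omega> u \<le> C * (W0_dual_nrm \<Omega> R (\<eta> \<delta>) f +
         H1_nrm \<Omega> (\<lambda>x. inverse (Phi \<Omega> \<rho> (\<eta> \<delta>) 2 x) * f x)))"
proof -
  have \<Omega>: "open \<Omega>" "bounded \<Omega>" using assms(1) by (auto simp: bounded_C2_domain_def)
  obtain D where D: "\<And>x. x \<in> \<Omega> \<Longrightarrow> norm x \<le> D" using \<Omega>(2) by (auto simp: bounded_iff)
  obtain \<rho>' \<rho>0 r0 B where \<rho>:
    "\<And>r. r \<ge> 0 \<Longrightarrow> ((\<lambda>r. \<rho> (max 0 r)) has_real_derivative \<rho>' r) (at r within {0..})"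
    "continuous_on {0..} \<rho>'" "\<rho>' 0 = 0" "(\<lambda>r. \<rho> (max 0 r)) \<in> borel_measurable borel"
    "\<And>r. r \<ge> 0 \<Longrightarrow> 0 \<le> \<rho> r" "\<And>r. r \<ge> 0 \<Longrightarrow> \<rho> r \<le> B" "\<And>r. r \<ge> 0 \<Longrightarrow> \<bar>\<rho>' r\<bar> \<le> B"
    "\<And>r. r \<ge> 1 \<Longrightarrow> \<rho> r = 0" "\<And>r. r \<ge> 1 \<Longrightarrow> \<rho>' r = 0"
    "0 < \<rho>0" "0 < r0" "r0 \<le> 1" "\<And>r. 0 \<le> r \<Longrightarrow> r \<le> r0 \<Longrightarrow> \<rho>0 \<le> \<rho> r"
    by (rule admissible_kernel_extension[OF assms(9)]) (rule that; assumption)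
  \<comment> \<open>Outside the locale the constant is a function of the listed parameters only.
    Neither \<open>\<eta>\<close> nor \<delta> is among them, so \<open>C\<close> is fixed before
    both.\<close>
  define C where "C = nonlocal_estimate.regularity_const TYPE('a) \<rho>0 r0 B D \<kappa>b"
  have main: "u \<in> H1 \<Omega> \<and> (\<lambda>x. inverse (Phi \<Omega> \<rho> (\<eta> \<delta>) 2 x) * f x) \<in> H1 \<Omega> \<and>
       H1_nrm \<Omega> u \<le> max 1 C * (W0_dual_nrm \<Omega> R (\<eta> \<delta>) f + H1_nrm \<Omega> (\<lambda>x. inverse (Phi \<Omega> \<rho> (\<eta> \<delta>) 2 x) * f x))"
    if fam: "localization_family \<Omega> \<kappa>0 \<kappa>1 \<kappa>2 \<kappa>b \<eta>" and \<delta>: "0 < \<delta>" "\<delta> < delta0 \<kappa>1 \<kappa>b"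
      and f: "f \<in> H1 \<Omega>" and w: "weak_solution \<Omega> R \<rho> (\<eta> \<delta>) f u" for \<eta> \<delta> f u
  proof -
    have lf: "localization_function \<Omega> \<kappa>0 \<kappa>1 \<kappa>2 \<kappa>b \<delta> (\<eta> \<delta>)"
      using fam \<delta> unfolding localization_family_def by blast
    note L = localized_domain_localization_function[OF \<Omega> assms(4,6) \<delta> lf]
    obtain g where "localized_domain \<Omega> (\<eta> \<delta>) g" using L(1) by blast
    then interpret localized_domain \<Omega> "\<eta> \<delta>" g .
    interpret nonlocal_estimate \<Omega> "\<eta> \<delta>" g "\<lambda>r. \<rho> (max 0 r)" \<rho>' \<rho>0 r0 B R D \<kappa>b
      by unfold_locales (use \<rho> D L(2) assms in \<open>simp_all add: max_def\<close>)
    have \<sigma>: "\<rho> r = \<rho> (max 0 r)" if "r \<ge> 0" for r using that by (simp add: max_def)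
    have f2: "f \<in> L2 \<Omega>" using f by (simp add: H1_def)
    have "0 \<le> W0_dual_nrm \<Omega> R (\<eta> \<delta>) f" by (rule weak_solution_energy(2)[OF \<sigma> f2 w])
    moreover have "0 \<le> H1_nrm \<Omega> v" for v by (simp add: H1_nrm_def)
    \<comment> \<open>Enlarging \<open>C\<close> to \<open>max 1 C\<close>, for the sake of
      positivity, is harmless because both norms on the right are nonnegative.\<close>
    ultimately have "C * (W0_dual_nrm \<Omega> R (\<eta> \<delta>) f + H1_nrm \<Omega> (\<lambda>x. inverse (Phi \<Omega> \<rho> (\<eta> \<delta>) 2 x) * f x)) \<le>
       max 1 C * (W0_dual_nrm \<Omega> R (\<eta> \<delta>) f + H1_nrm \<Omega> (\<lambda>x. inverse (Phi \<Omega> \<rho> (\<eta> \<delta>) 2 x) * f x))"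
      by (intro mult_right_mono add_nonneg_nonneg) auto
    with regularity_estimate[OF \<sigma> f w] show ?thesis
      unfolding C_def by (meson order_trans)
  qed
  show ?thesis
  proof (intro exI[of _ "max 1 C"] conjI[of "0 < max 1 C"] allI impI)
    show "0 < max 1 C" by simp
  qed (elim conjE, rule main)
qed

end
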